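(* Let $\alpha\geq \omega$ be an ordinal. Let $\mathfrak{A}_0\in \mathbf{Dc}_{\alpha}$, $\mathfrak{A}_1,\mathfrak{A}_2\in \mathbf{RCA}_{\alpha}$ and let $f:\mathfrak{A}_0\to \mathfrak{A}_1$ and $g:\mathfrak{A}_0\to \mathfrak{A}_2$ be monomorphisms. Then there exist $\mathfrak{D}\in \mathfrak{Nr}_{\alpha}\mathbf{CA}_{\alpha+\omega}$ and monomorphisms $m:\mathfrak{A}_1\to \mathfrak{D}$ and $n:\mathfrak{A}_2\to \mathfrak{D}$ such that $m\circ f=n\circ g$. Furthermore $\mathfrak{D}$ is a super amalgam, that is: for all $a\in A_1$ and $b\in A_2$, if $m(a)\le n(b)$ then there is $t\in A_0$ with $a\le f(t)$ and $g(t)\le b$; and if $n(b)\le m(a)$ then there is $t\in A_0$ with $b\le g(t)$ and $f(t)\le a$.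
   Context: For an ordinal $\gamma$, $\mathbf{CA}_\gamma$ is the class of cylindric algebras of dimension $\gamma$: algebras $(A,+,\cdot,-,0,1,\mathsf{c}_i,\mathsf{d}_{ij})_{i,j<\gamma}$ such that $(A,+,\cdot,-,0,1)$ is a Boolean algebra and for all $x,y\in A$, $i,j,k<\gamma$: $\mathsf{c}_i0=0$; $x\le \mathsf{c}_ix$; $\mathsf{c}_i(x\cdot \mathsf{c}_iy)=\mathsf{c}_ix\cdot \mathsf{c}_iy$; $\mathsf{c}_i\mathsf{c}_jx=\mathsf{c}_j\mathsf{c}_ix$; $\mathsf{d}_{ii}=1$; if $k\ne i,j$ then $\mathsf{d}_{ij}=\mathsf{c}_k(\mathsf{d}_{ik}\cdot \mathsf{d}_{kj})$; if $i\neq j$ then $\mathsf{c}_i(\mathsf{d}_{ij}\cdot x)\cdot \mathsf{c}_i(\mathsf{d}_{ij}\cdot -x)=0$. $\le$ is the Boolean order. $\mathbf{Dc}_\alpha$ is the class of dimension complemented algebras: those $\mathfrak{A}\in\mathbf{CA}_\alpha$ with $\Delta x\ne\alpha$ for all $x\in A$, where $\Delta x=\{i<\alpha:\mathsf{c}_ix\ne x\}$. $\mathbf{RCA}_\alpha$ is the class of representable cylindric algebras of dimension $\alpha$: algebras isomorphic to a subalgebra of a product of full cylindric set algebras $\wp({}^{\alpha}U)$, where $\mathsf{c}_iX=\{s\in{}^\alpha U: \exists t\in X,\ t_j=s_j \text{ for all } j\ne i\}$ and $\mathsf{d}_{ij}=\{s\in{}^\alpha U:s_i=s_j\}$. For $\mathfrak{B}\in\mathbf{CA}_\beta$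 with $\beta>\alpha$, $\mathfrak{Nr}_\alpha\mathfrak{B}\in\mathbf{CA}_\alpha$ (the neat $\alpha$-reduct) has universe $\{x\in B:\mathsf{c}_ix=x\text{ for all } \alpha\le i<\beta\}$, with the Boolean operations and $\mathsf{c}_i,\mathsf{d}_{ij}$ ($i,j<\alpha$) of $\mathfrak{B}$; $\mathfrak{Nr}_\alpha\mathbf{CA}_{\alpha+\omega}=\{\mathfrak{Nr}_\alpha\mathfrak{B}:\mathfrak{B}\in\mathbf{CA}_{\alpha+\omega}\}$. Monomorphisms are injective homomorphisms. *)

theory Defs
  imports Main "HOL-Library.FuncSet"
begin

text \<open>
  An ordinal is a well-order \<open>\<alpha> :: 'i rel\<close>; the elements of \<open>Field \<alpha>\<close> play the role of the
  ordinals \<open>i < \<alpha>\<close>. The well-order \<open>natLeq\<close> is \<open>\<omega>\<close>.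
\<close>

definition ord_sum :: "'i rel \<Rightarrow> 'j rel \<Rightarrow> ('i + 'j) rel" where
  "ord_sum \<alpha> \<gamma> =
     {(Inl i, Inl i') | i i'. (i, i') \<in> \<alpha>} \<union>
     {(Inr j, Inr j') | j j'. (j, j') \<in> \<gamma>} \<union>
     {(Inl i, Inr j) | i j. i \<in> Field \<alpha> \<and> j \<in> Field \<gamma>}"

lemma ord_sum_iffs:
  "(Inl i, Inl i') \<in> ord_sum \<alpha> \<gamma> \<longleftrightarrow> (i, i') \<in> \<alpha>"
  "(Inr j, Inr j') \<in> ord_sum \<alpha> \<gamma> \<longleftrightarrow> (j, j') \<in> \<gamma>"
  "(Inl i, Inr j) \<in> ord_sum \<alpha> \<gamma> \<longleftrightarrow> i \<in> Field \<alpha> \<and> j \<in> Field \<gamma>"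
  "(Inr j, Inl i) \<notin> ord_sum \<alpha> \<gamma>"
  unfolding ord_sum_def by auto

lemma Field_ord_sum: "Field (ord_sum \<alpha> \<gamma>) = Inl ` Field \<alpha> \<union> Inr ` Field \<gamma>"
proof
  show "Field (ord_sum \<alpha> \<gamma>) \<subseteq> Inl ` Field \<alpha> \<union> Inr ` Field \<gamma>"
    unfolding ord_sum_def by (auto simp: Field_def)
  show "Inl ` Field \<alpha> \<union> Inr ` Field \<gamma> \<subseteq> Field (ord_sum \<alpha> \<gamma>)"
  proof (intro Un_least image_subsetI)
    show "Inl i \<in> Field (ord_sum \<alpha> \<gamma>)" if "i \<in> Field \<alpha>" for i
      using that unfolding Field_def Domain_iff Range_iff Un_iff using ord_sum_iffs(1)[of _ _ \<alpha> \<gamma>] by meson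
    show "Inr j \<in> Field (ord_sum \<alpha> \<gamma>)" if "j \<in> Field \<gamma>" for j
      using that unfolding Field_def Domain_iff Range_iff Un_iff using ord_sum_iffs(2)[of _ _ \<alpha> \<gamma>] by meson
  qed
qed

lemma Well_order_ord_sum:
  assumes \<alpha>: "Well_order \<alpha>" and \<gamma>: "Well_order \<gamma>"
  shows "Well_order (ord_sum \<alpha> \<gamma>)"
proof -
  let ?s = "ord_sum \<alpha> \<gamma>"
  have o: "refl_on (Field \<alpha>) \<alpha>" "antisym \<alpha>" "trans \<alpha>" "total_on (Field \<alpha>) \<alpha>" "wf (\<alpha> - Id)"
    using \<alpha> unfolding order_on_defs by blast+
  have o': "refl_on (Field \<gamma>) \<gamma>" "antisym \<gamma>" "trans \<gamma>" "total_on (Field \<gamma>) \<gamma>" "wf (\<gamma> - Id)"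
    using \<gamma> unfolding order_on_defs by blast+
  have refl: "refl_on (Field ?s) ?s"
    unfolding Field_ord_sum using o(1) o'(1)
    by (intro refl_onI) (auto simp: ord_sum_iffs refl_on_def)
  have antisym: "antisym ?s"
  proof (rule antisymI)
    fix x y assume "(x, y) \<in> ?s" "(y, x) \<in> ?s"
    then show "x = y"
      by (cases x; cases y; simp add: ord_sum_iffs antisymD[OF o(2)] antisymD[OF o'(2)])
  qed
  have trans: "trans ?s"
  proof (rule transI)
    fix x y z assume "(x, y) \<in> ?s" "(y, z) \<in> ?s"
    then show "(x, z) \<in> ?s"
      by (cases x; cases y; cases z; simp add: ord_sum_iffs)
        (metis transD[OF o(3)] transD[OF o'(3)] FieldI1 FieldI2)+
  qed
  have total: "total_on (Field ?s) ?s"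
  proof (rule total_onI)
    fix x y assume "x \<in> Field ?s" "y \<in> Field ?s" "x \<noteq> y"
    then show "(x, y) \<in> ?s \<or> (y, x) \<in> ?s"
      using o(4) o'(4) unfolding total_on_def Field_ord_sum
      by (elim UnE imageE; simp add: ord_sum_iffs)
  qed
  have wf: "wf (?s - Id)"
  proof (rule wfI_min)
    fix x and Q :: "('a + 'b) set"
    assume "x \<in> Q"
    show "\<exists>z\<in>Q. \<forall>y. (y, z) \<in> ?s - Id \<longrightarrow> y \<notin> Q"
    proof (cases "\<exists>i. Inl i \<in> Q")
      case True
      then obtain i where "i \<in> Inl -` Q" by auto
      from wfE_min[OF o(5) this] obtain m where m: "m \<in> Inl -` Q"
        and min: "\<And>y. (y, m) \<in> \<alpha> - Id \<Longrightarrow> y \<notin> Inl -` Q" by metis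
      have "y \<notin> Q" if "(y, Inl m) \<in> ?s - Id" for y
        using that min by (cases y) (auto simp: ord_sum_iffs)
      with m show ?thesis by blast
    next
      case False
      with \<open>x \<in> Q\<close> obtain j where "j \<in> Inr -` Q" by (cases x) auto
      from wfE_min[OF o'(5) this] obtain m where m: "m \<in> Inr -` Q"
        and min: "\<And>y. (y, m) \<in> \<gamma> - Id \<Longrightarrow> y \<notin> Inr -` Q" by metis
      have "y \<notin> Q" if "(y, Inr m) \<in> ?s - Id" for y
        using that min False by (cases y) (auto simp: ord_sum_iffs)
      with m show ?thesis by blast
    qed
  qed
  have "?s \<subseteq> Field ?s \<times> Field ?s"
    by (meson FieldI1 FieldI2 SigmaI subrelI)
  with refl antisym trans total wf show ?thesis
    unfolding order_on_defs by blast
qed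

record ('a, 'i) cyl_alg =
  carrier :: "'a set"
  add :: "'a \<Rightarrow> 'a \<Rightarrow> 'a" (infixl "\<oplus>\<index>" 65)
  mult :: "'a \<Rightarrow> 'a \<Rightarrow> 'a" (infixl "\<otimes>\<index>" 70)
  neg :: "'a \<Rightarrow> 'a" ("\<ominus>\<index> _" [81] 80)
  zero :: 'a ("\<zero>\<index>")
  one :: 'a ("\<one>\<index>")
  cyl :: "'i \<Rightarrow> 'a \<Rightarrow> 'a" ("\<c>\<index>")
  diag :: "'i \<Rightarrow> 'i \<Rightarrow> 'a" ("\<d>\<index>")

definition le :: "('a, 'i) cyl_alg \<Rightarrow> 'a \<Rightarrow> 'a \<Rightarrow> bool" (infix "\<sqsubseteq>\<index>" 50) where
  "x \<sqsubseteq>\<^bsub>A\<^esub> y \<longleftrightarrow> x \<oplus>\<^bsub>A\<^esub> y = y"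

text \<open>
  An algebra of the similarity type of \<open>CA\<^sub>\<alpha>\<close>: the carrier is closed under the operations. The
  values of the operations off the carrier and off \<open>Field \<alpha>\<close> are irrelevant.
\<close>

locale cyl_type_algebra =
  fixes \<alpha> :: "'i rel" and A :: "('a, 'i) cyl_alg" (structure)
  assumes add_closed: "x \<in> carrier A \<Longrightarrow> y \<in> carrier A \<Longrightarrow> x \<oplus> y \<in> carrier A"
    and mult_closed: "x \<in> carrier A \<Longrightarrow> y \<in> carrier A \<Longrightarrow> x \<otimes> y \<in> carrier A"
    and neg_closed: "x \<in> carrier A \<Longrightarrow> \<ominus> x \<in> carrier A"
    and zero_closed: "\<zero> \<in> carrier A"
    and one_closed: "\<one> \<in> carrier A"
    and cyl_closed: "i \<in> Field \<alpha> \<Longrightarrow> x \<in> carrier A \<Longrightarrow> \<c> i x \<in> carrier A"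
    and diag_closed: "i \<in> Field \<alpha> \<Longrightarrow> j \<in> Field \<alpha> \<Longrightarrow> \<d> i j \<in> carrier A"

text \<open>
  The Boolean axioms are those of \<open>abstract_boolean_algebra\<close>, relativised to the carrier. The
  one-element algebra is allowed.
\<close>

locale cylindric_algebra = cyl_type_algebra +
  assumes add_assoc: "\<lbrakk>x \<in> carrier A; y \<in> carrier A; z \<in> carrier A\<rbrakk> \<Longrightarrow> (x \<oplus> y) \<oplus> z = x \<oplus> (y \<oplus> z)"
    and mult_assoc: "\<lbrakk>x \<in> carrier A; y \<in> carrier A; z \<in> carrier A\<rbrakk> \<Longrightarrow> (x \<otimes> y) \<otimes> z = x \<otimes> (y \<otimes> z)"
    and add_commute: "\<lbrakk>x \<in> carrier A; y \<in> carrier A\<rbrakk> \<Longrightarrow> x \<oplus> y = y \<oplus> x"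
    and mult_commute: "\<lbrakk>x \<in> carrier A; y \<in> carrier A\<rbrakk> \<Longrightarrow> x \<otimes> y = y \<otimes> x"
    and mult_add_distrib: "\<lbrakk>x \<in> carrier A; y \<in> carrier A; z \<in> carrier A\<rbrakk> \<Longrightarrow>
      x \<otimes> (y \<oplus> z) = (x \<otimes> y) \<oplus> (x \<otimes> z)"
    and add_mult_distrib: "\<lbrakk>x \<in> carrier A; y \<in> carrier A; z \<in> carrier A\<rbrakk> \<Longrightarrow>
      x \<oplus> (y \<otimes> z) = (x \<oplus> y) \<otimes> (x \<oplus> z)"
    and add_zero: "x \<in> carrier A \<Longrightarrow> x \<oplus> \<zero> = x"
    and mult_one: "x \<in> carrier A \<Longrightarrow> x \<otimes> \<one> = x"
    and add_neg: "x \<in> carrier A \<Longrightarrow> x \<oplus> (\<ominus> x) = \<one>"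
    and mult_neg: "x \<in> carrier A \<Longrightarrow> x \<otimes> (\<ominus> x) = \<zero>"
    and cyl_zero: "i \<in> Field \<alpha> \<Longrightarrow> \<c> i \<zero> = \<zero>"
    and cyl_extensive: "\<lbrakk>i \<in> Field \<alpha>; x \<in> carrier A\<rbrakk> \<Longrightarrow> x \<sqsubseteq> \<c> i x"
    and cyl_mult: "\<lbrakk>i \<in> Field \<alpha>; x \<in> carrier A; y \<in> carrier A\<rbrakk> \<Longrightarrow>
      \<c> i (x \<otimes> \<c> i y) = \<c> i x \<otimes> \<c> i y"
    and cyl_commute: "\<lbrakk>i \<in> Field \<alpha>; j \<in> Field \<alpha>; x \<in> carrier A\<rbrakk> \<Longrightarrow>
      \<c> i (\<c> j x) = \<c> j (\<c> i x)"
    and diag_refl: "i \<in> Field \<alpha> \<Longrightarrow> \<d> i i = \<one>"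
    and diag_cyl: "\<lbrakk>i \<in> Field \<alpha>; j \<in> Field \<alpha>; k \<in> Field \<alpha>; k \<noteq> i; k \<noteq> j\<rbrakk> \<Longrightarrow>
      \<d> i j = \<c> k (\<d> i k \<otimes> \<d> k j)"
    and cyl_diag_neg: "\<lbrakk>i \<in> Field \<alpha>; j \<in> Field \<alpha>; i \<noteq> j; x \<in> carrier A\<rbrakk> \<Longrightarrow>
      \<c> i (\<d> i j \<otimes> x) \<otimes> \<c> i (\<d> i j \<otimes> (\<ominus> x)) = \<zero>"

definition CA :: "'i rel \<Rightarrow> ('a, 'i) cyl_alg set" where
  "CA \<alpha> = {A. cylindric_algebra \<alpha> A}"

definition dim_set :: "'i rel \<Rightarrow> ('a, 'i) cyl_alg \<Rightarrow> 'a \<Rightarrow> 'i set" where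
  "dim_set \<alpha> A x = {i \<in> Field \<alpha>. \<c>\<^bsub>A\<^esub> i x \<noteq> x}"

definition Dc :: "'i rel \<Rightarrow> ('a, 'i) cyl_alg set" where
  "Dc \<alpha> = {A \<in> CA \<alpha>. \<forall>x\<in>carrier A. dim_set \<alpha> A x \<noteq> Field \<alpha>}"

definition homomorphism ::
    "'i rel \<Rightarrow> ('a, 'i) cyl_alg \<Rightarrow> ('b, 'i) cyl_alg \<Rightarrow> ('a \<Rightarrow> 'b) \<Rightarrow> bool" where
  "homomorphism \<alpha> A B h \<longleftrightarrow>
     h \<in> carrier A \<rightarrow> carrier B \<and>
     (\<forall>x\<in>carrier A. \<forall>y\<in>carrier A. h (x \<oplus>\<^bsub>A\<^esub> y) = h x \<oplus>\<^bsub>B\<^esub> h y) \<and>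
     (\<forall>x\<in>carrier A. \<forall>y\<in>carrier A. h (x \<otimes>\<^bsub>A\<^esub> y) = h x \<otimes>\<^bsub>B\<^esub> h y) \<and>
     (\<forall>x\<in>carrier A. h (\<ominus>\<^bsub>A\<^esub> x) = \<ominus>\<^bsub>B\<^esub> (h x)) \<and>
     h \<zero>\<^bsub>A\<^esub> = \<zero>\<^bsub>B\<^esub> \<and>
     h \<one>\<^bsub>A\<^esub> = \<one>\<^bsub>B\<^esub> \<and>
     (\<forall>i\<in>Field \<alpha>. \<forall>x\<in>carrier A. h (\<c>\<^bsub>A\<^esub> i x) = \<c>\<^bsub>B\<^esub> i (h x)) \<and>
     (\<forall>i\<in>Field \<alpha>. \<forall>j\<in>Field \<alpha>. h (\<d>\<^bsub>A\<^esub> i j) = \<d>\<^bsub>B\<^esub> i j)"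

definition monomorphism ::
    "'i rel \<Rightarrow> ('a, 'i) cyl_alg \<Rightarrow> ('b, 'i) cyl_alg \<Rightarrow> ('a \<Rightarrow> 'b) \<Rightarrow> bool" where
  "monomorphism \<alpha> A B h \<longleftrightarrow> homomorphism \<alpha> A B h \<and> inj_on h (carrier A)"

definition isomorphic :: "'i rel \<Rightarrow> ('a, 'i) cyl_alg \<Rightarrow> ('b, 'i) cyl_alg \<Rightarrow> bool" where
  "isomorphic \<alpha> A B \<longleftrightarrow> (\<exists>h. homomorphism \<alpha> A B h \<and> bij_betw h (carrier A) (carrier B))"

definition subalgebra :: "'i rel \<Rightarrow> ('a, 'i) cyl_alg \<Rightarrow> ('a, 'i) cyl_alg \<Rightarrow> bool" where
  "subalgebra \<alpha> S A \<longleftrightarrow>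
     (\<exists>X \<subseteq> carrier A. S = A\<lparr>carrier := X\<rparr>) \<and> cyl_type_algebra \<alpha> S"

definition full_set_algebra :: "'i rel \<Rightarrow> 'u set \<Rightarrow> (('i \<Rightarrow> 'u) set, 'i) cyl_alg" where
  "full_set_algebra \<alpha> U =
     (let V = Field \<alpha> \<rightarrow>\<^sub>E U in
      \<lparr>carrier = Pow V,
       add = (\<union>),
       mult = (\<inter>),
       neg = (\<lambda>X. V - X),
       zero = {},
       one = V,
       cyl = (\<lambda>i X. {s \<in> V. \<exists>t\<in>X. \<forall>j\<in>Field \<alpha>. j \<noteq> i \<longrightarrow> t j = s j}),
       diag = (\<lambda>i j. {s \<in> V. s i = s j})\<rparr>)"

definition product_algebra ::
    "'k set \<Rightarrow> ('k \<Rightarrow> ('a, 'i) cyl_alg) \<Rightarrow> ('k \<Rightarrow> 'a, 'i) cyl_alg" where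
  "product_algebra K A =
     \<lparr>carrier = (\<Pi>\<^sub>E k\<in>K. carrier (A k)),
      add = (\<lambda>x y. \<lambda>k\<in>K. x k \<oplus>\<^bsub>A k\<^esub> y k),
      mult = (\<lambda>x y. \<lambda>k\<in>K. x k \<otimes>\<^bsub>A k\<^esub> y k),
      neg = (\<lambda>x. \<lambda>k\<in>K. \<ominus>\<^bsub>A k\<^esub> (x k)),
      zero = (\<lambda>k\<in>K. \<zero>\<^bsub>A k\<^esub>),
      one = (\<lambda>k\<in>K. \<one>\<^bsub>A k\<^esub>),
      cyl = (\<lambda>i x. \<lambda>k\<in>K. \<c>\<^bsub>A k\<^esub> i (x k)),
      diag = (\<lambda>i j. \<lambda>k\<in>K. \<d>\<^bsub>A k\<^esub> i j)\<rparr>"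

text \<open>
  The factors of the product are indexed by a set in the type \<open>'k\<close> and have base sets in the type
  \<open>'u\<close>. HOL has no quantifier over types, so these types are parameters. In a hypothesis
  \<open>A \<in> RCA TYPE('k) TYPE('u) \<alpha>\<close> of a theorem in which \<open>'k\<close> and \<open>'u\<close> occur nowhere else, the type
  variables are implicitly universally quantified, so the hypothesis says that \<open>A\<close> is
  representable, without any bound on the size of the representation.
\<close>

definition RCA :: "'k itself \<Rightarrow> 'u itself \<Rightarrow> 'i rel \<Rightarrow> ('a, 'i) cyl_alg set" where
  "RCA _ _ \<alpha> = {A. cyl_type_algebra \<alpha> A \<and>
     (\<exists>(K :: 'k set) (U :: 'k \<Rightarrow> 'u set) S.
        subalgebra \<alpha> S (product_algebra K (\<lambda>k. full_set_algebra \<alpha> (U k))) \<and>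
        isomorphic \<alpha> A S)}"

text \<open>
  Every ordinal \<open>\<beta> > \<alpha>\<close> is \<open>\<alpha> + \<gamma>\<close> for a unique \<open>\<gamma> > 0\<close>; the indices \<open>i\<close> with \<open>\<alpha> \<le> i < \<beta>\<close> are then
  the \<open>Inr k\<close> with \<open>k \<in> Field \<gamma>\<close>.
\<close>

definition neat_reduct ::
    "'i rel \<Rightarrow> 'j rel \<Rightarrow> ('a, 'i + 'j) cyl_alg \<Rightarrow> ('a, 'i) cyl_alg" where
  "neat_reduct \<alpha> \<gamma> B =
     \<lparr>carrier = {x \<in> carrier B. \<forall>k\<in>Field \<gamma>. \<c>\<^bsub>B\<^esub> (Inr k) x = x},
      add = add B,
      mult = mult B,
      neg = neg B,
      zero = zero B,
      one = one B,
      cyl = (\<lambda>i. \<c>\<^bsub>B\<^esub> (Inl i)),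
      diag = (\<lambda>i j. \<d>\<^bsub>B\<^esub> (Inl i) (Inl j))\<rparr>"

definition Nr_CA :: "'i rel \<Rightarrow> 'j rel \<Rightarrow> ('a, 'i) cyl_alg set" where
  "Nr_CA \<alpha> \<gamma> = {neat_reduct \<alpha> \<gamma> B | B. B \<in> CA (ord_sum \<alpha> \<gamma>)}"

text \<open>
  An existence statement about algebras has to name the type that contains the carrier. If
  \<open>A\<^sub>1\<close> and \<open>A\<^sub>2\<close> embed in the neat reduct of an algebra \<open>B\<close> of dimension \<open>\<alpha> + \<omega>\<close>, they embed in the
  neat reduct of the subalgebra of \<open>B\<close> that their images generate. Its elements are values of terms,
  which are finite words over \<open>A\<^sub>1\<close>, \<open>A\<^sub>2\<close>, the indices and finitely many further symbols, so it has an
  isomorphic copy with carrier in the following type. Hence this choice does not restrict generality.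
\<close>

type_synonym ('a, 'b, 'i) amalgam = "('a + 'b + 'i + nat) list"

end

theory Submission
  imports Defs
begin

text \<open>
  Read the elements of \<open>A1\<close> and \<open>A2\<close> as formulas with variables in \<open>\<alpha>\<close>, and those of \<open>A0\<close> as the
  formulas of the common language. The super amalgam is then Craig interpolation, and it suffices
  to show: if \<open>a\<close> and \<open>b\<close> have no interpolant in \<open>A0\<close>, there are homomorphisms of \<open>A1\<close> and \<open>A2\<close> into
  one cylindric set algebra that agree on \<open>A0\<close> and send \<open>a\<close> not below \<open>b\<close>. The product of these
  algebras over all such pairs has the interpolation property in one direction. Complements give the
  other direction, and interpolation against zero shows that the homomorphisms are injective.

  Such a pair of homomorphisms comes from a Henkin construction. The variables are extended by
  witnesses, with sequences in the given representations of \<open>A1\<close> and \<open>A2\<close> now indexed by old and new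
  variables. Substitution along any map of variables is then simply composition, and no abstract
  theory of substitutions is needed for \<open>A1\<close> and \<open>A2\<close>. The relations on the new sequences that
  belong to \<open>A0\<close> form a Boolean algebra closed under quantification (\<open>definable_project\<close>) whose
  members specialise to elements of \<open>A0\<close>. Both facts rest on dimension complementation: finitely many
  elements of \<open>A0\<close> always leave infinitely many variables free (\<open>infinite_codim\<close>, \<open>dim_union\<close>), and
  therefore finite substitutions are definable in \<open>A0\<close> (\<open>finite_substitution\<close>).

  If \<open>a\<close> and the complement of \<open>b\<close> are not separated by \<open>A0\<close>, they are not separated by its
  definable relations (\<open>inseparable_base\<close>), and the Henkin axioms do not change this because their
  witnesses can be quantified away (\<open>inseparable_axioms\<close>). Inseparable families extend to ultrafilters
  with the same trace on the definable relations (\<open>joint_ultrafilters\<close>). Each ultrafilter yields a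
  homomorphism into the subsets of a weak space, namely of the sequences of variables that almost agree
  with the identity (\<open>index_model_of_ultra\<close>); the equality of the base is the same for both.

  A weak space exists in dimension \<open>\<alpha> + \<omega>\<close> too, and the images of the homomorphisms lie in the neat
  reduct. Finally, the subalgebra generated by the images is coded by words, which brings its carrier
  into the required type.
\<close>

section \<open>Ultrafilters with a common trace\<close>

text \<open>
  Families of subsets of \<open>S\<close> rather than filters on a type: the two representations live on disjoint
  parts of one type.
\<close>

definition ultra :: "'p set \<Rightarrow> 'p set set \<Rightarrow> bool" where
  "ultra S F \<longleftrightarrow> F \<subseteq> Pow S \<and> (\<forall>X\<subseteq>S. S - X \<in> F \<longleftrightarrow> X \<notin> F) \<and>
     (\<forall>X\<subseteq>S. \<forall>Y\<subseteq>S. X \<inter> Y \<in> F \<longleftrightarrow> X \<in> F \<and> Y \<in> F)"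

lemma ultra_sub: "ultra S F \<Longrightarrow> X \<in> F \<Longrightarrow> X \<subseteq> S"
  unfolding ultra_def by blast

lemma ultra_compl: "ultra S F \<Longrightarrow> X \<subseteq> S \<Longrightarrow> S - X \<in> F \<longleftrightarrow> X \<notin> F"
  unfolding ultra_def by blast

lemma ultra_Int: "ultra S F \<Longrightarrow> X \<subseteq> S \<Longrightarrow> Y \<subseteq> S \<Longrightarrow> X \<inter> Y \<in> F \<longleftrightarrow> X \<in> F \<and> Y \<in> F"
  unfolding ultra_def by blast

lemma ultra_mono: "ultra S F \<Longrightarrow> X \<in> F \<Longrightarrow> X \<subseteq> Y \<Longrightarrow> Y \<subseteq> S \<Longrightarrow> Y \<in> F"
  by (metis inf.absorb1 subset_trans ultra_Int)

lemma ultra_Un: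
  assumes u: "ultra S F" and "X \<subseteq> S" "Y \<subseteq> S"
  shows "X \<union> Y \<in> F \<longleftrightarrow> X \<in> F \<or> Y \<in> F"
proof -
  have "X \<union> Y \<notin> F \<longleftrightarrow> S - (X \<union> Y) \<in> F"
    using assms by (simp add: ultra_compl)
  also have "S - (X \<union> Y) = (S - X) \<inter> (S - Y)" by blast
  also have "\<dots> \<in> F \<longleftrightarrow> X \<notin> F \<and> Y \<notin> F"
    using assms by (simp add: ultra_Int ultra_compl)
  finally show ?thesis by blast
qed

lemma ultra_empty: "ultra S F \<Longrightarrow> {} \<notin> F"
  by (metis Diff_empty empty_subsetI ultra_compl ultra_mono order_refl)

lemma ultra_top: "ultra S F \<Longrightarrow> S \<in> F"
  by (metis Diff_empty empty_subsetI ultra_compl ultra_empty)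

lemma ultra_Inter:
  assumes u: "ultra S F" and "finite \<X>" "\<X> \<subseteq> F"
  shows "S \<inter> \<Inter>\<X> \<in> F"
  using assms(2,3)
proof (induction \<X>)
  case empty
  then show ?case using ultra_top[OF u] by simp
next
  case (insert X \<X>)
  have "S \<inter> \<Inter>(insert X \<X>) = X \<inter> (S \<inter> \<Inter>\<X>)" by blast
  then show ?case using insert ultra_Int[OF u, of X "S \<inter> \<Inter>\<X>"] ultra_sub[OF u, of X] by simp
qed

definition separable :: "'p set set \<Rightarrow> 'p set \<Rightarrow> 'p set \<Rightarrow> bool" where
  "separable R p q \<longleftrightarrow> (\<exists>r\<in>R. p \<subseteq> r \<and> q \<inter> r = {})"

lemma separable_mono: "separable R p q \<Longrightarrow> p' \<subseteq> p \<Longrightarrow> q' \<subseteq> q \<Longrightarrow> separable R p' q'"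
  unfolding separable_def by blast

locale set_algebra =
  fixes S :: "'p set" and R :: "'p set set"
  assumes sub: "r \<in> R \<Longrightarrow> r \<subseteq> S"
    and empty: "{} \<in> R"
    and compl: "r \<in> R \<Longrightarrow> S - r \<in> R"
    and un: "r \<in> R \<Longrightarrow> r' \<in> R \<Longrightarrow> r \<union> r' \<in> R"
begin

lemma separable_sym:
  assumes "separable R p q" "q \<subseteq> S"
  shows "separable R q p"
proof -
  obtain r where r: "r \<in> R" "p \<subseteq> r" "q \<inter> r = {}"
    using assms(1) unfolding separable_def by blast
  then have "q \<subseteq> S - r" "p \<inter> (S - r) = {}" using assms(2) by auto
  with compl[OF r(1)] show ?thesis unfolding separable_def by (intro bexI[of _ "S - r"]) auto
qed

lemma separable_split:
  assumes "separable R (p \<inter> X) q" "separable R (p - X) q"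
  shows "separable R p q"
proof -
  obtain r r' where "r \<in> R" "p \<inter> X \<subseteq> r" "q \<inter> r = {}" "r' \<in> R" "p - X \<subseteq> r'" "q \<inter> r' = {}"
    using assms unfolding separable_def by blast
  then have "r \<union> r' \<in> R" "p \<subseteq> r \<union> r'" "q \<inter> (r \<union> r') = {}" using un by blast+
  then show ?thesis unfolding separable_def by blast
qed

text \<open>
  The algebraic core of Robinson's joint consistency theorem: two families of sets that no finite
  meets separate by a member of \<open>R\<close> extend to a maximal such pair, and maximality turns both
  members of the pair into ultrafilters. They agree on each \<open>r \<in> R\<close> because \<open>r\<close> separates itself
  from its complement.
\<close>

lemma joint_ultrafilters:
  fixes T :: "bool \<Rightarrow> 'p set" and \<Sigma> :: "bool \<Rightarrow> 'p set set"
  assumes T: "\<And>b. T b \<subseteq> S" and \<Sigma>: "\<And>b. \<Sigma> b \<subseteq> Pow (T b)"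
    and insep: "\<And>\<Phi>. (\<And>b. finite (\<Phi> b) \<and> \<Phi> b \<subseteq> \<Sigma> b) \<Longrightarrow>
      \<not> separable R (T True \<inter> \<Inter>(\<Phi> True)) (T False \<inter> \<Inter>(\<Phi> False))"
  shows "\<exists>F. (\<forall>b. ultra (T b) (F b) \<and> \<Sigma> b \<subseteq> F b) \<and>
    (\<forall>r\<in>R. r \<inter> T True \<in> F True \<longleftrightarrow> r \<inter> T False \<in> F False)"
proof -
  define meet where "meet \<Psi> b = T b \<inter> \<Inter>{X. (b, X) \<in> \<Psi>}" for \<Psi> :: "(bool \<times> 'p set) set" and b
  define con where "con \<Phi> \<longleftrightarrow>
    (\<forall>\<Psi>. finite \<Psi> \<longrightarrow> \<Psi> \<subseteq> \<Phi> \<longrightarrow> \<not> separable R (meet \<Psi> True) (meet \<Psi> False))" for \<Phi>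
  define C where "C = {\<Phi>. (SIGMA b:UNIV. \<Sigma> b) \<subseteq> \<Phi> \<and> \<Phi> \<subseteq> (SIGMA b:UNIV. Pow (T b)) \<and> con \<Phi>}"
  have meet_sub: "meet \<Psi> b \<subseteq> S" for \<Psi> b using T unfolding meet_def by blast
  have con\<Sigma>: "con (SIGMA b:UNIV. \<Sigma> b)"
    unfolding con_def
  proof (intro allI impI)
    fix \<Psi> assume \<Psi>: "finite \<Psi>" "\<Psi> \<subseteq> (SIGMA b:UNIV. \<Sigma> b)"
    have "{X. (b, X) \<in> \<Psi>} \<subseteq> snd ` \<Psi>" for b by force
    then have "finite {X. (b, X) \<in> \<Psi>}" for b
      using \<Psi>(1) by (meson finite_imageI finite_subset)
    then show "\<not> separable R (meet \<Psi> True) (meet \<Psi> False)"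
      unfolding meet_def using \<Psi>(2) by (intro insep) auto
  qed
  have "\<exists>M\<in>C. \<forall>X\<in>C. M \<subseteq> X \<longrightarrow> X = M"
  proof (rule subset_Zorn)
    fix \<C> assume ch: "subset.chain C \<C>"
    show "\<exists>U\<in>C. \<forall>X\<in>\<C>. X \<subseteq> U"
    proof (cases "\<C> = {}")
      case True
      have "(SIGMA b:UNIV. \<Sigma> b) \<in> C" unfolding C_def using con\<Sigma> \<Sigma> by auto
      then show ?thesis using True by blast
    next
      case False
      have sub: "\<C> \<subseteq> C" using ch unfolding subset.chain_def by blast
      have "con (\<Union>\<C>)"
        unfolding con_def
      proof (intro allI impI)
        fix \<Psi> assume "finite \<Psi>" "\<Psi> \<subseteq> \<Union>\<C>"
        then obtain X where "X \<in> \<C>" "\<Psi> \<subseteq> X"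
          using False ch finite_subset_Union_chain by metis
        then show "\<not> separable R (meet \<Psi> True) (meet \<Psi> False)"
          using sub \<open>finite \<Psi>\<close> unfolding C_def con_def by blast
      qed
      moreover have "(SIGMA b:UNIV. \<Sigma> b) \<subseteq> \<Union>\<C>" using False sub unfolding C_def by blast
      moreover have "\<Union>\<C> \<subseteq> (SIGMA b:UNIV. Pow (T b))" using sub unfolding C_def by blast
      ultimately have "\<Union>\<C> \<in> C" unfolding C_def by simp
      then show ?thesis by blast
    qed
  qed
  then obtain M where M: "M \<in> C" and max: "\<And>X. X \<in> C \<Longrightarrow> M \<subseteq> X \<Longrightarrow> X = M" by blast
  have insepM: "\<not> separable R (meet \<Psi> b) (meet \<Psi> (\<not> b))" if "finite \<Psi>" "\<Psi> \<subseteq> M" for \<Psi> b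
    using that M separable_sym[of "meet \<Psi> False" "meet \<Psi> True"] meet_sub
    unfolding C_def con_def by (cases b) auto
  have meetM: "meet \<Psi> b \<noteq> {}" if "finite \<Psi>" "\<Psi> \<subseteq> M" for \<Psi> b
    using insepM[OF that, of b] empty unfolding separable_def by auto
  have incon: "\<exists>\<Psi>. finite \<Psi> \<and> \<Psi> \<subseteq> M \<and> separable R (meet \<Psi> b \<inter> X) (meet \<Psi> (\<not> b))"
    if "(b, X) \<notin> M" "X \<subseteq> T b" for b X
  proof -
    have "\<not> con (insert (b, X) M)"
      using max[of "insert (b, X) M"] that M unfolding C_def by auto
    then obtain \<Psi> where \<Psi>: "finite \<Psi>" "\<Psi> \<subseteq> insert (b, X) M"
      "separable R (meet \<Psi> True) (meet \<Psi> False)" unfolding con_def by blast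
    then have s: "separable R (meet \<Psi> b) (meet \<Psi> (\<not> b))"
      using separable_sym meet_sub by (cases b) auto
    have "separable R (meet (\<Psi> - {(b, X)}) b \<inter> X) (meet (\<Psi> - {(b, X)}) (\<not> b))"
      by (rule separable_mono[OF s]) (auto simp: meet_def)
    then show ?thesis using \<Psi> by (intro exI[of _ "\<Psi> - {(b, X)}"]) auto
  qed
  have dich: "(b, X) \<in> M \<or> (b, T b - X) \<in> M" if X: "X \<subseteq> T b" for b X
  proof (rule ccontr)
    assume neg: "\<not> ?thesis"
    obtain \<Psi> where \<Psi>: "finite \<Psi>" "\<Psi> \<subseteq> M" "separable R (meet \<Psi> b \<inter> X) (meet \<Psi> (\<not> b))"
      using incon[of b X] neg X by blast
    obtain \<Psi>' where \<Psi>': "finite \<Psi>'" "\<Psi>' \<subseteq> M"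
      "separable R (meet \<Psi>' b \<inter> (T b - X)) (meet \<Psi>' (\<not> b))"
      using incon[of b "T b - X"] neg by blast
    have "separable R (meet (\<Psi> \<union> \<Psi>') b) (meet (\<Psi> \<union> \<Psi>') (\<not> b))"
    proof (rule separable_split)
      show "separable R (meet (\<Psi> \<union> \<Psi>') b \<inter> X) (meet (\<Psi> \<union> \<Psi>') (\<not> b))"
        by (rule separable_mono[OF \<Psi>(3)]) (auto simp: meet_def)
      show "separable R (meet (\<Psi> \<union> \<Psi>') b - X) (meet (\<Psi> \<union> \<Psi>') (\<not> b))"
        by (rule separable_mono[OF \<Psi>'(3)]) (auto simp: meet_def)
    qed
    then show False using insepM[of "\<Psi> \<union> \<Psi>'" b] \<Psi> \<Psi>' by simp
  qed
  define F where "F b = {X. (b, X) \<in> M}" for b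
  have F_sub: "X \<subseteq> T b" if "X \<in> F b" for X b using that M unfolding C_def F_def by blast
  have meets: "T b \<inter> \<Inter>\<X> \<noteq> {}" if "finite \<X>" "\<X> \<subseteq> F b" for b \<X>
  proof -
    have "meet (Pair b ` \<X>) b \<noteq> {}" using that by (intro meetM) (auto simp: F_def)
    moreover have "{X. (b, X) \<in> Pair b ` \<X>} = \<X>" by auto
    ultimately show ?thesis unfolding meet_def by simp
  qed
  have F_compl: "T b - X \<in> F b \<longleftrightarrow> X \<notin> F b" if X: "X \<subseteq> T b" for X b
  proof
    show "X \<notin> F b" if "T b - X \<in> F b"
      using meets[of "{X, T b - X}" b] that by auto
    show "T b - X \<in> F b" if "X \<notin> F b" using dich[OF X] that unfolding F_def by blast
  qed
  have F_Int: "X \<inter> Y \<in> F b \<longleftrightarrow> X \<in> F b \<and> Y \<in> F b" if XY: "X \<subseteq> T b" "Y \<subseteq> T b" for X Y b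
  proof (intro iffI conjI)
    assume *: "X \<inter> Y \<in> F b"
    show "X \<in> F b" using meets[of "{X \<inter> Y, T b - X}" b] * F_compl[OF XY(1)] by auto
    show "Y \<in> F b" using meets[of "{X \<inter> Y, T b - Y}" b] * F_compl[OF XY(2)] by auto
  next
    assume *: "X \<in> F b \<and> Y \<in> F b"
    have "X \<inter> Y \<subseteq> T b" using XY by blast
    then show "X \<inter> Y \<in> F b" using meets[of "{X, Y, T b - (X \<inter> Y)}" b] * F_compl[of "X \<inter> Y" b] by auto
  qed
  have ultra: "ultra (T b) (F b)" for b
    unfolding ultra_def using F_sub F_compl F_Int by blast
  have "\<Sigma> b \<subseteq> F b" for b using M unfolding C_def F_def by blast
  moreover have "r \<inter> T True \<in> F True \<longleftrightarrow> r \<inter> T False \<in> F False" if r: "r \<in> R" for r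
  proof -
    have *: "T (\<not> b) \<inter> r \<in> F (\<not> b)" if "T b \<inter> r \<in> F b" for b
    proof (rule ccontr)
      assume "\<not> ?thesis"
      then have "T (\<not> b) - (T (\<not> b) \<inter> r) \<in> F (\<not> b)" using F_compl by blast
      then have "{(b, T b \<inter> r), (\<not> b, T (\<not> b) - (T (\<not> b) \<inter> r))} \<subseteq> M"
        using that unfolding F_def by blast
      from insepM[OF _ this, of b] r show False
        unfolding separable_def meet_def by (cases b) auto
    qed
    show ?thesis using *[of True] *[of False] by (auto simp: Int_commute)
  qed
  ultimately show ?thesis using ultra by blast
qed

end

section \<open>Homomorphisms into algebras of sets of sequences\<close>

text \<open>
  A product of full set algebras is treated as one algebra of sets, over the disjoint union of the
  spaces of sequences; \<open>k\<close> names the factor.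
\<close>

definition tuples :: "'i set \<Rightarrow> ('k \<Rightarrow> 'u set) \<Rightarrow> ('k \<times> ('i \<Rightarrow> 'u)) set" where
  "tuples I U = {(k, s). \<forall>i\<in>I. s i \<in> U k}"

lemma mem_tuples: "(k, s) \<in> tuples I U \<longleftrightarrow> (\<forall>i\<in>I. s i \<in> U k)"
  by (simp add: tuples_def)

lemma tuples_upd: "(k, s) \<in> tuples I U \<Longrightarrow> u \<in> U k \<Longrightarrow> (k, s(i := u)) \<in> tuples I U"
  by (simp add: mem_tuples)

locale set_hom = cyl_type_algebra \<alpha> A
  for \<alpha> :: "'i rel" and A :: "('a, 'i) cyl_alg" (structure) +
  fixes U :: "'k \<Rightarrow> 'u set" and \<rho> :: "'a \<Rightarrow> ('k \<times> ('i \<Rightarrow> 'u)) set"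
  assumes hom_sub: "x \<in> carrier A \<Longrightarrow> \<rho> x \<subseteq> tuples (Field \<alpha>) U"
    and hom_cong: "x \<in> carrier A \<Longrightarrow> (k, s) \<in> \<rho> x \<Longrightarrow> (\<And>i. i \<in> Field \<alpha> \<Longrightarrow> s i = s' i) \<Longrightarrow> (k, s') \<in> \<rho> x"
    and hom_add: "x \<in> carrier A \<Longrightarrow> y \<in> carrier A \<Longrightarrow> \<rho> (x \<oplus> y) = \<rho> x \<union> \<rho> y"
    and hom_mult: "x \<in> carrier A \<Longrightarrow> y \<in> carrier A \<Longrightarrow> \<rho> (x \<otimes> y) = \<rho> x \<inter> \<rho> y"
    and hom_neg: "x \<in> carrier A \<Longrightarrow> \<rho> (\<ominus> x) = tuples (Field \<alpha>) U - \<rho> x"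
    and hom_zero: "\<rho> \<zero> = {}"
    and hom_one: "\<rho> \<one> = tuples (Field \<alpha>) U"
    and hom_cyl: "i \<in> Field \<alpha> \<Longrightarrow> x \<in> carrier A \<Longrightarrow>
      \<rho> (\<c> i x) = {(k, s). (k, s) \<in> tuples (Field \<alpha>) U \<and> (\<exists>u\<in>U k. (k, s(i := u)) \<in> \<rho> x)}"
    and hom_diag: "i \<in> Field \<alpha> \<Longrightarrow> j \<in> Field \<alpha> \<Longrightarrow>
      \<rho> (\<d> i j) = {(k, s). (k, s) \<in> tuples (Field \<alpha>) U \<and> s i = s j}"
begin

lemma hom_cong_iff:
  "x \<in> carrier A \<Longrightarrow> (\<And>i. i \<in> Field \<alpha> \<Longrightarrow> s i = s' i) \<Longrightarrow> (k, s) \<in> \<rho> x \<longleftrightarrow> (k, s') \<in> \<rho> x"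
  using hom_cong[of x k s s'] hom_cong[of x k s' s] by metis

lemma hom_base: "x \<in> carrier A \<Longrightarrow> (k, s) \<in> \<rho> x \<Longrightarrow> i \<in> Field \<alpha> \<Longrightarrow> s i \<in> U k"
  using hom_sub[of x] mem_tuples[of k s "Field \<alpha>" U] by blast

text \<open>In every set algebra this term is the substitution of \<open>j\<close> for \<open>i\<close>.\<close>

lemma hom_replace:
  assumes "i \<in> Field \<alpha>" "j \<in> Field \<alpha>" "i \<noteq> j" "x \<in> carrier A"
  shows "\<rho> (\<c> i (\<d> i j \<otimes> x)) = {(k, s). (k, s) \<in> tuples (Field \<alpha>) U \<and> (k, s(i := s j)) \<in> \<rho> x}"
  using assms hom_sub[OF assms(4)]
  by (auto simp: hom_cyl hom_mult hom_diag mult_closed diag_closed mem_tuples dest: subsetD)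

end

text \<open>
  The two algebras to be amalgamated are represented over the same index and base types, hence the
  embeddings \<open>ek\<close> and \<open>eu\<close>; taking embeddings \<open>ek\<close> with disjoint ranges keeps the two representations
  disjoint. The index set of the product is recorded by the support of \<open>U\<close>.
\<close>

lemma RCA_faithful_set_hom:
  fixes ek :: "'k0 \<Rightarrow> 'k" and eu :: "'u0 \<Rightarrow> 'u" and A :: "('a, 'i) cyl_alg" (structure)
  assumes A: "A \<in> RCA TYPE('k0) TYPE('u0) \<alpha>" and ek: "inj ek" and eu: "inj eu"
    and ne: "Field \<alpha> \<noteq> {}"
  shows "\<exists>(U :: 'k \<Rightarrow> 'u set) \<rho>. set_hom \<alpha> A U \<rho> \<and> inj_on \<rho> (carrier A) \<and> (\<forall>k. U k \<noteq> {} \<longrightarrow> k \<in> range ek)"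
proof -
  let ?I = "Field \<alpha>"
  obtain K :: "'k0 set" and U0 :: "'k0 \<Rightarrow> 'u0 set" and S h where
    S: "subalgebra \<alpha> S (product_algebra K (\<lambda>k. full_set_algebra \<alpha> (U0 k)))" and
    h: "homomorphism \<alpha> A S h" and bij: "bij_betw h (carrier A) (carrier S)" and
    type: "cyl_type_algebra \<alpha> A"
    using A unfolding RCA_def isomorphic_def by auto
  interpret cyl_type_algebra \<alpha> A by (fact type)
  obtain X where X: "X \<subseteq> carrier (product_algebra K (\<lambda>k. full_set_algebra \<alpha> (U0 k)))"
    and SX: "S = (product_algebra K (\<lambda>k. full_set_algebra \<alpha> (U0 k)))\<lparr>carrier := X\<rparr>"
    using S unfolding subalgebra_def by blast
  define U where "U k = {eu u | k0 u. k0 \<in> K \<and> k = ek k0 \<and> u \<in> U0 k0}" for k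
  define z where "z s = restrict (inv eu \<circ> s) ?I" for s
  define \<rho> where "\<rho> x = {(ek k0, s) | k0 s. k0 \<in> K \<and> (\<forall>i\<in>?I. s i \<in> eu ` U0 k0) \<and> z s \<in> h x k0}" for x
  note defs = SX product_algebra_def full_set_algebra_def Let_def
  have U_ek: "U (ek k0) = (if k0 \<in> K then eu ` U0 k0 else {})" for k0
    using ek unfolding U_def inj_def by auto
  have U_range: "k \<in> range ek" if "U k \<noteq> {}" for k using that unfolding U_def by auto
  have Sp: "tuples ?I U = {(ek k0, s) | k0 s. k0 \<in> K \<and> (\<forall>i\<in>?I. s i \<in> eu ` U0 k0)}"
  proof safe
    fix k s assume *: "(k, s) \<in> tuples ?I U"
    then obtain k0 where k0: "k = ek k0" using ne U_range[of k] unfolding mem_tuples by fastforce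
    then have "k0 \<in> K" using * ne unfolding mem_tuples k0 U_ek by (auto split: if_splits)
    then show "\<exists>k0 s'. (k, s) = (ek k0, s') \<and> k0 \<in> K \<and> (\<forall>i\<in>?I. s' i \<in> eu ` U0 k0)"
      using * k0 unfolding mem_tuples by (auto simp: U_ek)
  next
    fix k0 s assume "k0 \<in> K" "\<forall>i\<in>?I. s i \<in> eu ` U0 k0"
    then show "(ek k0, s) \<in> tuples ?I U" by (simp add: mem_tuples U_ek)
  qed
  have mem: "(ek k0, s) \<in> \<rho> x \<longleftrightarrow> k0 \<in> K \<and> (\<forall>i\<in>?I. s i \<in> eu ` U0 k0) \<and> z s \<in> h x k0" for k0 s x
    using ek unfolding \<rho>_def inj_def by auto
  have memT: "(ek k0, s) \<in> tuples ?I U \<longleftrightarrow> k0 \<in> K \<and> (\<forall>i\<in>?I. s i \<in> eu ` U0 k0)" for k0 s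
    using ek unfolding Sp inj_def by auto
  have range\<rho>: "k \<in> range ek" if "(k, s) \<in> \<rho> x" for k s x using that unfolding \<rho>_def by auto
  have rangeT: "k \<in> range ek" if "(k, s) \<in> tuples ?I U" for k s using that unfolding Sp by auto
  have V: "z s \<in> ?I \<rightarrow>\<^sub>E U0 k0" if "\<forall>i\<in>?I. s i \<in> eu ` U0 k0" for s k0
    using that eu unfolding z_def by (auto simp: inv_f_f)
  have hX: "h x \<in> (\<Pi>\<^sub>E k\<in>K. Pow (?I \<rightarrow>\<^sub>E U0 k))" if "x \<in> carrier A" for x
    using bij that X unfolding bij_betw_def defs by auto
  have hV: "h x k0 \<subseteq> ?I \<rightarrow>\<^sub>E U0 k0" if "x \<in> carrier A" "k0 \<in> K" for x k0
    using hX[OF that(1)] that(2) by auto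
  have setI: "P = Q" if "\<And>k s. (k, s) \<in> P \<Longrightarrow> k \<in> range ek" "\<And>k s. (k, s) \<in> Q \<Longrightarrow> k \<in> range ek"
    "\<And>k0 s. (ek k0, s) \<in> P \<longleftrightarrow> (ek k0, s) \<in> Q" for P Q :: "('k \<times> ('i \<Rightarrow> 'u)) set"
    using that by (auto; blast)
  have "set_hom \<alpha> A U \<rho>"
  proof (unfold_locales, goal_cases)
    case (1 x) then show ?case unfolding \<rho>_def Sp by auto
  next
    case (2 x k s s')
    then have "z s = z s'" unfolding z_def by auto
    moreover obtain k0 where "k = ek k0" using range\<rho> 2 by blast
    ultimately show ?case using 2 by (simp add: mem)
  next
    case (3 x y)
    have "h (x \<oplus> y) k0 = h x k0 \<union> h y k0" if "k0 \<in> K" for k0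
      using h 3 that unfolding homomorphism_def by (simp add: defs)
    then show ?case by (intro setI) (auto simp: mem dest: range\<rho>)
  next
    case (4 x y)
    have "h (x \<otimes> y) k0 = h x k0 \<inter> h y k0" if "k0 \<in> K" for k0
      using h 4 that unfolding homomorphism_def by (simp add: defs)
    then show ?case by (intro setI) (auto simp: mem dest: range\<rho>)
  next
    case (5 x)
    have "h (\<ominus> x) k0 = (?I \<rightarrow>\<^sub>E U0 k0) - h x k0" if "k0 \<in> K" for k0
      using h 5 that unfolding homomorphism_def by (simp add: defs)
    then show ?case by (intro setI) (auto simp: mem memT V dest: range\<rho> rangeT)
  next
    case 6
    have "h \<zero> k0 = {}" if "k0 \<in> K" for k0
      using h that unfolding homomorphism_def by (simp add: defs)
    then show ?case by (intro setI) (auto simp: mem dest: range\<rho>)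
  next
    case 7
    have "h \<one> k0 = ?I \<rightarrow>\<^sub>E U0 k0" if "k0 \<in> K" for k0
      using h that unfolding homomorphism_def by (simp add: defs)
    then show ?case by (intro setI) (auto simp: mem memT V dest: range\<rho> rangeT)
  next
    case (8 i x)
    have hc: "h (\<c> i x) k0 = {s \<in> ?I \<rightarrow>\<^sub>E U0 k0. \<exists>t\<in>h x k0. \<forall>j\<in>?I. j \<noteq> i \<longrightarrow> t j = s j}" if "k0 \<in> K" for k0
      using h 8 that unfolding homomorphism_def by (simp add: defs)
    have z_upd: "z (s(i := eu v)) = (z s)(i := v)" for s v
      using 8 eu unfolding z_def by (auto simp: inv_f_f fun_eq_iff)
    show ?case
    proof (intro setI)
      fix k0 s
      have ex: "(\<exists>t\<in>h x k0. \<forall>j\<in>?I. j \<noteq> i \<longrightarrow> t j = z s j) \<longleftrightarrow> (\<exists>v\<in>U0 k0. (z s)(i := v) \<in> h x k0)" if "k0 \<in> K"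
      proof
        assume "\<exists>t\<in>h x k0. \<forall>j\<in>?I. j \<noteq> i \<longrightarrow> t j = z s j"
        then obtain t where t: "t \<in> h x k0" "\<forall>j\<in>?I. j \<noteq> i \<longrightarrow> t j = z s j" by blast
        then have tV: "t \<in> ?I \<rightarrow>\<^sub>E U0 k0" using hV 8 that by blast
        have "(z s)(i := t i) = t"
        proof
          fix j show "((z s)(i := t i)) j = t j"
            using t(2) tV 8 by (cases "j \<in> ?I") (auto simp: z_def PiE_def extensional_def)
        qed
        moreover have "t i \<in> U0 k0" using tV 8 by (auto simp: PiE_def Pi_def)
        ultimately show "\<exists>v\<in>U0 k0. (z s)(i := v) \<in> h x k0" using t(1) by metis
      next
        assume "\<exists>v\<in>U0 k0. (z s)(i := v) \<in> h x k0"
        then obtain v where "(z s)(i := v) \<in> h x k0" by blast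
        then show "\<exists>t\<in>h x k0. \<forall>j\<in>?I. j \<noteq> i \<longrightarrow> t j = z s j" by (intro bexI[of _ "(z s)(i := v)"]) auto
      qed
      then show "((ek k0, s) \<in> \<rho> (\<c> i x)) \<longleftrightarrow>
        (ek k0, s) \<in> {(k, s). (k, s) \<in> tuples ?I U \<and> (\<exists>u\<in>U k. (k, s(i := u)) \<in> \<rho> x)}"
      proof (cases "k0 \<in> K \<and> (\<forall>i\<in>?I. s i \<in> eu ` U0 k0)")
        case True
        then have "(ek k0, s) \<in> \<rho> (\<c> i x) \<longleftrightarrow> (\<exists>v\<in>U0 k0. (z s)(i := v) \<in> h x k0)"
          using V[of s k0] ex by (simp add: mem hc)
        also have "\<dots> \<longleftrightarrow> (\<exists>v\<in>U0 k0. (ek k0, s(i := eu v)) \<in> \<rho> x)"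
          using True by (auto simp: mem z_upd)
        finally show ?thesis using True by (simp add: memT U_ek)
      next
        case False
        then show ?thesis by (auto simp: mem memT)
      qed
    qed (auto dest: range\<rho> rangeT)
  next
    case (9 i j)
    have hd: "h (\<d> i j) k0 = {s \<in> ?I \<rightarrow>\<^sub>E U0 k0. s i = s j}" if "k0 \<in> K" for k0
      using h 9 that unfolding homomorphism_def by (simp add: defs)
    show ?case
    proof (intro setI)
      fix k0 s
      have "z s i = z s j \<longleftrightarrow> s i = s j" if sU: "\<forall>i\<in>?I. s i \<in> eu ` U0 k0"
      proof -
        from sU 9 have "s i \<in> eu ` U0 k0" "s j \<in> eu ` U0 k0" by auto
        then obtain a b where "s i = eu a" "s j = eu b" by (elim imageE)
        then show ?thesis using 9 eu unfolding z_def by (simp add: inv_f_f inj_eq)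
      qed
      then show "((ek k0, s) \<in> \<rho> (\<d> i j)) \<longleftrightarrow>
        (ek k0, s) \<in> {(k, s). (k, s) \<in> tuples ?I U \<and> s i = s j}"
        using V[of s k0] by (auto simp: mem memT hd)
    qed (auto dest: range\<rho> rangeT)
  qed
  moreover have "inj_on \<rho> (carrier A)"
  proof (rule inj_onI)
    fix x y assume xy: "x \<in> carrier A" "y \<in> carrier A" "\<rho> x = \<rho> y"
    have sub: "h a k0 \<subseteq> h b k0" if "a \<in> carrier A" "\<rho> a = \<rho> b" "k0 \<in> K" for a b k0
    proof
      fix t assume t: "t \<in> h a k0"
      then have tV: "t \<in> ?I \<rightarrow>\<^sub>E U0 k0" using hV that by blast
      have zt: "z (eu \<circ> t) = t"
      proof
        fix j show "z (eu \<circ> t) j = t j"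
          using tV eu by (cases "j \<in> ?I") (auto simp: z_def PiE_def extensional_def inv_f_f)
      qed
      have "(ek k0, eu \<circ> t) \<in> \<rho> a" using t tV that(3) zt by (auto simp: mem)
      then have "(ek k0, eu \<circ> t) \<in> \<rho> b" using that(2) by simp
      then show "t \<in> h b k0" using zt mem[of k0 "eu \<circ> t" b] by simp
    qed
    have "h x = h y"
      using hX[OF xy(1)] hX[OF xy(2)] sub[OF xy(1)] sub[OF xy(2)] xy(3)
      by (intro PiE_ext[of "h x" K "\<lambda>k. Pow (?I \<rightarrow>\<^sub>E U0 k)"]) (auto; blast)+
    then show "x = y" using bij xy unfolding bij_betw_def inj_on_def by blast
  qed
  ultimately show ?thesis using U_range by (intro exI[of _ U] exI[of _ \<rho>]) simp
qed

section \<open>Dimension complemented algebras of sets\<close>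

locale dc_set_hom = set_hom \<alpha> A U \<rho>
  for \<alpha> :: "'i rel" and A :: "('a, 'i) cyl_alg" (structure)
    and U :: "'k \<Rightarrow> 'u set" and \<rho> :: "'a \<Rightarrow> ('k \<times> ('i \<Rightarrow> 'u)) set" +
  assumes faithful: "inj_on \<rho> (carrier A)"
    and dim_complemented: "x \<in> carrier A \<Longrightarrow> dim_set \<alpha> A x \<noteq> Field \<alpha>"
    and infinite_dim: "infinite (Field \<alpha>)"
begin

abbreviation \<Delta> :: "'a \<Rightarrow> 'i set" where "\<Delta> \<equiv> dim_set \<alpha> A"

lemma not_in_dim_iff:
  assumes "x \<in> carrier A" "i \<in> Field \<alpha>"
  shows "i \<notin> \<Delta> x \<longleftrightarrow> (\<forall>k s u. (k, s) \<in> \<rho> x \<longrightarrow> u \<in> U k \<longrightarrow> (k, s(i := u)) \<in> \<rho> x)"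
proof -
  have "i \<notin> \<Delta> x \<longleftrightarrow> \<rho> (\<c> i x) = \<rho> x"
    using assms faithful cyl_closed unfolding dim_set_def inj_on_def by auto
  also have "\<dots> \<longleftrightarrow> (\<forall>k s u. (k, s) \<in> \<rho> x \<longrightarrow> u \<in> U k \<longrightarrow> (k, s(i := u)) \<in> \<rho> x)"
  proof (intro iffI allI impI)
    fix k s u assume *: "\<rho> (\<c> i x) = \<rho> x" "(k, s) \<in> \<rho> x" "u \<in> U k"
    then have "(k, s(i := u)) \<in> tuples (Field \<alpha>) U" using hom_sub assms by (blast intro: tuples_upd)
    moreover have "s i \<in> U k" using hom_base assms * by blast
    ultimately have "(k, s(i := u)) \<in> \<rho> (\<c> i x)"
      using * assms by (auto simp: hom_cyl intro!: bexI[of _ "s i"])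
    then show "(k, s(i := u)) \<in> \<rho> x" using * by simp
  next
    assume *: "\<forall>k s u. (k, s) \<in> \<rho> x \<longrightarrow> u \<in> U k \<longrightarrow> (k, s(i := u)) \<in> \<rho> x"
    show "\<rho> (\<c> i x) = \<rho> x"
    proof (intro equalityI subrelI)
      fix k s assume "(k, s) \<in> \<rho> (\<c> i x)"
      then obtain u where "u \<in> U k" "(k, s(i := u)) \<in> \<rho> x" "s i \<in> U k"
        using assms by (auto simp: hom_cyl mem_tuples)
      then have "(k, (s(i := u))(i := s i)) \<in> \<rho> x" using * by blast
      then show "(k, s) \<in> \<rho> x" by simp
    next
      fix k s assume "(k, s) \<in> \<rho> x"
      then show "(k, s) \<in> \<rho> (\<c> i x)"
        using assms hom_sub hom_base by (auto simp: hom_cyl intro!: bexI[of _ "s i"])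
    qed
  qed
  finally show ?thesis .
qed

lemma hom_upd_iff:
  assumes x: "x \<in> carrier A" and i: "i \<notin> \<Delta> x" and s: "s i \<in> U k" "u \<in> U k"
  shows "(k, s(i := u)) \<in> \<rho> x \<longleftrightarrow> (k, s) \<in> \<rho> x"
proof (cases "i \<in> Field \<alpha>")
  case True
  have upd: "(k, s(i := u)) \<in> \<rho> x" if "(k, s) \<in> \<rho> x" "u \<in> U k" for s u
    using not_in_dim_iff[OF x True] i that by blast
  show ?thesis using upd[of s u] upd[of "s(i := u)" "s i"] s by auto
next
  case False
  then show ?thesis by (intro hom_cong_iff[OF x]) auto
qed

text \<open>
  Membership in \<open>\<rho> x\<close> may depend on the behaviour of a sequence at infinity even if
  \<open>\<Delta> x\<close> is empty. Only finitely many coordinates outside \<open>\<Delta> x\<close> can be changed freely.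
\<close>

lemma hom_finite_change:
  assumes x: "x \<in> carrier A" and s: "(k, s) \<in> tuples (Field \<alpha>) U" and s': "(k, s') \<in> tuples (Field \<alpha>) U"
    and fin: "finite {i \<in> Field \<alpha>. s i \<noteq> s' i}" and eq: "\<And>i. i \<in> \<Delta> x \<Longrightarrow> s i = s' i"
  shows "(k, s) \<in> \<rho> x \<longleftrightarrow> (k, s') \<in> \<rho> x"
proof -
  have "(k, s) \<in> \<rho> x \<longleftrightarrow> (k, s') \<in> \<rho> x"
    if "finite M" "M = {i \<in> Field \<alpha>. s i \<noteq> s' i}" "(k, s) \<in> tuples (Field \<alpha>) U" "\<And>i. i \<in> \<Delta> x \<Longrightarrow> s i = s' i" for M s
    using that
  proof (induction M arbitrary: s)
    case empty
    then show ?case by (intro hom_cong_iff[OF x]) auto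
  next
    case (insert i M)
    then have i: "i \<in> Field \<alpha>" "i \<notin> \<Delta> x" by blast+
    have b: "s i \<in> U k" "s' i \<in> U k" using insert.prems(2) s' i by (simp_all add: mem_tuples)
    have "(k, s(i := s' i)) \<in> \<rho> x \<longleftrightarrow> (k, s') \<in> \<rho> x"
    proof (rule insert.IH)
      show "M = {j \<in> Field \<alpha>. (s(i := s' i)) j \<noteq> s' j}" using insert.prems(1) insert.hyps by auto
      show "(k, s(i := s' i)) \<in> tuples (Field \<alpha>) U" using insert.prems(2) b by (simp add: mem_tuples)
      show "(s(i := s' i)) j = s' j" if "j \<in> \<Delta> x" for j using insert.prems(3) that by simp
    qed
    then show ?case using hom_upd_iff[of x i s k "s' i"] x i b by simp
  qed
  then show ?thesis using fin s eq by blast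
qed

text \<open>
  Multiplying \<open>z\<close> with the diagonal \<open>\<d> k j\<close> adds the missing dimension \<open>k\<close> without losing
  any: substituting \<open>j\<close> for \<open>k\<close> recovers \<open>z\<close> from the product. On base sets with one element
  nothing depends on any coordinate, which is why some \<open>j \<in> \<Delta> z\<close> is needed.
\<close>

lemma dim_extend:
  assumes z: "z \<in> carrier A" and k: "k \<in> Field \<alpha>" "k \<notin> \<Delta> z" and j: "j \<in> \<Delta> z"
  shows "\<exists>w\<in>carrier A. insert k (\<Delta> z) \<subseteq> \<Delta> w"
proof -
  have jI: "j \<in> Field \<alpha>" using j by (simp add: dim_set_def)
  have kj: "k \<noteq> j" using k j by blast
  define w where "w = z \<otimes> \<d> k j"
  have w: "w \<in> carrier A" using z k jI by (simp add: w_def mult_closed diag_closed)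
  have mem: "(k', s) \<in> \<rho> w \<longleftrightarrow> (k', s) \<in> \<rho> z \<and> s k = s j" for k' s
    using z k jI hom_sub[OF z] by (auto simp: w_def hom_mult hom_diag diag_closed)
  have zk: "(k', s(k := u)) \<in> \<rho> z" if "(k', s) \<in> \<rho> z" "u \<in> U k'" for k' s u
    using not_in_dim_iff[OF z k(1)] k(2) that by blast
  have lift: "(k', s(k := s j)) \<in> \<rho> w" if "(k', s) \<in> \<rho> z" for k' s
    using zk[OF that, of "s j"] hom_base[OF z that jI] kj by (simp add: mem)
  have keep: "i \<in> \<Delta> w" if i: "i \<in> \<Delta> z" "i \<noteq> j" for i
  proof (rule ccontr)
    assume "i \<notin> \<Delta> w"
    moreover have iI: "i \<in> Field \<alpha>" using i by (simp add: dim_set_def)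
    moreover have ik: "i \<noteq> k" using i k by blast
    ultimately have wi: "(k', s(i := u)) \<in> \<rho> w" if "(k', s) \<in> \<rho> w" "u \<in> U k'" for k' s u
      using not_in_dim_iff[OF w] that by blast
    have "(k', s(i := u)) \<in> \<rho> z" if "(k', s) \<in> \<rho> z" "u \<in> U k'" for k' s u
    proof -
      have "(k', s(k := s j, i := u)) \<in> \<rho> z" using wi[OF lift] that mem by blast
      from zk[OF this hom_base[OF z that(1) k(1)]] ik show ?thesis
        by (simp add: fun_upd_idem)
    qed
    then show False using not_in_dim_iff[OF z iI] i by blast
  qed
  have "j \<in> \<Delta> w"
  proof (rule ccontr)
    assume "j \<notin> \<Delta> w"
    then have wj: "(k', s(j := u)) \<in> \<rho> w" if "(k', s) \<in> \<rho> w" "u \<in> U k'" for k' s u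
      using not_in_dim_iff[OF w jI] that by blast
    have "(k', s(j := u)) \<in> \<rho> z" if "(k', s) \<in> \<rho> z" "u \<in> U k'" for k' s u
    proof -
      have "(k', s(k := s j, j := u)) \<in> \<rho> z" using wj[OF lift] that mem by blast
      from zk[OF this hom_base[OF z that(1) k(1)]] kj show ?thesis
        by (simp add: fun_upd_idem)
    qed
    then show False using not_in_dim_iff[OF z jI] j by blast
  qed
  moreover have "k \<in> \<Delta> w"
  proof (rule ccontr)
    assume "k \<notin> \<Delta> w"
    then have wk: "(k', s(k := u)) \<in> \<rho> w" if "(k', s) \<in> \<rho> w" "u \<in> U k'" for k' s u
      using not_in_dim_iff[OF w k(1)] that by blast
    have "(k', s(j := u)) \<in> \<rho> z" if "(k', s) \<in> \<rho> z" "u \<in> U k'" for k' s u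
    proof -
      have "(k', s(k := s j, k := u)) \<in> \<rho> w" using wk[OF lift] that by blast
      then have "u = s j" using kj by (simp add: mem)
      then show ?thesis using that by simp
    qed
    then show False using not_in_dim_iff[OF z jI] j by blast
  qed
  ultimately show ?thesis using w keep by blast
qed

text \<open>
  If only finitely many dimensions were missing, they could be added one after the other until all of
  \<open>\<alpha>\<close> is reached. A nonempty dimension set to start from is available because \<open>\<alpha>\<close> is infinite.
\<close>

lemma infinite_codim:
  assumes "x \<in> carrier A"
  shows "infinite (Field \<alpha> - \<Delta> x)"
proof
  assume fin: "finite (Field \<alpha> - \<Delta> x)"
  have "False" if "x \<in> carrier A" "n = card (Field \<alpha> - \<Delta> x)" "finite (Field \<alpha> - \<Delta> x)" for n x
    using that
  proof (induction n arbitrary: x rule: less_induct)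
    case (less n)
    have "\<Delta> x \<subseteq> Field \<alpha>" by (auto simp: dim_set_def)
    then obtain k where k: "k \<in> Field \<alpha>" "k \<notin> \<Delta> x" using dim_complemented[OF less.prems(1)] by blast
    have "\<Delta> x \<noteq> {}" using less.prems(3) infinite_dim by auto
    then obtain j where "j \<in> \<Delta> x" by blast
    from dim_extend[OF less.prems(1) k this] obtain w where w: "w \<in> carrier A" "insert k (\<Delta> x) \<subseteq> \<Delta> w"
      by blast
    then have "Field \<alpha> - \<Delta> w \<subset> Field \<alpha> - \<Delta> x" using k by blast
    then show False
      using less.IH[OF _ w(1) refl] less.prems by (meson finite_subset psubset_card_mono psubset_imp_subset)
  qed
  then show False using assms fin by blast
qed

text \<open>
  If \<open>x\<close> does not depend on \<open>k\<close> and \<open>y\<close> does not depend on \<open>l\<close>, both are coded by the element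
  that equals \<open>x\<close> where \<open>s k = s l\<close> and \<open>y\<close> elsewhere; only \<open>k\<close> and \<open>l\<close> can be lost.
\<close>

lemma dim_union:
  assumes x: "x \<in> carrier A" and y: "y \<in> carrier A"
  shows "\<exists>z\<in>carrier A. finite (\<Delta> x \<union> \<Delta> y - \<Delta> z)"
proof -
  obtain k where k: "k \<in> Field \<alpha>" "k \<notin> \<Delta> x"
    using infinite_imp_nonempty[OF infinite_codim[OF x]] by blast
  have "infinite (Field \<alpha> - \<Delta> y - {k})" using infinite_codim[OF y] by simp
  then obtain l where l: "l \<in> Field \<alpha>" "l \<notin> \<Delta> y" "l \<noteq> k"
    using infinite_imp_nonempty by blast
  define z where "z = (x \<otimes> \<d> k l) \<oplus> (y \<otimes> \<ominus> (\<d> k l))"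
  have z: "z \<in> carrier A"
    using x y k l by (simp add: z_def add_closed mult_closed neg_closed diag_closed)
  have mem: "(k', s) \<in> \<rho> z \<longleftrightarrow> (if s k = s l then (k', s) \<in> \<rho> x else (k', s) \<in> \<rho> y)" for k' s
    using x y k l hom_sub[OF x] hom_sub[OF y]
    by (auto simp: z_def hom_add hom_mult hom_neg hom_diag add_closed mult_closed neg_closed diag_closed)
  have xk: "(k', s(k := u)) \<in> \<rho> x" if "(k', s) \<in> \<rho> x" "u \<in> U k'" for k' s u
    using not_in_dim_iff[OF x k(1)] k(2) that by blast
  have yl: "(k', s(l := u)) \<in> \<rho> y" if "(k', s) \<in> \<rho> y" "u \<in> U k'" for k' s u
    using not_in_dim_iff[OF y l(1)] l(2) that by blast
  have "i \<notin> \<Delta> x \<and> i \<notin> \<Delta> y" if i: "i \<in> Field \<alpha>" "i \<notin> \<Delta> z" "i \<noteq> k" "i \<noteq> l" for i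
  proof
    have zi: "(k', s(i := u)) \<in> \<rho> z" if "(k', s) \<in> \<rho> z" "u \<in> U k'" for k' s u
      using not_in_dim_iff[OF z i(1)] i(2) that by blast
    have "(k', s(i := u)) \<in> \<rho> x" if su: "(k', s) \<in> \<rho> x" "u \<in> U k'" for k' s u
    proof -
      have "(k', s(k := s l)) \<in> \<rho> z" using xk[OF su(1) hom_base[OF x su(1) l(1)]] l by (simp add: mem)
      from zi[OF this su(2)] have "(k', s(k := s l, i := u)) \<in> \<rho> x" using i l by (simp add: mem)
      from xk[OF this hom_base[OF x su(1) k(1)]] i show ?thesis by (simp add: fun_upd_idem)
    qed
    then show "i \<notin> \<Delta> x" using not_in_dim_iff[OF x i(1)] by blast
    have "(k', s(i := u)) \<in> \<rho> y" if su: "(k', s) \<in> \<rho> y" "u \<in> U k'" for k' s u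
    \<comment> \<open>leaving the diagonal needs a second base element; without one, \<open>y\<close> cannot depend on \<open>i\<close>\<close>
    proof (cases "\<exists>v\<in>U k'. v \<noteq> s k")
      case True
      then obtain v where v: "v \<in> U k'" "v \<noteq> s k" by blast
      have "(k', s(l := v)) \<in> \<rho> z" using yl[OF su(1) v(1)] l v by (simp add: mem)
      from zi[OF this su(2)] have "(k', s(l := v, i := u)) \<in> \<rho> y" using i l v by (simp add: mem)
      from yl[OF this hom_base[OF y su(1) l(1)]] i show ?thesis by (simp add: fun_upd_idem)
    next
      case False
      then have "u = s i" using su(2) hom_base[OF y su(1) i(1)] by metis
      then show ?thesis using su by simp
    qed
    then show "i \<notin> \<Delta> y" using not_in_dim_iff[OF y i(1)] by blast
  qed
  then have "\<Delta> x \<union> \<Delta> y - \<Delta> z \<subseteq> {k, l}" by (auto simp: dim_set_def[of \<alpha> A x] dim_set_def[of \<alpha> A y])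
  then show ?thesis using z by (meson finite.emptyI finite_insert finite_subset)
qed

text \<open>
  To send \<open>i\<close> to
  \<open>\<tau> i\<close> after the other values have been moved, \<open>i\<close> is first parked in a coordinate \<open>v\<close> on which
  \<open>x\<close> does not depend; this avoids any clash with the other substitutions.
\<close>

lemma finite_substitution:
  assumes "finite M" "x \<in> carrier A" "M \<subseteq> Field \<alpha>"
    "\<And>i. i \<in> Field \<alpha> \<Longrightarrow> \<tau> i \<in> Field \<alpha>" "\<And>i. i \<in> Field \<alpha> - M \<Longrightarrow> \<tau> i = i"
  shows "\<exists>y\<in>carrier A. \<rho> y = {(k, s). (k, s) \<in> tuples (Field \<alpha>) U \<and> (k, s \<circ> \<tau>) \<in> \<rho> x}"
  using assms
proof (induction M arbitrary: x \<tau>)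
  case empty
  have "(k, s \<circ> \<tau>) \<in> \<rho> x \<longleftrightarrow> (k, s) \<in> \<rho> x" for k s
    using empty by (intro hom_cong_iff) auto
  then show ?case using empty hom_sub[OF \<open>x \<in> carrier A\<close>] by (intro bexI[of _ x]) (auto simp: comp_def)
next
  case (insert i M)
  note x = \<open>x \<in> carrier A\<close>
  have iI: "i \<in> Field \<alpha>" using insert.prems by blast
  have "finite (insert i M \<union> \<tau> ` insert i M)" using insert.hyps(1) by simp
  from Diff_infinite_finite[OF this infinite_codim[OF x]]
  have "infinite (Field \<alpha> - \<Delta> x - (insert i M \<union> \<tau> ` insert i M))" .
  then obtain v where v: "v \<in> Field \<alpha>" "v \<notin> \<Delta> x" "v \<notin> insert i M" "v \<notin> \<tau> ` insert i M"
    using infinite_imp_nonempty by blast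
  \<comment> \<open>\<open>x1\<close> parks \<open>i\<close> in \<open>v\<close>; the induction hypothesis moves \<open>M\<close>; \<open>y\<close> sends \<open>v\<close> to \<open>\<tau> i\<close>\<close>
  define x1 where "x1 = \<c> i (\<d> i v \<otimes> x)"
  have x1: "x1 \<in> carrier A" using x iI v by (simp add: x1_def cyl_closed mult_closed diag_closed)
  have \<rho>1: "\<rho> x1 = {(k, s). (k, s) \<in> tuples (Field \<alpha>) U \<and> (k, s(i := s v)) \<in> \<rho> x}"
    using hom_replace[of i v x] x iI v by (auto simp: x1_def)
  have "\<exists>y\<in>carrier A. \<rho> y = {(k, s). (k, s) \<in> tuples (Field \<alpha>) U \<and> (k, s \<circ> \<tau>(i := i)) \<in> \<rho> x1}"
    using insert.prems x1 iI by (intro insert.IH) auto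
  then obtain x2 where x2: "x2 \<in> carrier A"
    and \<rho>2: "\<rho> x2 = {(k, s). (k, s) \<in> tuples (Field \<alpha>) U \<and> (k, s \<circ> \<tau>(i := i)) \<in> \<rho> x1}" by blast
  define y where "y = \<c> v (\<d> v (\<tau> i) \<otimes> x2)"
  have \<tau>i: "\<tau> i \<in> Field \<alpha>" "v \<noteq> \<tau> i" using insert.prems iI v by auto
  have y: "y \<in> carrier A" using x2 \<tau>i v by (simp add: y_def cyl_closed mult_closed diag_closed)
  have \<rho>y: "\<rho> y = {(k, s). (k, s) \<in> tuples (Field \<alpha>) U \<and> (k, s(v := s (\<tau> i))) \<in> \<rho> x2}"
    using hom_replace[of v "\<tau> i" x2] x2 \<tau>i v by (auto simp: y_def)
  have "(k, s(v := s (\<tau> i))) \<in> \<rho> x2 \<longleftrightarrow> (k, s \<circ> \<tau>) \<in> \<rho> x" if s: "(k, s) \<in> tuples (Field \<alpha>) U" for k s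
  proof -
    define t where "t = s(v := s (\<tau> i))"
    have t: "(k, t) \<in> tuples (Field \<alpha>) U" unfolding t_def using s \<tau>i by (simp add: mem_tuples)
    have t': "(k, t \<circ> \<tau>(i := i)) \<in> tuples (Field \<alpha>) U"
      using t insert.prems(3) by (simp add: mem_tuples)
    have \<tau>v: "\<tau> v = v" "v \<noteq> i" using insert.prems v by auto
    have "(k, t) \<in> \<rho> x2 \<longleftrightarrow> (k, (t \<circ> \<tau>(i := i))(i := s (\<tau> i))) \<in> \<rho> x"
      using t t' \<tau>v by (simp add: \<rho>1 \<rho>2 t_def)
    also have "\<dots> \<longleftrightarrow> (k, (s \<circ> \<tau>)(v := s (\<tau> i))) \<in> \<rho> x"
    proof (rule hom_cong_iff[OF x])
      fix j assume j: "j \<in> Field \<alpha>"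
      show "((t \<circ> \<tau>(i := i))(i := s (\<tau> i))) j = ((s \<circ> \<tau>)(v := s (\<tau> i))) j"
        using \<tau>v \<tau>i v insert.prems(4)[of j] j by (cases "j \<in> M") (auto simp: t_def)
    qed
    also have "\<dots> \<longleftrightarrow> (k, s \<circ> \<tau>) \<in> \<rho> x"
      using s \<tau>i v \<tau>v x by (intro hom_upd_iff) (auto simp: mem_tuples)
    finally show ?thesis by (simp add: t_def)
  qed
  then show ?case using y by (intro bexI[of _ y]) (auto simp: \<rho>y comp_def)
qed

end

section \<open>Parametrically definable relations over an extended index set\<close>

text \<open>
  The indices of the dilated algebras. \<open>Wit c l i\<close> is a Henkin witness for the statement that
  \<open>\<c> i c\<close> holds at the sequence of indices given by the association list \<open>l\<close>.
  Witnesses contain the indices on which they depend, so that they are ordered by their size.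
\<close>

datatype ('c, 'i) idx = Base 'i | Wit 'c "('i \<times> ('c, 'i) idx) list" 'i

text \<open>The substitution operator of \<open>\<sigma>\<close>, from sequences of one index type to those of another.\<close>

definition pull :: "('k \<Rightarrow> 'u set) \<Rightarrow> ('i \<Rightarrow> 'j) \<Rightarrow> ('k \<times> ('i \<Rightarrow> 'u)) set \<Rightarrow> ('k \<times> ('j \<Rightarrow> 'u)) set" where
  "pull U \<sigma> X = {(k, s). (k, s) \<in> tuples UNIV U \<and> (k, s \<circ> \<sigma>) \<in> X}"

lemma mem_pull: "(k, s) \<in> pull U \<sigma> X \<longleftrightarrow> (k, s) \<in> tuples UNIV U \<and> (k, s \<circ> \<sigma>) \<in> X"
  by (simp add: pull_def)

definition project :: "('k \<Rightarrow> 'u set) \<Rightarrow> 'j \<Rightarrow> ('k \<times> ('j \<Rightarrow> 'u)) set \<Rightarrow> ('k \<times> ('j \<Rightarrow> 'u)) set" where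
  "project U w X = {(k, s). (k, s) \<in> tuples UNIV U \<and> (\<exists>u\<in>U k. (k, s(w := u)) \<in> X)}"

context dc_set_hom
begin

text \<open>
  Sets of indices on which finitely many substitution instances of elements of \<open>A\<close> can depend. One
  element \<open>z\<close> suffices by \<open>dim_union\<close>.
\<close>

definition small :: "('c, 'i) idx set \<Rightarrow> bool" where
  "small Z \<longleftrightarrow> (\<exists>z\<in>carrier A. finite (Z - Base ` \<Delta> z))"

text \<open>
  Outside the support, new coordinates can be changed at will, but old ones only at finitely many
  places, as for the elements of \<open>A\<close>.
\<close>

definition supports :: "('c, 'i) idx set \<Rightarrow> ('k \<times> (('c, 'i) idx \<Rightarrow> 'u)) set \<Rightarrow> bool" where
  "supports Z r \<longleftrightarrow> (\<forall>k s s'. (k, s) \<in> tuples UNIV U \<longrightarrow> (k, s') \<in> tuples UNIV U \<longrightarrow>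
     (\<forall>j\<in>Z. s j = s' j) \<longrightarrow> finite {i \<in> Field \<alpha>. s (Base i) \<noteq> s' (Base i)} \<longrightarrow>
     ((k, s) \<in> r \<longleftrightarrow> (k, s') \<in> r))"

definition collapse :: "(('c, 'i) idx \<Rightarrow> 'i) \<Rightarrow> bool" where
  "collapse \<kappa> \<longleftrightarrow> range \<kappa> \<subseteq> Field \<alpha> \<and> finite {i \<in> Field \<alpha>. \<kappa> (Base i) \<noteq> i}"

text \<open>
  The relations that \<open>A\<close> defines on sequences indexed by \<open>('c, 'i) idx\<close>. They are not generated
  from \<open>A\<close> but characterised by their specialisations: whenever the new indices are identified with
  old ones, the result is an element of \<open>A\<close>. Closure under the operations is then easy to
  check, and since a collapse may fix the old indices, \<open>A\<close> gains no relation between these. The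
  latter is the neat reduct property of dimension complemented algebras.
\<close>

definition definable :: "('k \<times> (('c, 'i) idx \<Rightarrow> 'u)) set set" where
  "definable = {r. r \<subseteq> tuples UNIV U \<and> (\<exists>Z. small Z \<and> supports Z r) \<and>
     (\<forall>\<kappa>. collapse \<kappa> \<longrightarrow>
       (\<exists>t\<in>carrier A. \<rho> t = {(k, u). (k, u) \<in> tuples (Field \<alpha>) U \<and> (k, u \<circ> \<kappa>) \<in> r}))}"

lemma definable_sub: "r \<in> definable \<Longrightarrow> r \<subseteq> tuples UNIV U"
  unfolding definable_def by blast

lemma definable_collapse:
  "r \<in> definable \<Longrightarrow> collapse \<kappa> \<Longrightarrow>
    \<exists>t\<in>carrier A. \<rho> t = {(k, u). (k, u) \<in> tuples (Field \<alpha>) U \<and> (k, u \<circ> \<kappa>) \<in> r}"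
  unfolding definable_def by blast

lemma definable_support: "r \<in> definable \<Longrightarrow> \<exists>Z. small Z \<and> supports Z r"
  unfolding definable_def by blast

lemma collapse_tuples:
  "collapse \<kappa> \<Longrightarrow> (k, u) \<in> tuples (Field \<alpha>) U \<Longrightarrow> (k, u \<circ> \<kappa>) \<in> tuples UNIV U"
  unfolding collapse_def by (auto simp: mem_tuples)

lemma small_Un:
  assumes "small Z" "small Z'"
  shows "small (Z \<union> Z')"
proof -
  obtain z z' where z: "z \<in> carrier A" "finite (Z - Base ` \<Delta> z)" "z' \<in> carrier A" "finite (Z' - Base ` \<Delta> z')"
    using assms unfolding small_def by blast
  from dim_union[OF z(1,3)] obtain w where w: "w \<in> carrier A" "finite (\<Delta> z \<union> \<Delta> z' - \<Delta> w)" by blast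
  have "Z \<union> Z' - Base ` \<Delta> w \<subseteq> (Z - Base ` \<Delta> z) \<union> (Z' - Base ` \<Delta> z') \<union> Base ` (\<Delta> z \<union> \<Delta> z' - \<Delta> w)"
    by auto
  then have "finite (Z \<union> Z' - Base ` \<Delta> w)"
    using z w by (meson finite_Un finite_imageI finite_subset)
  then show ?thesis using w(1) unfolding small_def by blast
qed

lemma small_finite: "finite Z \<Longrightarrow> small Z"
  unfolding small_def using zero_closed by blast

text \<open>
  A collapse moves only finitely many old indices, so the image of a small set is again covered by
  one dimension set and finitely many further indices.
\<close>

lemma small_fresh:
  assumes "small Z" "collapse \<kappa>"
  shows "\<exists>v\<in>Field \<alpha>. v \<notin> \<kappa> ` Z"
proof -
  obtain z where z: "z \<in> carrier A" "finite (Z - Base ` \<Delta> z)" using assms unfolding small_def by blast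
  let ?F = "\<kappa> ` (Z - Base ` \<Delta> z) \<union> \<kappa> ` Base ` {i \<in> Field \<alpha>. \<kappa> (Base i) \<noteq> i}"
  have "finite ?F" using z assms unfolding collapse_def by simp
  from infinite_imp_nonempty[OF Diff_infinite_finite[OF this infinite_codim[OF z(1)]]]
  obtain v where v: "v \<in> Field \<alpha>" "v \<notin> \<Delta> z" "v \<notin> ?F" by blast
  have "v \<noteq> \<kappa> j" if "j \<in> Z" for j
  proof (cases "j \<in> Base ` \<Delta> z")
    case True
    then obtain i where i: "j = Base i" "i \<in> \<Delta> z" by blast
    then have "i \<in> Field \<alpha>" by (simp add: dim_set_def)
    then show ?thesis using v i by (cases "\<kappa> (Base i) = i") auto
  next
    case False
    then show ?thesis using v that by blast
  qed
  then show ?thesis using v by blast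
qed

lemma definable_empty: "{} \<in> definable"
proof -
  have "\<exists>t\<in>carrier A. \<rho> t = {}" using zero_closed hom_zero by blast
  moreover have "small {}" "supports {} {}" by (simp_all add: small_finite supports_def)
  ultimately show ?thesis unfolding definable_def by auto
qed

lemma definable_compl:
  assumes r: "r \<in> definable"
  shows "tuples UNIV U - r \<in> definable"
proof -
  obtain Z where Z: "small Z" "supports Z r" using definable_support[OF r] by blast
  have "supports Z (tuples UNIV U - r)" using Z(2) unfolding supports_def by blast
  moreover have "\<exists>t\<in>carrier A. \<rho> t = {(k, u). (k, u) \<in> tuples (Field \<alpha>) U \<and> (k, u \<circ> \<kappa>) \<in> tuples UNIV U - r}"
    if \<kappa>: "collapse \<kappa>" for \<kappa>
  proof -
    obtain t where t: "t \<in> carrier A" "\<rho> t = {(k, u). (k, u) \<in> tuples (Field \<alpha>) U \<and> (k, u \<circ> \<kappa>) \<in> r}"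
      using definable_collapse[OF r \<kappa>] by blast
    then show ?thesis
      using collapse_tuples[OF \<kappa>] by (intro bexI[of _ "\<ominus> t"]) (auto simp: hom_neg neg_closed)
  qed
  ultimately show ?thesis using Z unfolding definable_def by blast
qed

lemma definable_Un:
  assumes r: "r \<in> definable" and r': "r' \<in> definable"
  shows "r \<union> r' \<in> definable"
proof -
  obtain Z Z' where Z: "small Z" "supports Z r" "small Z'" "supports Z' r'"
    using definable_support r r' by blast
  have "supports (Z \<union> Z') (r \<union> r')" using Z(2,4) unfolding supports_def Ball_def Un_iff by meson
  moreover have "\<exists>t\<in>carrier A. \<rho> t = {(k, u). (k, u) \<in> tuples (Field \<alpha>) U \<and> (k, u \<circ> \<kappa>) \<in> r \<union> r'}"
    if \<kappa>: "collapse \<kappa>" for \<kappa>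
  proof -
    obtain t where t: "t \<in> carrier A" "\<rho> t = {(k, u). (k, u) \<in> tuples (Field \<alpha>) U \<and> (k, u \<circ> \<kappa>) \<in> r}"
      using definable_collapse[OF r \<kappa>] by blast
    obtain t' where t': "t' \<in> carrier A" "\<rho> t' = {(k, u). (k, u) \<in> tuples (Field \<alpha>) U \<and> (k, u \<circ> \<kappa>) \<in> r'}"
      using definable_collapse[OF r' \<kappa>] by blast
    show ?thesis
      using t t' by (intro bexI[of _ "t \<oplus> t'"]) (auto simp: hom_add add_closed)
  qed
  ultimately show ?thesis
    using Z small_Un[OF Z(1,3)] definable_sub[OF r] definable_sub[OF r'] unfolding definable_def by blast
qed

text \<open>
  To collapse a projection along \<open>w\<close>, the quantified index \<open>w\<close> is sent to an old index \<open>v\<close> that the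
  support does not use, and \<open>v\<close> is then quantified inside \<open>A\<close>. Dimension complementation
  supplies \<open>v\<close>.
\<close>

lemma definable_project:
  assumes r: "r \<in> definable"
  shows "project U w r \<in> definable"
proof -
  obtain Z where Z: "small Z" "supports Z r" using definable_support[OF r] by blast
  have "supports Z (project U w r)"
    unfolding supports_def
  proof (intro allI impI)
    fix k s s'
    assume s: "(k, s) \<in> tuples UNIV U" and s': "(k, s') \<in> tuples UNIV U" and eq: "\<forall>j\<in>Z. s j = s' j"
      and fin: "finite {i \<in> Field \<alpha>. s (Base i) \<noteq> s' (Base i)}"
    have "(k, s(w := u)) \<in> r \<longleftrightarrow> (k, s'(w := u)) \<in> r" if "u \<in> U k" for u
    proof -
      have "finite {i \<in> Field \<alpha>. (s(w := u)) (Base i) \<noteq> (s'(w := u)) (Base i)}"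
        by (rule finite_subset[OF _ fin]) auto
      then show ?thesis
        using Z(2) s s' eq that unfolding supports_def by (simp add: mem_tuples)
    qed
    then show "(k, s) \<in> project U w r \<longleftrightarrow> (k, s') \<in> project U w r"
      using s s' unfolding project_def by auto
  qed
  moreover have "\<exists>t\<in>carrier A. \<rho> t = {(k, u). (k, u) \<in> tuples (Field \<alpha>) U \<and> (k, u \<circ> \<kappa>) \<in> project U w r}"
    if \<kappa>: "collapse \<kappa>" for \<kappa>
  proof -
    obtain v where v: "v \<in> Field \<alpha>" "v \<notin> \<kappa> ` Z" using small_fresh[OF Z(1) \<kappa>] by blast
    have "{i \<in> Field \<alpha>. (\<kappa>(w := v)) (Base i) \<noteq> i} \<subseteq> insert v {i \<in> Field \<alpha>. \<kappa> (Base i) \<noteq> i} \<union> {i. Base i = w}"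
      by auto
    moreover have "finite {i. Base i = w}" by (cases w) auto
    ultimately have fin': "finite {i \<in> Field \<alpha>. (\<kappa>(w := v)) (Base i) \<noteq> i}"
      using \<kappa> unfolding collapse_def by (meson finite_Un finite_insert finite_subset)
    then have \<kappa>': "collapse (\<kappa>(w := v))" using \<kappa> v unfolding collapse_def by auto
    obtain t where t: "t \<in> carrier A"
      "\<rho> t = {(k, u). (k, u) \<in> tuples (Field \<alpha>) U \<and> (k, u \<circ> \<kappa>(w := v)) \<in> r}"
      using definable_collapse[OF r \<kappa>'] by blast
    have key: "(k, u(v := a) \<circ> \<kappa>(w := v)) \<in> r \<longleftrightarrow> (k, (u \<circ> \<kappa>)(w := a)) \<in> r"
      if u: "(k, u) \<in> tuples (Field \<alpha>) U" and a: "a \<in> U k" for k u a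
    proof -
      have "(k, u(v := a) \<circ> \<kappa>(w := v)) \<in> tuples UNIV U"
        using collapse_tuples[OF \<kappa>' tuples_upd[OF u a]] .
      moreover have "(k, (u \<circ> \<kappa>)(w := a)) \<in> tuples UNIV U"
        using tuples_upd[OF collapse_tuples[OF \<kappa> u] a] .
      moreover have "\<forall>j\<in>Z. (u(v := a) \<circ> \<kappa>(w := v)) j = ((u \<circ> \<kappa>)(w := a)) j" using v by auto
      moreover have "{i \<in> Field \<alpha>. (u(v := a) \<circ> \<kappa>(w := v)) (Base i) \<noteq> ((u \<circ> \<kappa>)(w := a)) (Base i)}
        \<subseteq> insert v {i \<in> Field \<alpha>. \<kappa> (Base i) \<noteq> i}" by auto
      moreover have "finite (insert v {i \<in> Field \<alpha>. \<kappa> (Base i) \<noteq> i})"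
        using \<kappa> unfolding collapse_def by simp
      ultimately show ?thesis using Z(2) unfolding supports_def by (meson finite_subset)
    qed
    have "\<rho> (\<c> v t) = {(k, u). (k, u) \<in> tuples (Field \<alpha>) U \<and> (k, u \<circ> \<kappa>) \<in> project U w r}"
    proof (intro equalityI subrelI)
      fix k u assume "(k, u) \<in> \<rho> (\<c> v t)"
      then show "(k, u) \<in> {(k, u). (k, u) \<in> tuples (Field \<alpha>) U \<and> (k, u \<circ> \<kappa>) \<in> project U w r}"
        using v t key collapse_tuples[OF \<kappa>] by (simp add: hom_cyl project_def) blast
    next
      fix k u assume "(k, u) \<in> {(k, u). (k, u) \<in> tuples (Field \<alpha>) U \<and> (k, u \<circ> \<kappa>) \<in> project U w r}"
      then obtain a where a: "(k, u) \<in> tuples (Field \<alpha>) U" "a \<in> U k" "(k, (u \<circ> \<kappa>)(w := a)) \<in> r"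
        unfolding project_def by auto
      then have "(k, u(v := a)) \<in> \<rho> t" using key[OF a(1,2)] tuples_upd[OF a(1,2)] t by simp
      then show "(k, u) \<in> \<rho> (\<c> v t)" using a v t(1) by (auto simp: hom_cyl)
    qed
    then show ?thesis using t(1) v cyl_closed by blast
  qed
  moreover have "project U w r \<subseteq> tuples UNIV U" unfolding project_def by auto
  ultimately show ?thesis using Z(1) unfolding definable_def by blast
qed

text \<open>
  Composing a finite substitution with a collapse gives a finite substitution on \<open>\<alpha>\<close>, under which
  \<open>A\<close> is closed.
\<close>

lemma definable_pull:
  assumes x: "x \<in> carrier A" and \<sigma>: "finite {i \<in> Field \<alpha>. \<sigma> i \<noteq> Base i}"
  shows "pull U \<sigma> (\<rho> x) \<in> definable"
proof -
  have "small (\<sigma> ` \<Delta> x)"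
  proof -
    have "\<sigma> ` \<Delta> x - Base ` \<Delta> x \<subseteq> \<sigma> ` {i \<in> Field \<alpha>. \<sigma> i \<noteq> Base i}" by (auto simp: dim_set_def)
    then have "finite (\<sigma> ` \<Delta> x - Base ` \<Delta> x)" using \<sigma> by (meson finite_imageI finite_subset)
    then show ?thesis using x unfolding small_def by blast
  qed
  moreover have "supports (\<sigma> ` \<Delta> x) (pull U \<sigma> (\<rho> x))"
    unfolding supports_def
  proof (intro allI impI)
    fix k s s'
    assume s: "(k, s) \<in> tuples UNIV U" and s': "(k, s') \<in> tuples UNIV U" and eq: "\<forall>j\<in>\<sigma> ` \<Delta> x. s j = s' j"
      and fin: "finite {i \<in> Field \<alpha>. s (Base i) \<noteq> s' (Base i)}"
    have "{i \<in> Field \<alpha>. (s \<circ> \<sigma>) i \<noteq> (s' \<circ> \<sigma>) i} \<subseteq>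
      {i \<in> Field \<alpha>. \<sigma> i \<noteq> Base i} \<union> {i \<in> Field \<alpha>. s (Base i) \<noteq> s' (Base i)}" by auto
    then have "finite {i \<in> Field \<alpha>. (s \<circ> \<sigma>) i \<noteq> (s' \<circ> \<sigma>) i}"
      using \<sigma> fin by (meson finite_Un finite_subset)
    then have "(k, s \<circ> \<sigma>) \<in> \<rho> x \<longleftrightarrow> (k, s' \<circ> \<sigma>) \<in> \<rho> x"
      using s s' eq by (intro hom_finite_change[OF x]) (auto simp: mem_tuples)
    then show "(k, s) \<in> pull U \<sigma> (\<rho> x) \<longleftrightarrow> (k, s') \<in> pull U \<sigma> (\<rho> x)" using s s' by (simp add: mem_pull)
  qed
  moreover have "\<exists>t\<in>carrier A. \<rho> t = {(k, u). (k, u) \<in> tuples (Field \<alpha>) U \<and> (k, u \<circ> \<kappa>) \<in> pull U \<sigma> (\<rho> x)}"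
    if \<kappa>: "collapse \<kappa>" for \<kappa>
  proof -
    let ?M = "{i \<in> Field \<alpha>. \<sigma> i \<noteq> Base i} \<union> {i \<in> Field \<alpha>. \<kappa> (Base i) \<noteq> i}"
    have fin: "finite ?M" using \<sigma> \<kappa> unfolding collapse_def by simp
    have "\<exists>t\<in>carrier A. \<rho> t = {(k, u). (k, u) \<in> tuples (Field \<alpha>) U \<and> (k, u \<circ> (\<kappa> \<circ> \<sigma>)) \<in> \<rho> x}"
      using \<kappa> by (intro finite_substitution[OF fin x]) (auto simp: collapse_def)
    then show ?thesis using collapse_tuples[OF \<kappa>] by (simp add: mem_pull comp_assoc cong: conj_cong)
  qed
  moreover have "pull U \<sigma> (\<rho> x) \<subseteq> tuples UNIV U" unfolding pull_def by auto
  ultimately show ?thesis unfolding definable_def by blast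
qed

lemma set_algebra_definable: "set_algebra (tuples UNIV U) definable"
  by unfold_locales (use definable_sub definable_empty definable_compl definable_Un in auto)

end

section \<open>Henkin axioms\<close>

text \<open>
  Sequences of indices that almost agree with \<open>Base\<close> are given by finite lists of exceptions, so that
  they can be stored in a witness.
\<close>

definition app :: "('i \<times> ('c, 'i) idx) list \<Rightarrow> 'i \<Rightarrow> ('c, 'i) idx" where
  "app l i = (case map_of l i of None \<Rightarrow> Base i | Some j \<Rightarrow> j)"

lemma size_app: "app l i \<noteq> Base i \<Longrightarrow> size (app l i) < size (Wit c l i')"
proof (induction l)
  case Nil
  then show ?case by (simp add: app_def)
next
  case (Cons p l)
  obtain i0 j0 where p: "p = (i0, j0)" by (cases p)
  show ?case
  proof (cases "i = i0")
    case True
    then show ?thesis by (simp add: app_def p)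
  next
    case False
    then have "app (p # l) i = app l i" by (simp add: app_def p)
    then show ?thesis using Cons by simp
  qed
qed

lemma Wit_notin_app: "size (Wit c' l' i') \<le> size (Wit c l i) \<Longrightarrow> Wit c l i \<notin> range (app l')"
proof
  assume le: "size (Wit c' l' i') \<le> size (Wit c l i)" and "Wit c l i \<in> range (app l')"
  then obtain m where m: "Wit c l i = app l' m" by blast
  then have "app l' m \<noteq> Base m" by auto
  from size_app[OF this, of c' i'] m le show False by simp
qed

definition cylindrical :: "('k \<Rightarrow> 'u set) \<Rightarrow> 'j \<Rightarrow> ('k \<times> ('j \<Rightarrow> 'u)) set \<Rightarrow> bool" where
  "cylindrical U w X \<longleftrightarrow> (\<forall>k s u. (k, s) \<in> X \<longrightarrow> u \<in> U k \<longrightarrow> (k, s(w := u)) \<in> X)"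

lemma cylindrical_pull:
  assumes "w \<notin> range \<sigma>"
  shows "cylindrical U w (pull U \<sigma> X)"
  unfolding cylindrical_def
proof (intro allI impI)
  fix k s u assume "(k, s) \<in> pull U \<sigma> X" "u \<in> U k"
  moreover have "s(w := u) \<circ> \<sigma> = s \<circ> \<sigma>" using assms by (auto simp: fun_eq_iff)
  ultimately show "(k, s(w := u)) \<in> pull U \<sigma> X" by (simp add: mem_pull tuples_upd)
qed

lemma cylindrical_compl:
  assumes "cylindrical U w X"
  shows "cylindrical U w (tuples UNIV U - X)"
  unfolding cylindrical_def
proof (intro allI impI)
  fix k s u assume *: "(k, s) \<in> tuples UNIV U - X" "u \<in> U k"
  have "s w \<in> U k" using * by (simp add: mem_tuples)
  then have "(k, s(w := u)) \<in> X \<Longrightarrow> (k, s(w := u, w := s w)) \<in> X"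
    using assms unfolding cylindrical_def by blast
  then show "(k, s(w := u)) \<in> tuples UNIV U - X" using * tuples_upd[of k s UNIV U u w] by auto
qed

lemma cylindrical_Un: "cylindrical U w X \<Longrightarrow> cylindrical U w Y \<Longrightarrow> cylindrical U w (X \<union> Y)"
  unfolding cylindrical_def by blast

lemma cylindrical_Int: "cylindrical U w X \<Longrightarrow> cylindrical U w Y \<Longrightarrow> cylindrical U w (X \<inter> Y)"
  unfolding cylindrical_def by blast

lemma cylindrical_Inter: "(\<And>X. X \<in> \<X> \<Longrightarrow> cylindrical U w X) \<Longrightarrow> cylindrical U w (\<Inter>\<X>)"
  unfolding cylindrical_def by blast

text \<open>
  The implication from \<open>\<c> i x\<close> at the sequence \<open>app l\<close> to \<open>x\<close> at the same sequence with the witness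
  at \<open>i\<close>.
\<close>

definition henkin ::
    "('k \<Rightarrow> 'u set) \<Rightarrow> ('i \<Rightarrow> 'a \<Rightarrow> 'a) \<Rightarrow> ('a \<Rightarrow> ('k \<times> ('i \<Rightarrow> 'u)) set) \<Rightarrow>
      'c \<Rightarrow> ('i \<times> ('c, 'i) idx) list \<Rightarrow> 'i \<Rightarrow> 'a \<Rightarrow> ('k \<times> (('c, 'i) idx \<Rightarrow> 'u)) set" where
  "henkin U cy \<rho> c l i x = (tuples UNIV U - pull U (app l) (\<rho> (cy i x))) \<union>
     pull U ((app l)(i := Wit c l i)) (\<rho> x)"

lemma henkin_sub: "henkin U cy \<rho> c l i x \<subseteq> tuples UNIV U"
  unfolding henkin_def by (auto simp: pull_def)

text \<open>
  A Henkin axiom mentions its own witness and otherwise only indices of smaller size, so it does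
  not restrict the witness of any other axiom of the same or a smaller size.
\<close>

lemma cylindrical_henkin:
  assumes "size (Wit c' l' i') \<le> size (Wit c l i)" "(c', l', i') \<noteq> (c, l, i)"
  shows "cylindrical U (Wit c l i) (henkin U cy \<rho> c' l' i' x)"
proof -
  have "Wit c l i \<notin> range ((app l')(i' := Wit c' l' i'))"
    using Wit_notin_app[OF assms(1)] assms(2) by (auto simp: image_iff)
  then show ?thesis
    unfolding henkin_def using Wit_notin_app[OF assms(1)]
    by (intro cylindrical_Un cylindrical_compl cylindrical_pull)
qed

context set_hom
begin

lemma henkin_witness:
  assumes x: "x \<in> carrier A" and i: "i \<in> Field \<alpha>" and s: "(k, s) \<in> tuples UNIV U"
  shows "\<exists>u\<in>U k. (k, s(Wit c l i := u)) \<in> henkin U (cyl A) \<rho> c l i x"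
proof -
  let ?w = "Wit c l i"
  have fresh: "app l j \<noteq> ?w" for j using Wit_notin_app[of c l i c l i] by (metis order_refl rangeI)
  show ?thesis
  proof (cases "(k, s \<circ> app l) \<in> \<rho> (\<c> i x)")
    case True
    then obtain u where u: "u \<in> U k" "(k, (s \<circ> app l)(i := u)) \<in> \<rho> x"
      using x i by (auto simp: hom_cyl)
    have "s(?w := u) \<circ> (app l)(i := ?w) = (s \<circ> app l)(i := u)" using fresh by (auto simp: fun_eq_iff)
    then show ?thesis using u s unfolding henkin_def by (intro bexI[of _ u]) (simp_all add: mem_pull tuples_upd)
  next
    case False
    then have "(k, s) \<in> henkin U (cyl A) \<rho> c l i x" using s unfolding henkin_def by (simp add: mem_pull)
    moreover have "s ?w \<in> U k" using s by (simp add: mem_tuples)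
    ultimately show ?thesis by (intro bexI[of _ "s ?w"]) simp_all
  qed
qed

lemma pull_cong:
  assumes "x \<in> carrier A" "\<And>i. i \<in> Field \<alpha> \<Longrightarrow> \<sigma> i = \<sigma>' i"
  shows "pull U \<sigma> (\<rho> x) = pull U \<sigma>' (\<rho> x)"
proof -
  have "(k, s \<circ> \<sigma>) \<in> \<rho> x \<longleftrightarrow> (k, s \<circ> \<sigma>') \<in> \<rho> x" for k s
    using assms by (intro hom_cong_iff) auto
  then show ?thesis unfolding pull_def by simp
qed

end

context dc_set_hom
begin

text \<open>
  A separating relation for \<open>p \<inter> H\<close> and \<open>q\<close> is turned into one for \<open>p\<close> and \<open>q\<close> by quantifying the
  witness away.
\<close>

lemma separable_project:
  assumes sep: "separable definable (p \<inter> H) q" and p: "cylindrical U w p" and q: "cylindrical U w q"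
    and pS: "p \<subseteq> tuples UNIV U"
    and H: "\<And>k s. (k, s) \<in> p \<Longrightarrow> \<exists>u\<in>U k. (k, s(w := u)) \<in> H"
  shows "separable definable p q"
proof -
  obtain r where r: "r \<in> definable" "p \<inter> H \<subseteq> r" "q \<inter> r = {}" using sep unfolding separable_def by blast
  have "p \<subseteq> project U w r"
  proof (rule subrelI)
    fix k s assume ks: "(k, s) \<in> p"
    then obtain u where u: "u \<in> U k" "(k, s(w := u)) \<in> H" using H by blast
    then have "(k, s(w := u)) \<in> p" using p ks unfolding cylindrical_def by blast
    then show "(k, s) \<in> project U w r" using u r(2) ks pS unfolding project_def by blast
  qed
  moreover have "q \<inter> project U w r = {}"
    using q r(3) unfolding cylindrical_def project_def by blast
  ultimately show ?thesis using definable_project[OF r(1)] unfolding separable_def by blast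
qed

end

section \<open>Models whose base consists of indices\<close>

definition index_seqs :: "'i rel \<Rightarrow> ('i \<Rightarrow> ('c, 'i) idx) set" where
  "index_seqs \<alpha> = {\<tau>. finite {i \<in> Field \<alpha>. \<tau> i \<noteq> Base i}}"

lemma index_seqs_upd: "\<tau> \<in> index_seqs \<alpha> \<Longrightarrow> \<tau>(i := j) \<in> index_seqs \<alpha>"
proof -
  assume "\<tau> \<in> index_seqs \<alpha>"
  then have "finite (insert i {i \<in> Field \<alpha>. \<tau> i \<noteq> Base i})" by (simp add: index_seqs_def)
  moreover have "{i' \<in> Field \<alpha>. (\<tau>(i := j)) i' \<noteq> Base i'} \<subseteq> insert i {i \<in> Field \<alpha>. \<tau> i \<noteq> Base i}"
    by auto
  ultimately show ?thesis unfolding index_seqs_def mem_Collect_eq by (rule rev_finite_subset)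
qed

text \<open>
  A homomorphism into a weak set algebra with base \<open>('c, 'i) idx\<close> modulo \<open>E\<close>. The quotient is not
  formed: its sets of sequences are the \<open>E\<close>-saturated sets.
\<close>

locale index_model = cyl_type_algebra \<alpha> A
  for \<alpha> :: "'i rel" and A :: "('a, 'i) cyl_alg" (structure) +
  fixes E :: "('c, 'i) idx \<Rightarrow> ('c, 'i) idx \<Rightarrow> bool" and M :: "'a \<Rightarrow> ('i \<Rightarrow> ('c, 'i) idx) set"
  assumes E: "equivp E"
    and model_sub: "x \<in> carrier A \<Longrightarrow> M x \<subseteq> index_seqs \<alpha>"
    and model_sat: "x \<in> carrier A \<Longrightarrow> \<tau> \<in> M x \<Longrightarrow> \<tau>' \<in> index_seqs \<alpha> \<Longrightarrow>
      (\<And>i. i \<in> Field \<alpha> \<Longrightarrow> E (\<tau> i) (\<tau>' i)) \<Longrightarrow> \<tau>' \<in> M x"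
    and model_add: "x \<in> carrier A \<Longrightarrow> y \<in> carrier A \<Longrightarrow> M (x \<oplus> y) = M x \<union> M y"
    and model_mult: "x \<in> carrier A \<Longrightarrow> y \<in> carrier A \<Longrightarrow> M (x \<otimes> y) = M x \<inter> M y"
    and model_neg: "x \<in> carrier A \<Longrightarrow> M (\<ominus> x) = index_seqs \<alpha> - M x"
    and model_zero: "M \<zero> = {}"
    and model_one: "M \<one> = index_seqs \<alpha>"
    and model_cyl: "i \<in> Field \<alpha> \<Longrightarrow> x \<in> carrier A \<Longrightarrow>
      M (\<c> i x) = {\<tau> \<in> index_seqs \<alpha>. \<exists>j. \<tau>(i := j) \<in> M x}"
    and model_diag: "i \<in> Field \<alpha> \<Longrightarrow> j \<in> Field \<alpha> \<Longrightarrow>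
      M (\<d> i j) = {\<tau> \<in> index_seqs \<alpha>. E (\<tau> i) (\<tau> j)}"

context set_hom
begin

lemma app_surj:
  assumes "\<tau> \<in> index_seqs \<alpha>"
  shows "\<exists>l. \<forall>i\<in>Field \<alpha>. app l i = \<tau> i"
proof -
  obtain xs where xs: "set xs = {i \<in> Field \<alpha>. \<tau> i \<noteq> Base i}"
    using assms finite_list unfolding index_seqs_def by blast
  have "app (map (\<lambda>i. (i, \<tau> i)) xs) i = \<tau> i" if "i \<in> Field \<alpha>" for i
    using that xs by (auto simp: app_def map_of_map_restrict restrict_map_def)
  then show ?thesis by blast
qed

text \<open>
  A sequence of indices satisfies \<open>x\<close> if the ultrafilter contains the corresponding substitution
  instance of \<open>x\<close>. The Henkin axioms are exactly what makes this commute with cylindrifications.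
\<close>

lemma index_model_of_ultra:
  fixes F :: "('k \<times> (('c, 'i) idx \<Rightarrow> 'u)) set set" and wit :: "'a \<Rightarrow> 'c"
  assumes u: "ultra (tuples UNIV U) F"
    and henkin: "\<And>x l i. x \<in> carrier A \<Longrightarrow> i \<in> Field \<alpha> \<Longrightarrow> henkin U (cyl A) \<rho> (wit x) l i x \<in> F"
  shows "index_model \<alpha> A (\<lambda>j j'. {(k, s). (k, s) \<in> tuples UNIV U \<and> s j = s j'} \<in> F)
    (\<lambda>x. {\<tau> \<in> index_seqs \<alpha>. pull U \<tau> (\<rho> x) \<in> F})"
proof -
  define E where "E j j' \<longleftrightarrow> {(k, s). (k, s) \<in> tuples UNIV U \<and> s j = s j'} \<in> F" for j j'
  have E_sub: "{(k, s). (k, s) \<in> tuples UNIV U \<and> s j = s j'} \<subseteq> tuples UNIV U" for j j' :: "('c, 'i) idx"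
    by auto
  have pull_sub: "pull U \<tau> X \<subseteq> tuples UNIV U" for \<tau> :: "'i \<Rightarrow> ('c, 'i) idx" and X by (auto simp: pull_def)
  have "index_model \<alpha> A E (\<lambda>x. {\<tau> \<in> index_seqs \<alpha>. pull U \<tau> (\<rho> x) \<in> F})"
  proof (unfold_locales, goal_cases)
    case 1
    show ?case
    proof (rule equivpI)
      show "reflp E" using ultra_top[OF u] unfolding E_def by (intro reflpI) simp
      show "symp E" unfolding E_def by (intro sympI) (simp add: eq_commute)
      show "transp E"
      proof (rule transpI)
        fix j j' j'' assume "E j j'" "E j' j''"
        then have "{(k, s). (k, s) \<in> tuples UNIV U \<and> s j = s j'} \<inter>
          {(k, s). (k, s) \<in> tuples UNIV U \<and> s j' = s j''} \<in> F"
          unfolding E_def using ultra_Int[OF u E_sub E_sub] by blast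
        then show "E j j''" unfolding E_def by (rule ultra_mono[OF u _ _ E_sub]) auto
      qed
    qed
  next
    case (2 x) then show ?case by blast
  next
    case (3 x \<tau> \<tau>')
    define D where "D = {i \<in> Field \<alpha>. \<tau> i \<noteq> \<tau>' i}"
    have "D \<subseteq> {i \<in> Field \<alpha>. \<tau> i \<noteq> Base i} \<union> {i \<in> Field \<alpha>. \<tau>' i \<noteq> Base i}" unfolding D_def by auto
    then have "finite D" using 3 unfolding index_seqs_def by (auto elim: finite_subset)
    define \<X> where "\<X> = (\<lambda>i. {(k, s). (k, s) \<in> tuples UNIV U \<and> s (\<tau> i) = s (\<tau>' i)}) ` D"
    have "finite \<X>" using \<open>finite D\<close> unfolding \<X>_def by simp
    have "\<X> \<subseteq> F" using 3(4) unfolding \<X>_def D_def E_def by auto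
    then have "tuples UNIV U \<inter> \<Inter>\<X> \<in> F" using \<open>finite \<X>\<close> by (intro ultra_Inter[OF u])
    then have in_F: "pull U \<tau> (\<rho> x) \<inter> (tuples UNIV U \<inter> \<Inter>\<X>) \<in> F"
      using 3(2) ultra_Int[OF u pull_sub, of "tuples UNIV U \<inter> \<Inter>\<X>"] by simp
    have "pull U \<tau> (\<rho> x) \<inter> (tuples UNIV U \<inter> \<Inter>\<X>) \<subseteq> pull U \<tau>' (\<rho> x)"
    proof (rule subrelI)
      fix k s assume *: "(k, s) \<in> pull U \<tau> (\<rho> x) \<inter> (tuples UNIV U \<inter> \<Inter>\<X>)"
      have "(s \<circ> \<tau>) i = (s \<circ> \<tau>') i" if "i \<in> Field \<alpha>" for i
        using * that unfolding \<X>_def D_def by (cases "\<tau> i = \<tau>' i") auto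
      then have "(k, s \<circ> \<tau>) \<in> \<rho> x \<longleftrightarrow> (k, s \<circ> \<tau>') \<in> \<rho> x" by (intro hom_cong_iff[OF 3(1)])
      then show "(k, s) \<in> pull U \<tau>' (\<rho> x)" using * by (simp add: mem_pull)
    qed
    from ultra_mono[OF u in_F this pull_sub] have "pull U \<tau>' (\<rho> x) \<in> F" .
    then show ?case using 3 by blast
  next
    case (4 x y)
    have "pull U \<tau> (\<rho> (x \<oplus> y)) = pull U \<tau> (\<rho> x) \<union> pull U \<tau> (\<rho> y)" for \<tau> :: "'i \<Rightarrow> ('c, 'i) idx"
      using 4 by (auto simp: pull_def hom_add)
    then show ?case using ultra_Un[OF u pull_sub pull_sub] by auto
  next
    case (5 x y)
    have "pull U \<tau> (\<rho> (x \<otimes> y)) = pull U \<tau> (\<rho> x) \<inter> pull U \<tau> (\<rho> y)" for \<tau> :: "'i \<Rightarrow> ('c, 'i) idx"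
      using 5 by (auto simp: pull_def hom_mult)
    then show ?case using ultra_Int[OF u pull_sub pull_sub] by auto
  next
    case (6 x)
    have "pull U \<tau> (\<rho> (\<ominus> x)) = tuples UNIV U - pull U \<tau> (\<rho> x)" for \<tau> :: "'i \<Rightarrow> ('c, 'i) idx"
      using 6 by (auto simp: pull_def hom_neg mem_tuples)
    then show ?case using ultra_compl[OF u pull_sub] by auto
  next
    case 7
    have "pull U \<tau> (\<rho> \<zero>) = {}" for \<tau> :: "'i \<Rightarrow> ('c, 'i) idx"
      by (auto simp: pull_def hom_zero)
    then show ?case using ultra_empty[OF u] by auto
  next
    case 8
    have "pull U \<tau> (\<rho> \<one>) = tuples UNIV U" for \<tau> :: "'i \<Rightarrow> ('c, 'i) idx"
      by (auto simp: pull_def hom_one mem_tuples)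
    then show ?case using ultra_top[OF u] by auto
  next
    case (9 i x)
    have "pull U \<tau> (\<rho> (\<c> i x)) \<in> F \<longleftrightarrow> (\<exists>j. pull U (\<tau>(i := j)) (\<rho> x) \<in> F)" if \<tau>: "\<tau> \<in> index_seqs \<alpha>" for \<tau>
    proof
      assume *: "pull U \<tau> (\<rho> (\<c> i x)) \<in> F"
      obtain l where l: "\<forall>i\<in>Field \<alpha>. app l i = \<tau> i" using app_surj[OF \<tau>] by blast
      let ?w = "Wit (wit x) l i"
      have "pull U (app l) (\<rho> (\<c> i x)) \<in> F"
        using * l pull_cong[of "\<c> i x" "app l" \<tau>] 9 cyl_closed by simp
      then have "pull U ((app l)(i := ?w)) (\<rho> x) \<in> F"
        using henkin[OF 9(2,1), of l] ultra_compl[OF u pull_sub, of "app l" "\<rho> (\<c> i x)"]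
        unfolding henkin_def by (simp add: ultra_Un[OF u Diff_subset pull_sub])
      moreover have "pull U ((app l)(i := ?w)) (\<rho> x) = pull U (\<tau>(i := ?w)) (\<rho> x)"
        using l 9 by (intro pull_cong) auto
      ultimately show "\<exists>j. pull U (\<tau>(i := j)) (\<rho> x) \<in> F" by auto
    next
      assume "\<exists>j. pull U (\<tau>(i := j)) (\<rho> x) \<in> F"
      then obtain j where j: "pull U (\<tau>(i := j)) (\<rho> x) \<in> F" by blast
      have "pull U (\<tau>(i := j)) (\<rho> x) \<subseteq> pull U \<tau> (\<rho> (\<c> i x))"
      proof (rule subrelI)
        fix k s assume *: "(k, s) \<in> pull U (\<tau>(i := j)) (\<rho> x)"
        have upd: "s \<circ> \<tau>(i := j) = (s \<circ> \<tau>)(i := s j)" by (auto simp: fun_eq_iff)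
        have "(k, s) \<in> tuples UNIV U" "(k, (s \<circ> \<tau>)(i := s j)) \<in> \<rho> x"
          using * by (simp_all only: mem_pull upd)
        moreover from this have "s j \<in> U k" "(k, s \<circ> \<tau>) \<in> tuples (Field \<alpha>) U" by (simp_all add: mem_tuples)
        ultimately show "(k, s) \<in> pull U \<tau> (\<rho> (\<c> i x))"
          unfolding mem_pull hom_cyl[OF 9] by blast
      qed
      from ultra_mono[OF u j this pull_sub] show "pull U \<tau> (\<rho> (\<c> i x)) \<in> F" .
    qed
    then show ?case by (simp add: index_seqs_upd cong: conj_cong)
  next
    case (10 i j)
    have "pull U \<tau> (\<rho> (\<d> i j)) = {(k, s). (k, s) \<in> tuples UNIV U \<and> s (\<tau> i) = s (\<tau> j)}"
      for \<tau> :: "'i \<Rightarrow> ('c, 'i) idx"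
      using 10 by (auto simp: pull_def hom_diag mem_tuples)
    then show ?case unfolding E_def by simp
  qed
  then show ?thesis unfolding E_def .
qed

end

section \<open>Joint models of two algebras without interpolant\<close>

text \<open>
  The representations of \<open>A1\<close> and \<open>A2\<close> use disjoint sets of factors. Their union therefore represents
  \<open>A0\<close>, and a relation of \<open>A0\<close> is a single set with a part on either side.
\<close>

locale amalgamation_problem =
  fixes \<alpha> :: "'i rel" and A0 :: "('a0, 'i) cyl_alg" and A1 :: "('a1, 'i) cyl_alg"
    and A2 :: "('a2, 'i) cyl_alg" and f :: "'a0 \<Rightarrow> 'a1" and g :: "'a0 \<Rightarrow> 'a2"
    and U1 U2 :: "'k \<Rightarrow> 'u set"
    and \<rho>1 :: "'a1 \<Rightarrow> ('k \<times> ('i \<Rightarrow> 'u)) set" and \<rho>2 :: "'a2 \<Rightarrow> ('k \<times> ('i \<Rightarrow> 'u)) set"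
  assumes A0: "A0 \<in> Dc \<alpha>" and infinite_dim: "infinite (Field \<alpha>)"
    and rep1: "set_hom \<alpha> A1 U1 \<rho>1" and faithful1: "inj_on \<rho>1 (carrier A1)"
    and rep2: "set_hom \<alpha> A2 U2 \<rho>2" and faithful2: "inj_on \<rho>2 (carrier A2)"
    and disjoint: "U1 k = {} \<or> U2 k = {}"
    and f: "monomorphism \<alpha> A0 A1 f" and g: "monomorphism \<alpha> A0 A2 g"
begin

sublocale one: set_hom \<alpha> A1 U1 \<rho>1 by (fact rep1)
sublocale two: set_hom \<alpha> A2 U2 \<rho>2 by (fact rep2)

lemma f_closed: "t \<in> carrier A0 \<Longrightarrow> f t \<in> carrier A1"
  and g_closed: "t \<in> carrier A0 \<Longrightarrow> g t \<in> carrier A2"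
  using f g unfolding monomorphism_def homomorphism_def by auto

abbreviation U :: "'k \<Rightarrow> 'u set" where "U \<equiv> \<lambda>k. U1 k \<union> U2 k"

abbreviation \<rho>0 :: "'a0 \<Rightarrow> ('k \<times> ('i \<Rightarrow> 'u)) set" where "\<rho>0 \<equiv> \<lambda>t. \<rho>1 (f t) \<union> \<rho>2 (g t)"

lemma tuples_U: "tuples I U = tuples I U1 \<union> tuples I U2"
proof -
  have "(k, s) \<in> tuples I U \<longleftrightarrow> (k, s) \<in> tuples I U1 \<or> (k, s) \<in> tuples I U2" for k s
    using disjoint[of k] unfolding mem_tuples by auto
  then show ?thesis by auto
qed

lemma tuples_disjoint: "I \<noteq> {} \<Longrightarrow> (k, s) \<in> tuples I U1 \<Longrightarrow> (k, s) \<notin> tuples I U2"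
  using disjoint[of k] unfolding mem_tuples by auto

lemma dim_nonempty: "Field \<alpha> \<noteq> {}"
  using infinite_dim by auto

sublocale zero: dc_set_hom \<alpha> A0 U \<rho>0
proof -
  interpret A0: cylindric_algebra \<alpha> A0 using A0 unfolding Dc_def CA_def by blast
  note hom = f[unfolded monomorphism_def homomorphism_def] g[unfolded monomorphism_def homomorphism_def]
  have disj: "\<rho>1 (f x) \<inter> tuples (Field \<alpha>) U2 = {}" "\<rho>2 (g x) \<inter> tuples (Field \<alpha>) U1 = {}"
    if "x \<in> carrier A0" for x
    using one.hom_sub[OF f_closed[OF that]] two.hom_sub[OF g_closed[OF that]] tuples_disjoint[OF dim_nonempty]
    by auto
  have sub: "\<rho>1 (f x) \<subseteq> tuples (Field \<alpha>) U1" "\<rho>2 (g x) \<subseteq> tuples (Field \<alpha>) U2"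
    if "x \<in> carrier A0" for x
    using one.hom_sub[OF f_closed[OF that]] two.hom_sub[OF g_closed[OF that]] .
  have disj2: "\<rho>1 (f x) \<inter> \<rho>2 (g y) = {}" if "x \<in> carrier A0" "y \<in> carrier A0" for x y
    using disj[OF that(1)] sub[OF that(2)] by blast
  show "dc_set_hom \<alpha> A0 U \<rho>0"
  proof (unfold_locales, goal_cases)
    case (1 x)
    then show ?case using sub[OF 1] unfolding tuples_U by blast
  next
    case (2 x k s s')
    then show ?case using one.hom_cong[OF f_closed, of x k s s'] two.hom_cong[OF g_closed, of x k s s'] by blast
  next
    case (3 x y)
    then show ?case using hom f_closed g_closed by (simp add: one.hom_add two.hom_add Un_ac)
  next
    case (4 x y)
    have "\<rho>0 (x \<otimes>\<^bsub>A0\<^esub> y) = (\<rho>1 (f x) \<inter> \<rho>1 (f y)) \<union> (\<rho>2 (g x) \<inter> \<rho>2 (g y))"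
      using 4 hom f_closed g_closed by (simp add: one.hom_mult two.hom_mult)
    then show ?case using disj2[OF 4] disj2[OF 4(2,1)] by blast
  next
    case (5 x)
    have "\<rho>0 (\<ominus>\<^bsub>A0\<^esub> x) = (tuples (Field \<alpha>) U1 - \<rho>1 (f x)) \<union> (tuples (Field \<alpha>) U2 - \<rho>2 (g x))"
      using 5 hom f_closed g_closed by (simp add: one.hom_neg two.hom_neg)
    then show ?case using disj[OF 5] sub[OF 5] unfolding tuples_U by blast
  next
    case 6
    then show ?case using hom by (simp add: one.hom_zero two.hom_zero)
  next
    case 7
    then show ?case using hom by (simp add: one.hom_one two.hom_one tuples_U)
  next
    case (8 i x)
    have eq: "\<rho>0 (\<c>\<^bsub>A0\<^esub> i x) =
      {(k, s). (k, s) \<in> tuples (Field \<alpha>) U1 \<and> (\<exists>u\<in>U1 k. (k, s(i := u)) \<in> \<rho>1 (f x))} \<union>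
      {(k, s). (k, s) \<in> tuples (Field \<alpha>) U2 \<and> (\<exists>u\<in>U2 k. (k, s(i := u)) \<in> \<rho>2 (g x))}"
      using 8 hom f_closed g_closed by (simp add: one.hom_cyl two.hom_cyl)
    have "(k, s) \<in> tuples (Field \<alpha>) U1 \<and> (\<exists>u\<in>U1 k. (k, s(i := u)) \<in> \<rho>1 (f x)) \<or>
      (k, s) \<in> tuples (Field \<alpha>) U2 \<and> (\<exists>u\<in>U2 k. (k, s(i := u)) \<in> \<rho>2 (g x)) \<longleftrightarrow>
      (k, s) \<in> tuples (Field \<alpha>) U \<and> (\<exists>u\<in>U k. (k, s(i := u)) \<in> \<rho>0 x)" for k s
    proof (cases "U1 k = {}")
      case True
      then have "(k, s') \<notin> \<rho>1 (f x)" for s' using sub(1)[OF 8(2)] dim_nonempty by (auto simp: mem_tuples dest!: subsetD)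
      moreover have "(k, s) \<in> tuples (Field \<alpha>) U \<longleftrightarrow> (k, s) \<in> tuples (Field \<alpha>) U2" using True by (simp add: mem_tuples)
      ultimately show ?thesis using True by simp
    next
      case False
      then have U2: "U2 k = {}" using disjoint by blast
      then have "(k, s') \<notin> \<rho>2 (g x)" for s' using sub(2)[OF 8(2)] dim_nonempty by (auto simp: mem_tuples dest!: subsetD)
      moreover have "(k, s) \<in> tuples (Field \<alpha>) U \<longleftrightarrow> (k, s) \<in> tuples (Field \<alpha>) U1" using U2 by (simp add: mem_tuples)
      ultimately show ?thesis using U2 by simp
    qed
    then show ?case unfolding eq by auto
  next
    case (9 i j)
    then show ?case using hom by (auto simp: one.hom_diag two.hom_diag tuples_U)
  next
    case 10
    show ?case
    proof (rule inj_onI)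
      fix x y assume xy: "x \<in> carrier A0" "y \<in> carrier A0" "\<rho>0 x = \<rho>0 y"
      then have "\<rho>1 (f x) = \<rho>1 (f y)" using disj2[OF xy(1,2)] disj2[OF xy(2,1)] disj2[OF xy(1,1)] disj2[OF xy(2,2)] by blast
      then show "x = y"
        using xy f faithful1 f_closed unfolding monomorphism_def inj_on_def by blast
    qed
  next
    case (11 x)
    then show ?case using A0 unfolding Dc_def by blast
  next
    case 12
    show ?case by (fact infinite_dim)
  qed
qed

lemma pull_\<rho>0:
  fixes \<sigma> :: "'i \<Rightarrow> 'j"
  assumes t: "t \<in> carrier A0"
  shows "pull U \<sigma> (\<rho>0 t) \<inter> tuples UNIV U1 = pull U1 \<sigma> (\<rho>1 (f t))"
    and "pull U \<sigma> (\<rho>0 t) \<inter> tuples UNIV U2 = pull U2 \<sigma> (\<rho>2 (g t))"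
proof -
  have *: "(k, s \<circ> \<sigma>) \<in> \<rho>1 (f t) \<Longrightarrow> (k, s \<circ> \<sigma>) \<notin> tuples (Field \<alpha>) U2"
    "(k, s \<circ> \<sigma>) \<in> \<rho>2 (g t) \<Longrightarrow> (k, s \<circ> \<sigma>) \<notin> tuples (Field \<alpha>) U1" for k s
    using one.hom_sub[OF f_closed[OF t]] two.hom_sub[OF g_closed[OF t]] tuples_disjoint[OF dim_nonempty] by blast+
  have **: "(k, s) \<in> tuples UNIV V \<Longrightarrow> (k, s \<circ> \<sigma>) \<in> tuples (Field \<alpha>) V" for k s and V :: "'k \<Rightarrow> 'u set"
    by (simp add: mem_tuples)
  show "pull U \<sigma> (\<rho>0 t) \<inter> tuples UNIV U1 = pull U1 \<sigma> (\<rho>1 (f t))"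
    by (auto simp: pull_def tuples_U dest: * **)
  show "pull U \<sigma> (\<rho>0 t) \<inter> tuples UNIV U2 = pull U2 \<sigma> (\<rho>2 (g t))"
    by (auto simp: pull_def tuples_U dest: * **)
qed

lemma cylindrical_U:
  "X \<subseteq> tuples UNIV U1 \<Longrightarrow> cylindrical U1 w X \<Longrightarrow> cylindrical U w X"
  "X \<subseteq> tuples UNIV U2 \<Longrightarrow> cylindrical U2 w X \<Longrightarrow> cylindrical U w X"
proof -
  have *: "(k, s) \<in> tuples UNIV U1 \<Longrightarrow> U k = U1 k" "(k, s) \<in> tuples UNIV U2 \<Longrightarrow> U k = U2 k"
    for k and s :: "'j \<Rightarrow> 'u"
    using disjoint[of k] by (auto simp: mem_tuples)
  show "X \<subseteq> tuples UNIV U1 \<Longrightarrow> cylindrical U1 w X \<Longrightarrow> cylindrical U w X"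
    unfolding cylindrical_def using *(1) by blast
  show "X \<subseteq> tuples UNIV U2 \<Longrightarrow> cylindrical U2 w X \<Longrightarrow> cylindrical U w X"
    unfolding cylindrical_def using *(2) by blast
qed

text \<open>
  The Henkin axiom for a requirement concerns only one of the two sides; on the other side it is taken
  to be the whole space. In this way one finite set of requirements controls both sides.
\<close>

definition henkin_at :: "bool \<Rightarrow> ('a1 + 'a2) \<times> ('i \<times> ('a1 + 'a2, 'i) idx) list \<times> 'i \<Rightarrow>
    ('k \<times> (('a1 + 'a2, 'i) idx \<Rightarrow> 'u)) set" where
  "henkin_at left y = (case y of (c, l, i) \<Rightarrow>
     (if left then (case c of Inl a \<Rightarrow> henkin U1 (cyl A1) \<rho>1 c l i a | Inr b \<Rightarrow> tuples UNIV U1)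
      else (case c of Inl a \<Rightarrow> tuples UNIV U2 | Inr b \<Rightarrow> henkin U2 (cyl A2) \<rho>2 c l i b)))"

abbreviation requirements ::
    "(('a1 + 'a2) \<times> ('i \<times> ('a1 + 'a2, 'i) idx) list \<times> 'i) set" where
  "requirements \<equiv> (carrier A1 <+> carrier A2) \<times> UNIV \<times> Field \<alpha>"

lemma henkin_at_sub: "henkin_at left y \<subseteq> tuples UNIV (if left then U1 else U2)"
  unfolding henkin_at_def by (simp add: henkin_sub split: prod.split sum.split)

lemma cylindrical_tuples: "cylindrical V w (tuples UNIV V)"
  unfolding cylindrical_def by (simp add: tuples_upd)

lemma cylindrical_henkin_at:
  assumes "size (Wit c' l' i') \<le> size (Wit c l i)" "(c', l', i') \<noteq> (c, l, i)"
  shows "cylindrical U (Wit c l i) (henkin_at left (c', l', i'))"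
proof (cases left)
  case True
  have "cylindrical U1 (Wit c l i) (henkin_at left (c', l', i'))"
    using cylindrical_henkin[OF assms, of U1 "cyl A1" \<rho>1] True
    by (cases c') (simp_all add: henkin_at_def cylindrical_tuples)
  from cylindrical_U(1)[OF _ this] henkin_at_sub[of left "(c', l', i')"] True show ?thesis by simp
next
  case False
  have "cylindrical U2 (Wit c l i) (henkin_at left (c', l', i'))"
    using cylindrical_henkin[OF assms, of U2 "cyl A2" \<rho>2] False
    by (cases c') (simp_all add: henkin_at_def cylindrical_tuples)
  from cylindrical_U(2)[OF _ this] henkin_at_sub[of left "(c', l', i')"] False show ?thesis by simp
qed

text \<open>
  The axioms are removed one at a time, one with a witness of maximal size first. No remaining axiom
  restricts this witness, so it can be quantified away.
\<close>

lemma inseparable_axioms: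
  assumes insep: "\<not> separable zero.definable p q"
    and p: "p \<subseteq> tuples UNIV U1" "\<And>c l i. cylindrical U (Wit c l i) p"
    and q: "q \<subseteq> tuples UNIV U2" "\<And>c l i. cylindrical U (Wit c l i) q"
    and "finite Q" "Q \<subseteq> requirements"
  shows "\<not> separable zero.definable (p \<inter> \<Inter>(henkin_at True ` Q)) (q \<inter> \<Inter>(henkin_at False ` Q))"
  using assms(6,7)
proof (induction Q rule: finite_ranking_induct[where f = "\<lambda>(c, l, i). size (Wit c l i)"])
  case empty
  then show ?case using insep by simp
next
  case (insert y Q)
  show ?case
  proof (cases "y \<in> Q")
    case True
    then show ?thesis using insert by (simp add: insert_absorb)
  next
    case new: False
    obtain c l i where y: "y = (c, l, i)" by (cases y)
    have i: "i \<in> Field \<alpha>" using insert.prems y by blast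
    define p' where "p' = p \<inter> \<Inter>(henkin_at True ` Q)"
    define q' where "q' = q \<inter> \<Inter>(henkin_at False ` Q)"
    have IH: "\<not> separable zero.definable p' q'" using insert unfolding p'_def q'_def by blast
    have ax: "cylindrical U (Wit c l i) (henkin_at left y')" if "y' \<in> Q" for left y'
    proof -
      obtain c' l' i' where y': "y' = (c', l', i')" by (cases y')
      then show ?thesis
        using insert.hyps(2)[OF that] that new y cylindrical_henkin_at[of c' l' i' c l i left] by auto
    qed
    have cyl: "cylindrical U (Wit c l i) p'" "cylindrical U (Wit c l i) q'"
      unfolding p'_def q'_def using p(2) q(2) ax by (auto intro!: cylindrical_Int cylindrical_Inter)
    have p'T: "p' \<subseteq> tuples UNIV U1" and q'T: "q' \<subseteq> tuples UNIV U2"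
      using p(1) q(1) unfolding p'_def q'_def by auto
    have p'S: "p' \<subseteq> tuples UNIV U" and q'S: "q' \<subseteq> tuples UNIV U"
      using p'T q'T unfolding tuples_U by auto
    note sym = set_algebra.separable_sym[OF zero.set_algebra_definable]
    have "\<not> separable zero.definable (p' \<inter> henkin_at True y) (q' \<inter> henkin_at False y)"
    proof
      assume sep: "separable zero.definable (p' \<inter> henkin_at True y) (q' \<inter> henkin_at False y)"
      show False
      proof (cases c)
        case (Inl a)
        have a: "a \<in> carrier A1" using insert.prems y Inl by auto
        have "q' \<inter> henkin_at False y = q'" using q'T y Inl by (auto simp: henkin_at_def)
        then have sep': "separable zero.definable (p' \<inter> henkin_at True y) q'" using sep by simp
        have "\<exists>u\<in>U k. (k, s(Wit c l i := u)) \<in> henkin_at True y" if "(k, s) \<in> p'" for k s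
          using one.henkin_witness[OF a i, of k s c l] that p'T y Inl by (auto simp: henkin_at_def)
        from zero.separable_project[OF sep' cyl p'S this] show False using IH by blast
      next
        case (Inr b)
        have b: "b \<in> carrier A2" using insert.prems y Inr by auto
        have "p' \<inter> henkin_at True y = p'" using p'T y Inr by (auto simp: henkin_at_def)
        then have "separable zero.definable p' (q' \<inter> henkin_at False y)" using sep by simp
        then have sep': "separable zero.definable (q' \<inter> henkin_at False y) p'" by (rule sym) (use q'S in blast)
        have "\<exists>u\<in>U k. (k, s(Wit c l i := u)) \<in> henkin_at False y" if "(k, s) \<in> q'" for k s
          using two.henkin_witness[OF b i, of k s c l] that q'T y Inr by (auto simp: henkin_at_def)
        from zero.separable_project[OF sep' cyl(2,1) q'S this] show False using IH sym[OF _ p'S] by blast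
      qed
    qed
    then show ?thesis unfolding p'_def q'_def by (simp add: Int_ac)
  qed
qed

lemma le_iff_subset:
  "x \<in> carrier A1 \<Longrightarrow> y \<in> carrier A1 \<Longrightarrow> x \<sqsubseteq>\<^bsub>A1\<^esub> y \<longleftrightarrow> \<rho>1 x \<subseteq> \<rho>1 y"
  "x' \<in> carrier A2 \<Longrightarrow> y' \<in> carrier A2 \<Longrightarrow> x' \<sqsubseteq>\<^bsub>A2\<^esub> y' \<longleftrightarrow> \<rho>2 x' \<subseteq> \<rho>2 y'"
  using inj_on_eq_iff[OF faithful1 one.add_closed, of x y y] inj_on_eq_iff[OF faithful2 two.add_closed, of x' y' y']
  by (auto simp: le_def one.hom_add two.hom_add)

text \<open>
  Collapsing the new indices and keeping the old ones turns a separating relation into an interpolant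
  in \<open>A0\<close>.
\<close>

lemma inseparable_base:
  assumes a: "a \<in> carrier A1" and b: "b \<in> carrier A2"
    and no: "\<not> (\<exists>t\<in>carrier A0. a \<sqsubseteq>\<^bsub>A1\<^esub> f t \<and> g t \<sqsubseteq>\<^bsub>A2\<^esub> b)"
  shows "\<not> separable zero.definable (pull U1 (Base :: 'i \<Rightarrow> ('c, 'i) idx) (\<rho>1 a))
    (tuples UNIV U2 - pull U2 Base (\<rho>2 b))"
proof
  assume "separable zero.definable (pull U1 (Base :: 'i \<Rightarrow> ('c, 'i) idx) (\<rho>1 a)) (tuples UNIV U2 - pull U2 Base (\<rho>2 b))"
  then obtain r :: "('k \<times> (('c, 'i) idx \<Rightarrow> 'u)) set" where r: "r \<in> zero.definable" "pull U1 Base (\<rho>1 a) \<subseteq> r"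
    "(tuples UNIV U2 - pull U2 Base (\<rho>2 b)) \<inter> r = {}" unfolding separable_def by blast
  obtain i0 where i0: "i0 \<in> Field \<alpha>" using dim_nonempty by blast
  define \<kappa> :: "('c, 'i) idx \<Rightarrow> 'i" where
    "\<kappa> j = (case j of Base i \<Rightarrow> if i \<in> Field \<alpha> then i else i0 | Wit _ _ _ \<Rightarrow> i0)" for j
  have \<kappa>I: "\<kappa> j \<in> Field \<alpha>" for j using i0 by (simp add: \<kappa>_def split: idx.split)
  have \<kappa>: "zero.collapse \<kappa>" unfolding zero.collapse_def using \<kappa>I by (auto simp: \<kappa>_def)
  obtain t where t: "t \<in> carrier A0" "\<rho>0 t = {(k, u). (k, u) \<in> tuples (Field \<alpha>) U \<and> (k, u \<circ> \<kappa>) \<in> r}"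
    using zero.definable_collapse[OF r(1) \<kappa>] by blast
  have T: "(k, u \<circ> \<kappa>) \<in> tuples UNIV V" if "(k, u) \<in> tuples (Field \<alpha>) V" for k u and V :: "'k \<Rightarrow> 'u set"
    using that \<kappa>I by (simp add: mem_tuples)
  have base: "(u \<circ> \<kappa> \<circ> Base) i = u i" if "i \<in> Field \<alpha>" for u :: "'i \<Rightarrow> 'u" and i
    using that by (simp add: \<kappa>_def)
  have "\<rho>1 a \<subseteq> \<rho>1 (f t)"
  proof (rule subrelI)
    fix k u assume ku: "(k, u) \<in> \<rho>1 a"
    then have kuT: "(k, u) \<in> tuples (Field \<alpha>) U1" using one.hom_sub[OF a] by blast
    have "(k, u \<circ> \<kappa> \<circ> Base) \<in> \<rho>1 a" using one.hom_cong[OF a ku] base by metis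
    then have "(k, u \<circ> \<kappa>) \<in> r" using r(2) T[OF kuT] by (auto simp: mem_pull)
    then have "(k, u) \<in> \<rho>0 t" using t(2) kuT tuples_U by auto
    moreover have "(k, u) \<notin> \<rho>2 (g t)"
      using two.hom_sub[OF g_closed[OF t(1)]] tuples_disjoint[OF dim_nonempty kuT] by blast
    ultimately show "(k, u) \<in> \<rho>1 (f t)" by blast
  qed
  moreover have "\<rho>2 (g t) \<subseteq> \<rho>2 b"
  proof (rule subrelI)
    fix k u assume ku: "(k, u) \<in> \<rho>2 (g t)"
    then have kuT: "(k, u) \<in> tuples (Field \<alpha>) U2" using two.hom_sub[OF g_closed[OF t(1)]] by blast
    have "(k, u) \<in> \<rho>0 t" using ku by blast
    then have "(k, u \<circ> \<kappa>) \<in> r" using t(2) by simp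
    then have "(k, u \<circ> \<kappa> \<circ> Base) \<in> \<rho>2 b" using r(3) T[OF kuT] by (auto simp: mem_pull)
    then show "(k, u) \<in> \<rho>2 b" using two.hom_cong[OF b, of k "u \<circ> \<kappa> \<circ> Base" u] base by metis
  qed
  ultimately show False using no t(1) le_iff_subset a b f_closed g_closed by blast
qed

end

context amalgamation_problem
begin

text \<open>Since equality is definable, both ultrafilters identify the same indices.\<close>

lemma diagonal_definable:
  assumes ij: "i \<in> Field \<alpha>" "i' \<in> Field \<alpha>" "i \<noteq> i'"
  shows "{(k, s). (k, s) \<in> tuples UNIV U \<and> s j = s j'} \<in> zero.definable"
proof -
  let ?\<sigma> = "Base(i := j, i' := j')"
  have "{i'' \<in> Field \<alpha>. ?\<sigma> i'' \<noteq> Base i''} \<subseteq> {i, i'}" by auto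
  then have "finite {i'' \<in> Field \<alpha>. ?\<sigma> i'' \<noteq> Base i''}" by (rule finite_subset) simp
  from zero.definable_pull[OF zero.diag_closed[OF ij(1,2)] this]
  have "pull U ?\<sigma> (\<rho>0 (\<d>\<^bsub>A0\<^esub> i i')) \<in> zero.definable" .
  also have "pull U ?\<sigma> (\<rho>0 (\<d>\<^bsub>A0\<^esub> i i')) = {(k, s). (k, s) \<in> tuples UNIV U \<and> s j = s j'}"
    unfolding pull_def zero.hom_diag[OF ij(1,2)] using ij by (auto simp: mem_tuples)
  finally show ?thesis .
qed

text \<open>
  Joint consistency of the two algebras. The ultrafilters with common trace extend the Henkin axioms,
  with \<open>a\<close> added on one side and the complement of \<open>b\<close> on the other. Their agreement on the
  definable relations makes the models agree on equality and on \<open>A0\<close>.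
\<close>

lemma joint_index_models:
  assumes a: "a \<in> carrier A1" and b: "b \<in> carrier A2"
    and no: "\<not> (\<exists>t\<in>carrier A0. a \<sqsubseteq>\<^bsub>A1\<^esub> f t \<and> g t \<sqsubseteq>\<^bsub>A2\<^esub> b)"
  shows "\<exists>(E :: ('a1 + 'a2, 'i) idx \<Rightarrow> ('a1 + 'a2, 'i) idx \<Rightarrow> bool) M N.
    index_model \<alpha> A1 E M \<and> index_model \<alpha> A2 E N \<and>
    (\<forall>t\<in>carrier A0. M (f t) = N (g t)) \<and> Base \<in> M a \<and> Base \<notin> N b"
proof -
  let ?P = "pull U1 (Base :: 'i \<Rightarrow> ('a1 + 'a2, 'i) idx) (\<rho>1 a)"
  let ?Q = "tuples UNIV U2 - pull U2 (Base :: 'i \<Rightarrow> ('a1 + 'a2, 'i) idx) (\<rho>2 b)"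
  define T :: "bool \<Rightarrow> ('k \<times> (('a1 + 'a2, 'i) idx \<Rightarrow> 'u)) set" where
    "T left = tuples UNIV (if left then U1 else U2)" for left
  define \<Sigma> where "\<Sigma> left = insert (if left then ?P else ?Q) (henkin_at left ` requirements)" for left
  have T_simps: "T True = tuples UNIV U1" "T False = tuples UNIV U2" by (simp_all add: T_def)
  have PT: "?P \<subseteq> T True" and QT: "?Q \<subseteq> T False" by (auto simp: T_def pull_def)
  have Wit: "Wit c l i \<notin> range Base" for c l and i :: 'i by auto
  have P_cyl: "cylindrical U (Wit c l i) ?P" for c l i
    using PT unfolding T_simps by (intro cylindrical_U(1) cylindrical_pull Wit)
  have Q_cyl: "cylindrical U (Wit c l i) ?Q" for c l i
    using QT unfolding T_simps by (intro cylindrical_U(2) cylindrical_compl cylindrical_pull Wit)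
  have "\<exists>F. (\<forall>left. ultra (T left) (F left) \<and> \<Sigma> left \<subseteq> F left) \<and>
    (\<forall>r\<in>zero.definable. r \<inter> T True \<in> F True \<longleftrightarrow> r \<inter> T False \<in> F False)"
  proof (rule set_algebra.joint_ultrafilters[OF zero.set_algebra_definable])
    show "T left \<subseteq> tuples UNIV U" for left by (auto simp: T_def tuples_U)
    show "\<Sigma> left \<subseteq> Pow (T left)" for left
    proof
      fix X assume "X \<in> \<Sigma> left"
      then consider "X = (if left then ?P else ?Q)" | y where "X = henkin_at left y"
        unfolding \<Sigma>_def by blast
      then show "X \<in> Pow (T left)"
      proof cases
        case 1
        then show ?thesis using PT QT by (cases left) simp_all
      next
        case 2
        then show ?thesis using henkin_at_sub[of left] by (simp add: T_def)
      qed
    qed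
    fix \<Phi> assume \<Phi>: "\<And>left. finite (\<Phi> left) \<and> \<Phi> left \<subseteq> \<Sigma> left"
    have "\<exists>C. finite C \<and> C \<subseteq> requirements \<and> \<Phi> left - {if left then ?P else ?Q} = henkin_at left ` C" for left
    proof -
      have fin: "finite (\<Phi> left - {if left then ?P else ?Q})" using \<Phi>[of left] by simp
      have "\<Phi> left - {if left then ?P else ?Q} \<subseteq> henkin_at left ` requirements"
        using \<Phi>[of left] unfolding \<Sigma>_def by blast
      from finite_subset_image[OF fin this] show ?thesis by (elim exE conjE) (intro exI conjI)
    qed
    then have "\<forall>left. \<exists>C. finite C \<and> C \<subseteq> requirements \<and>
      \<Phi> left - {if left then ?P else ?Q} = henkin_at left ` C" by (rule allI)
    from choice[OF this] obtain C where C: "\<And>left. finite (C left) \<and> C left \<subseteq> requirements \<and>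
      \<Phi> left - {if left then ?P else ?Q} = henkin_at left ` C left" by (elim exE) blast
    define Q where "Q = C True \<union> C False"
    have Q: "finite Q" "Q \<subseteq> requirements" using C unfolding Q_def by (simp, blast)
    have "\<not> separable zero.definable (?P \<inter> \<Inter>(henkin_at True ` Q)) (?Q \<inter> \<Inter>(henkin_at False ` Q))"
      by (rule inseparable_axioms[OF inseparable_base[OF a b no] _ P_cyl _ Q_cyl Q])
        (use PT QT in \<open>simp_all add: T_simps\<close>)
    moreover have meets: "p \<inter> \<Inter>(henkin_at left ` Q) \<subseteq> T left \<inter> \<Inter>(\<Phi> left)"
      if "p \<subseteq> T left" "p = (if left then ?P else ?Q)" for left p
    proof -
      have "C left \<subseteq> Q" unfolding Q_def by (cases left) auto
      moreover have "\<Phi> left - {p} = henkin_at left ` C left" using C[of left] that(2) by simp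
      ultimately have "\<Phi> left - {p} \<subseteq> henkin_at left ` Q" by (simp add: image_mono)
      then show ?thesis using that(1) by blast
    qed
    ultimately show "\<not> separable zero.definable (T True \<inter> \<Inter>(\<Phi> True)) (T False \<inter> \<Inter>(\<Phi> False))"
      using separable_mono[OF _ meets[OF PT] meets[OF QT]] by auto
  qed
  then obtain F where F: "\<And>left. ultra (T left) (F left)" "\<And>left. \<Sigma> left \<subseteq> F left"
    and agree: "\<And>r. r \<in> zero.definable \<Longrightarrow> r \<inter> T True \<in> F True \<longleftrightarrow> r \<inter> T False \<in> F False"
    by blast
  have henkin1: "henkin U1 (cyl A1) \<rho>1 (Inl x) l i x \<in> F True" if "x \<in> carrier A1" "i \<in> Field \<alpha>" for x l i
  proof -
    have "henkin_at True (Inl x, l, i) \<in> \<Sigma> True" using that unfolding \<Sigma>_def by auto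
    then show ?thesis using F(2)[of True] by (auto simp: henkin_at_def)
  qed
  have henkin2: "henkin U2 (cyl A2) \<rho>2 (Inr x) l i x \<in> F False" if "x \<in> carrier A2" "i \<in> Field \<alpha>" for x l i
  proof -
    have "henkin_at False (Inr x, l, i) \<in> \<Sigma> False" using that unfolding \<Sigma>_def by auto
    then show ?thesis using F(2)[of False] by (auto simp: henkin_at_def)
  qed
  define E where "E j j' \<longleftrightarrow> {(k, s). (k, s) \<in> tuples UNIV U1 \<and> s j = s j'} \<in> F True" for j j'
  define M where "M x = {\<tau> \<in> index_seqs \<alpha>. pull U1 \<tau> (\<rho>1 x) \<in> F True}" for x
  define N where "N x = {\<tau> \<in> index_seqs \<alpha>. pull U2 \<tau> (\<rho>2 x) \<in> F False}" for x
  \<comment> \<open>every equation between indices is a substitution instance of \<open>\<d> i i'\<close> for distinct \<open>i\<close> and \<open>i'\<close>\<close>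
  obtain i where i: "i \<in> Field \<alpha>" using dim_nonempty by blast
  have "infinite (Field \<alpha> - {i})" using infinite_dim by simp
  from infinite_imp_nonempty[OF this] obtain i' where i': "i' \<in> Field \<alpha>" "i \<noteq> i'" by blast
  have E2: "{(k, s). (k, s) \<in> tuples UNIV U2 \<and> s j = s j'} \<in> F False \<longleftrightarrow> E j j'" for j j'
  proof -
    let ?D = "{(k, s). (k, s) \<in> tuples UNIV U \<and> s j = s j'}"
    have "?D \<inter> T True = {(k, s). (k, s) \<in> tuples UNIV U1 \<and> s j = s j'}"
      "?D \<inter> T False = {(k, s). (k, s) \<in> tuples UNIV U2 \<and> s j = s j'}"
      unfolding T_simps tuples_U by auto
    then show ?thesis using agree[OF diagonal_definable[OF i i', of j j']] unfolding E_def by simp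
  qed
  have "index_model \<alpha> A1 E M"
    using one.index_model_of_ultra[where F = "F True" and wit = Inl] F(1)[of True] henkin1
    unfolding E_def M_def T_simps by blast
  moreover have "index_model \<alpha> A2 E N"
    using two.index_model_of_ultra[where F = "F False" and wit = Inr] F(1)[of False] henkin2
    unfolding N_def T_simps E2 by blast
  moreover have "M (f t) = N (g t)" if t: "t \<in> carrier A0" for t
  proof -
    have "pull U1 \<tau> (\<rho>1 (f t)) \<in> F True \<longleftrightarrow> pull U2 \<tau> (\<rho>2 (g t)) \<in> F False" if "\<tau> \<in> index_seqs \<alpha>" for \<tau>
      using agree[OF zero.definable_pull[OF t, of \<tau>]] that pull_\<rho>0[OF t, of \<tau>]
      unfolding index_seqs_def T_simps by simp
    then show ?thesis unfolding M_def N_def by blast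
  qed
  moreover have "Base \<in> M a"
    using F(2)[of True] unfolding M_def \<Sigma>_def index_seqs_def by auto
  moreover have "Base \<notin> N b"
  proof -
    have "?Q \<in> F False" using F(2)[of False] unfolding \<Sigma>_def by auto
    moreover have "pull U2 Base (\<rho>2 b) \<subseteq> tuples UNIV U2" by (auto simp: pull_def)
    ultimately show ?thesis
      using ultra_compl[OF F(1)[of False]] unfolding T_simps N_def by blast
  qed
  ultimately show ?thesis by blast
qed

end

section \<open>Algebras of saturated sets\<close>

text \<open>
  If \<open>E p\<close> is an equivalence relation for every \<open>p\<close>, this is the product over \<open>p\<close> of the set
  algebras with base modulo \<open>E p\<close>. Quotients are avoided by working with saturated sets, and \<open>V\<close> may
  be any union of weak spaces.
\<close>

definition saturated_algebra ::
    "('p \<times> ('j \<Rightarrow> 'x)) set \<Rightarrow> ('p \<Rightarrow> 'x \<Rightarrow> 'x \<Rightarrow> bool) \<Rightarrow> (('p \<times> ('j \<Rightarrow> 'x)) set, 'j) cyl_alg" where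
  "saturated_algebra V E =
     \<lparr>carrier = {X. X \<subseteq> V \<and> (\<forall>p s s'. (p, s) \<in> X \<longrightarrow> (p, s') \<in> V \<longrightarrow> (\<forall>j. E p (s j) (s' j)) \<longrightarrow> (p, s') \<in> X)},
      add = (\<union>), mult = (\<inter>), neg = (\<lambda>X. V - X), zero = {}, one = V,
      cyl = (\<lambda>i X. {(p, s). (p, s) \<in> V \<and> (\<exists>x. (p, s(i := x)) \<in> X)}),
      diag = (\<lambda>i j. {(p, s). (p, s) \<in> V \<and> E p (s i) (s j)})\<rparr>"

lemma cylindric_saturated_algebra:
  assumes V: "\<And>p s i x. (p, s) \<in> V \<Longrightarrow> (p, s(i := x)) \<in> V"
    and E: "\<And>p s. (p, s) \<in> V \<Longrightarrow> equivp (E p)"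
  shows "cylindric_algebra \<beta> (saturated_algebra V E)"
proof -
  have refl: "E p x x" if "(p, s) \<in> V" for p s x using equivp_reflp[OF E[OF that]] .
  have sym: "E p x y \<Longrightarrow> E p y x" if "(p, s) \<in> V" for p s x y using equivp_symp[OF E[OF that]] .
  have trans: "E p x y \<Longrightarrow> E p y z \<Longrightarrow> E p x z" if "(p, s) \<in> V" for p s x y z
    using equivp_transp[OF E[OF that]] .
  define sat where "sat X \<longleftrightarrow> X \<subseteq> V \<and>
    (\<forall>p s s'. (p, s) \<in> X \<longrightarrow> (p, s') \<in> V \<longrightarrow> (\<forall>j. E p (s j) (s' j)) \<longrightarrow> (p, s') \<in> X)" for X
  have satD: "(p, s') \<in> X" if "sat X" "(p, s) \<in> X" "(p, s') \<in> V" "\<And>j. E p (s j) (s' j)" for X p s s'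
    using that unfolding sat_def by blast
  have satV: "(p, s) \<in> V" if "sat X" "(p, s) \<in> X" for X p s using that unfolding sat_def by blast
  have carr: "X \<in> carrier (saturated_algebra V E) \<longleftrightarrow> sat X" for X
    by (simp add: saturated_algebra_def sat_def)
  have ops: "add (saturated_algebra V E) = (\<union>)" "mult (saturated_algebra V E) = (\<inter>)"
    "neg (saturated_algebra V E) = (\<lambda>X. V - X)" "zero (saturated_algebra V E) = {}"
    "one (saturated_algebra V E) = V"
    "cyl (saturated_algebra V E) = (\<lambda>i X. {(p, s). (p, s) \<in> V \<and> (\<exists>x. (p, s(i := x)) \<in> X)})"
    "diag (saturated_algebra V E) = (\<lambda>i j. {(p, s). (p, s) \<in> V \<and> E p (s i) (s j)})"
    by (simp_all add: saturated_algebra_def)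
  note simps = carr ops le_def
  show ?thesis
  proof (unfold_locales, goal_cases)
    case (1 x y) then show ?case unfolding simps sat_def by blast
  next
    case (2 x y) then show ?case unfolding simps sat_def by blast
  next
    case (3 x)
    then have x: "sat x" by (simp add: simps)
    have "sat (V - x)"
      unfolding sat_def
    proof (intro conjI allI impI Diff_subset)
      fix p s s' assume *: "(p, s) \<in> V - x" "(p, s') \<in> V" "\<forall>j. E p (s j) (s' j)"
      then show "(p, s') \<in> V - x" using satD[OF x, of p s' s] sym by blast
    qed
    then show ?case by (simp add: simps)
  next
    case 4 then show ?case unfolding simps sat_def by blast
  next
    case 5 then show ?case unfolding simps sat_def by blast
  next
    case (6 i X)
    then have X: "sat X" by (simp add: simps)
    have "sat {(p, s). (p, s) \<in> V \<and> (\<exists>x. (p, s(i := x)) \<in> X)}"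
      unfolding sat_def
    proof (intro conjI allI impI)
      fix p s s' assume *: "(p, s) \<in> {(p, s). (p, s) \<in> V \<and> (\<exists>x. (p, s(i := x)) \<in> X)}"
        "(p, s') \<in> V" "\<forall>j. E p (s j) (s' j)"
      then obtain x where "(p, s(i := x)) \<in> X" by blast
      moreover have "(p, s'(i := x)) \<in> V" by (rule V[OF *(2)])
      moreover have "E p ((s(i := x)) j) ((s'(i := x)) j)" for j using *(3) refl[OF *(2)] by simp
      ultimately have "(p, s'(i := x)) \<in> X" by (rule satD[OF X])
      with *(2) show "(p, s') \<in> {(p, s). (p, s) \<in> V \<and> (\<exists>x. (p, s(i := x)) \<in> X)}"
        by auto
    qed auto
    then show ?case by (simp add: simps)
  next
    case (7 i j)
    have "sat {(p, s). (p, s) \<in> V \<and> E p (s i) (s j)}"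
      unfolding sat_def
    proof (intro conjI allI impI)
      fix p s s' assume *: "(p, s) \<in> {(p, s). (p, s) \<in> V \<and> E p (s i) (s j)}" "(p, s') \<in> V"
        "\<forall>j. E p (s j) (s' j)"
      then have "E p (s i) (s j)" "E p (s' i) (s i)" "E p (s j) (s' j)" using sym[OF *(2)] by auto
      then have "E p (s' i) (s' j)" using trans[OF *(2)] by blast
      then show "(p, s') \<in> {(p, s). (p, s) \<in> V \<and> E p (s i) (s j)}" using *(2) by simp
    qed auto
    then show ?case by (simp add: simps)
  next
    case (17 x) then show ?case by (auto simp: simps dest: satV)
  next
    case (19 i X)
    then have X: "sat X" by (simp add: simps)
    have "(p, s) \<in> V \<and> (\<exists>x. (p, s(i := x)) \<in> X)" if "(p, s) \<in> X" for p s
      using satV[OF X that] that by (metis fun_upd_triv)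
    then show ?case by (auto simp: simps)
  next
    case (20 i X Y) then show ?case by (auto simp: simps V)
  next
    case (21 i j X)
    show ?case
    proof (cases "i = j")
      case False
      then show ?thesis using V by (auto simp: simps) (metis fun_upd_twist)+
    qed simp
  next
    case (22 i) then show ?case using refl by (auto simp: simps)
  next
    case (23 i j k)
    have "E p (s i) (s j) \<longleftrightarrow> (\<exists>x. E p (s i) x \<and> E p x (s j))" if "(p, s) \<in> V" for p s
      using refl[OF that] trans[OF that] by blast
    then show ?case using 23 V by (auto simp: simps)
  next
    case (24 i j X)
    then have X: "sat X" by (simp add: simps)
    have "(p, s(i := y)) \<in> X" if "(p, s) \<in> V" "(p, s(i := x)) \<in> X" "E p x (s j)" "E p y (s j)" for p s x y
    proof (rule satD[OF X that(2)])
      have "E p x y" by (rule trans[OF that(1) that(3) sym[OF that(1) that(4)]])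
      then show "E p ((s(i := x)) l) ((s(i := y)) l)" for l using refl[OF that(1)] by simp
    qed (use V that in blast)
    then show ?case using 24 by (auto simp: simps)
  qed (auto simp: simps dest: satV)
qed

section \<open>Coding a generated subalgebra by words\<close>

definition closed_under :: "'j rel \<Rightarrow> ('x, 'j) cyl_alg \<Rightarrow> 'x set \<Rightarrow> bool" where
  "closed_under \<beta> B S \<longleftrightarrow> S \<subseteq> carrier B \<and> cyl_type_algebra \<beta> (B\<lparr>carrier := S\<rparr>)"

inductive_set generated :: "'j rel \<Rightarrow> ('x, 'j) cyl_alg \<Rightarrow> 'x set \<Rightarrow> 'x set"
  for \<beta> :: "'j rel" and B :: "('x, 'j) cyl_alg" and G :: "'x set" where
  gen: "x \<in> G \<Longrightarrow> x \<in> generated \<beta> B G"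
| gen_add: "x \<in> generated \<beta> B G \<Longrightarrow> y \<in> generated \<beta> B G \<Longrightarrow> x \<oplus>\<^bsub>B\<^esub> y \<in> generated \<beta> B G"
| gen_mult: "x \<in> generated \<beta> B G \<Longrightarrow> y \<in> generated \<beta> B G \<Longrightarrow> x \<otimes>\<^bsub>B\<^esub> y \<in> generated \<beta> B G"
| gen_neg: "x \<in> generated \<beta> B G \<Longrightarrow> \<ominus>\<^bsub>B\<^esub> x \<in> generated \<beta> B G"
| gen_zero: "\<zero>\<^bsub>B\<^esub> \<in> generated \<beta> B G"
| gen_one: "\<one>\<^bsub>B\<^esub> \<in> generated \<beta> B G"
| gen_cyl: "i \<in> Field \<beta> \<Longrightarrow> x \<in> generated \<beta> B G \<Longrightarrow> \<c>\<^bsub>B\<^esub> i x \<in> generated \<beta> B G"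
| gen_diag: "i \<in> Field \<beta> \<Longrightarrow> j \<in> Field \<beta> \<Longrightarrow> \<d>\<^bsub>B\<^esub> i j \<in> generated \<beta> B G"

lemma closed_under_generated:
  assumes B: "cyl_type_algebra \<beta> B" and G: "G \<subseteq> carrier B"
  shows "closed_under \<beta> B (generated \<beta> B G)"
proof -
  interpret cyl_type_algebra \<beta> B by (fact B)
  have "x \<in> carrier B" if "x \<in> generated \<beta> B G" for x
    using that G
    by induction (auto intro: add_closed mult_closed neg_closed zero_closed one_closed cyl_closed diag_closed)
  moreover have "cyl_type_algebra \<beta> (B\<lparr>carrier := generated \<beta> B G\<rparr>)"
    by unfold_locales (auto intro: generated.intros)
  ultimately show ?thesis unfolding closed_under_def by blast
qed

text \<open>
  Terms are coded as words in reverse Polish notation for a machine with a stack of indices and a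
  stack of values.
\<close>

fun machine_step ::
    "('a \<Rightarrow> 'x) \<Rightarrow> ('b \<Rightarrow> 'x) \<Rightarrow> ('x, 'i + nat) cyl_alg \<Rightarrow> 'a + 'b + 'i + nat \<Rightarrow>
      ('i + nat) list \<times> 'x list \<Rightarrow> ('i + nat) list \<times> 'x list" where
  "machine_step m n B (Inl a) (is, xs) = (is, m a # xs)"
| "machine_step m n B (Inr (Inl b)) (is, xs) = (is, n b # xs)"
| "machine_step m n B (Inr (Inr (Inl i))) (is, xs) = (Inl i # is, xs)"
| "machine_step m n B (Inr (Inr (Inr k))) (is, xs) =
    (if k = 0 then (is, \<zero>\<^bsub>B\<^esub> # xs)
     else if k = 1 then (is, \<one>\<^bsub>B\<^esub> # xs)
     else if k = 2 then (is, \<ominus>\<^bsub>B\<^esub> (hd xs) # tl xs)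
     else if k = 3 then (is, (hd xs \<oplus>\<^bsub>B\<^esub> hd (tl xs)) # tl (tl xs))
     else if k = 4 then (is, (hd xs \<otimes>\<^bsub>B\<^esub> hd (tl xs)) # tl (tl xs))
     else if k = 5 then (tl is, \<c>\<^bsub>B\<^esub> (hd is) (hd xs) # tl xs)
     else if k = 6 then (tl (tl is), \<d>\<^bsub>B\<^esub> (hd is) (hd (tl is)) # xs)
     else (Inr (k - 7) # is, xs))"

fun index_symbol :: "'i + nat \<Rightarrow> 'a + 'b + 'i + nat" where
  "index_symbol (Inl i) = Inr (Inr (Inl i))"
| "index_symbol (Inr k) = Inr (Inr (Inr (k + 7)))"

lemma machine_step_index: "machine_step m n B (index_symbol i) (is, xs) = (i # is, xs)"
  by (cases i) auto

lemma generated_word: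
  fixes m :: "'a \<Rightarrow> 'x" and n :: "'b \<Rightarrow> 'x"
  assumes G: "G \<subseteq> range m \<union> range n" and x: "x \<in> generated \<beta> B G"
  shows "\<exists>w. \<forall>is xs. fold (machine_step m n B) w (is, xs) = (is, x # xs)"
  using x
proof induction
  case (gen x)
  with G consider a where "x = m a" | b where "x = n b" by blast
  then show ?case
  proof cases
    case 1 then show ?thesis by (intro exI[of _ "[Inl a]"]) simp
  next
    case 2 then show ?thesis by (intro exI[of _ "[Inr (Inl b)]"]) simp
  qed
next
  case (gen_add x y)
  then obtain v w where "\<forall>is xs. fold (machine_step m n B) v (is, xs) = (is, x # xs)"
    "\<forall>is xs. fold (machine_step m n B) w (is, xs) = (is, y # xs)" by blast
  then show ?case by (intro exI[of _ "w @ v @ [Inr (Inr (Inr 3))]"]) simp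
next
  case (gen_mult x y)
  then obtain v w where "\<forall>is xs. fold (machine_step m n B) v (is, xs) = (is, x # xs)"
    "\<forall>is xs. fold (machine_step m n B) w (is, xs) = (is, y # xs)" by blast
  then show ?case by (intro exI[of _ "w @ v @ [Inr (Inr (Inr 4))]"]) simp
next
  case (gen_neg x)
  then obtain v where "\<forall>is xs. fold (machine_step m n B) v (is, xs) = (is, x # xs)" by blast
  then show ?case by (intro exI[of _ "v @ [Inr (Inr (Inr 2))]"]) simp
next
  case gen_zero
  show ?case by (intro exI[of _ "[Inr (Inr (Inr 0))]"]) simp
next
  case gen_one
  show ?case by (intro exI[of _ "[Inr (Inr (Inr 1))]"]) simp
next
  case (gen_cyl i x)
  then obtain v where "\<forall>is xs. fold (machine_step m n B) v (is, xs) = (is, x # xs)" by blast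
  then show ?case
    by (intro exI[of _ "index_symbol i # v @ [Inr (Inr (Inr 5))]"]) (simp add: machine_step_index)
next
  case (gen_diag i j)
  show ?case
    by (intro exI[of _ "[index_symbol j, index_symbol i, Inr (Inr (Inr 6))]"]) (simp add: machine_step_index)
qed

text \<open>Decoding a word is total; a code of \<open>x\<close> is any word that decodes to \<open>x\<close>.\<close>

lemma generated_coding:
  fixes m :: "'a \<Rightarrow> 'x" and n :: "'b \<Rightarrow> 'x" and B :: "('x, 'i + nat) cyl_alg"
  assumes G: "G \<subseteq> range m \<union> range n"
  shows "\<exists>(d :: ('a, 'b, 'i) amalgam \<Rightarrow> 'x) e. \<forall>x\<in>generated \<beta> B G. d (e x) = x"
proof -
  define d where "d w = hd (snd (fold (machine_step m n B) w ([], [])))" for w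
  have "\<exists>w. d w = x" if x: "x \<in> generated \<beta> B G" for x
  proof -
    obtain w where "\<forall>is xs. fold (machine_step m n B) w (is, xs) = (is, x # xs)"
      using generated_word[OF G x] by blast
    then show ?thesis unfolding d_def by (intro exI[of _ w]) simp
  qed
  then show ?thesis by metis
qed

text \<open>The copy of the subalgebra \<open>S\<close> of \<open>B\<close> along the injection \<open>e\<close> with left inverse \<open>d\<close>.\<close>

definition recode :: "('x \<Rightarrow> 'y) \<Rightarrow> ('y \<Rightarrow> 'x) \<Rightarrow> 'x set \<Rightarrow> ('x, 'j) cyl_alg \<Rightarrow> ('y, 'j) cyl_alg" where
  "recode e d S B =
     \<lparr>carrier = e ` S,
      add = (\<lambda>x y. e (d x \<oplus>\<^bsub>B\<^esub> d y)), mult = (\<lambda>x y. e (d x \<otimes>\<^bsub>B\<^esub> d y)), neg = (\<lambda>x. e (\<ominus>\<^bsub>B\<^esub> (d x))),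
      zero = e \<zero>\<^bsub>B\<^esub>, one = e \<one>\<^bsub>B\<^esub>,
      cyl = (\<lambda>i x. e (\<c>\<^bsub>B\<^esub> i (d x))), diag = (\<lambda>i j. e (\<d>\<^bsub>B\<^esub> i j))\<rparr>"

lemma cylindric_recode:
  assumes B: "cylindric_algebra \<beta> B" and S: "closed_under \<beta> B S" and d: "\<And>x. x \<in> S \<Longrightarrow> d (e x) = x"
  shows "cylindric_algebra \<beta> (recode e d S B)"
proof -
  interpret cylindric_algebra \<beta> B by (fact B)
  interpret S: cyl_type_algebra \<beta> "B\<lparr>carrier := S\<rparr>" using S unfolding closed_under_def by blast
  have sub: "x \<in> S \<Longrightarrow> x \<in> carrier B" for x using S unfolding closed_under_def by blast
  note clo = S.add_closed[simplified] S.mult_closed[simplified] S.neg_closed[simplified]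
    S.zero_closed[simplified] S.one_closed[simplified] S.cyl_closed[simplified] S.diag_closed[simplified]
  show ?thesis
  proof (unfold_locales, goal_cases)
    case (8 x y z) then show ?case using add_assoc by (auto simp: recode_def d clo sub)
  next
    case (9 x y z) then show ?case using mult_assoc by (auto simp: recode_def d clo sub)
  next
    case (10 x y) then show ?case using add_commute by (auto simp: recode_def d clo sub)
  next
    case (11 x y) then show ?case using mult_commute by (auto simp: recode_def d clo sub)
  next
    case (12 x y z) then show ?case using mult_add_distrib by (auto simp: recode_def d clo sub)
  next
    case (13 x y z) then show ?case using add_mult_distrib by (auto simp: recode_def d clo sub)
  next
    case (19 i x) then show ?case using cyl_extensive unfolding le_def by (auto simp: recode_def d clo sub)
  next
    case (20 i x y) then show ?case using cyl_mult by (auto simp: recode_def d clo sub)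
  next
    case (21 i j x) then show ?case using cyl_commute by (auto simp: recode_def d clo sub)
  next
    case (23 i j k) then show ?case using diag_cyl[of i j k] by (auto simp: recode_def d clo)
  next
    case (24 i j x) then show ?case using cyl_diag_neg by (auto simp: recode_def d clo sub)
  qed (auto simp: recode_def d clo sub add_zero mult_one add_neg mult_neg cyl_zero diag_refl)
qed

lemma homomorphism_recode:
  fixes \<gamma> :: "'l rel"
  assumes h: "homomorphism \<alpha> A (neat_reduct \<alpha> \<gamma> B) h"
    and S: "closed_under (ord_sum \<alpha> \<gamma>) B S" and hS: "h ` carrier A \<subseteq> S"
    and d: "\<And>x. x \<in> S \<Longrightarrow> d (e x) = x"
  shows "homomorphism \<alpha> A (neat_reduct \<alpha> \<gamma> (recode e d S B)) (e \<circ> h)"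
proof -
  have dh: "d (e (h x)) = h x" if "x \<in> carrier A" for x using d hS that by blast
  have cl: "\<forall>x\<in>carrier A. h x \<in> S" using hS by blast
  show ?thesis
    using h cl unfolding homomorphism_def neat_reduct_def recode_def
    by (auto simp: dh Pi_iff)
qed

section \<open>The super amalgam\<close>

definition model_set :: "('p \<times> ('i + 'l \<Rightarrow> 'x)) set \<Rightarrow> ('p \<Rightarrow> 'a \<Rightarrow> ('i \<Rightarrow> 'x) set) \<Rightarrow> 'a \<Rightarrow>
    ('p \<times> ('i + 'l \<Rightarrow> 'x)) set" where
  "model_set V M a = {(p, s). (p, s) \<in> V \<and> s \<circ> Inl \<in> M p a}"

text \<open>
  The model sets do not mention the coordinates \<open>Inr k\<close>, so they are fixed by the additional
  cylindrifications and lie in the neat reduct.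
\<close>

lemma homomorphism_model_set:
  fixes P :: "'p set" and \<gamma> :: "'l rel" and \<alpha> :: "'i rel" and A :: "('a, 'i) cyl_alg"
    and M :: "'p \<Rightarrow> 'a \<Rightarrow> ('i \<Rightarrow> ('c, 'i) idx) set"
  assumes M: "\<And>p. p \<in> P \<Longrightarrow> index_model \<alpha> A (E p) (M p)"
    and V: "V = {(p, s). p \<in> P \<and> s \<circ> Inl \<in> index_seqs \<alpha>}"
  shows "homomorphism \<alpha> A (neat_reduct \<alpha> \<gamma> (saturated_algebra V E)) (model_set V M)"
proof -
  have inl: "s(Inl i := x) \<circ> Inl = (s \<circ> Inl)(i := x)" "s(Inr k := x) \<circ> Inl = s \<circ> Inl"
    for s :: "'i + 'l \<Rightarrow> ('c, 'i) idx" and i k x by (auto simp: fun_eq_iff)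
  have VP: "p \<in> P" if "(p, s) \<in> V" for p s using that V by blast
  have Vs: "s \<circ> Inl \<in> index_seqs \<alpha>" if "(p, s) \<in> V" for p s using that V by blast
  have Vupd: "(p, s(i := x)) \<in> V" if "(p, s) \<in> V" for p s i x
    using that V by (cases i) (auto simp: inl index_seqs_upd)
  show ?thesis
    unfolding homomorphism_def
  proof (intro conjI ballI funcsetI, goal_cases)
    case (1 a)
    have "(p, s') \<in> model_set V M a" if "(p, s) \<in> model_set V M a" "(p, s') \<in> V" "\<forall>j. E p (s j) (s' j)" for p s s'
    proof -
      have p: "p \<in> P" "s \<circ> Inl \<in> M p a" using that VP by (auto simp: model_set_def)
      have "s' \<circ> Inl \<in> M p a"
        using index_model.model_sat[OF M[OF p(1)] 1 p(2) Vs[OF that(2)]] that(3) by simp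
      then show ?thesis using that(2) by (simp add: model_set_def)
    qed
    moreover have "(p, s) \<in> model_set V M a \<longleftrightarrow> (p, s) \<in> V \<and> (\<exists>x. (p, s(Inr k := x)) \<in> model_set V M a)" for p s k
      using Vupd by (auto simp: model_set_def inl)
    moreover have "model_set V M a \<subseteq> V" by (auto simp: model_set_def)
    ultimately show ?case
      unfolding neat_reduct_def saturated_algebra_def by auto
  next
    case (2 a b)
    then show ?case
      using VP index_model.model_add[OF M] by (auto simp: model_set_def neat_reduct_def saturated_algebra_def)
  next
    case (3 a b)
    then show ?case
      using VP index_model.model_mult[OF M] by (auto simp: model_set_def neat_reduct_def saturated_algebra_def)
  next
    case (4 a)
    then show ?case
      using VP Vs index_model.model_neg[OF M] by (auto simp: model_set_def neat_reduct_def saturated_algebra_def)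
  next
    case 5
    then show ?case
      using VP index_model.model_zero[OF M] by (auto simp: model_set_def neat_reduct_def saturated_algebra_def)
  next
    case 6
    then show ?case
      using VP Vs index_model.model_one[OF M] by (auto simp: model_set_def neat_reduct_def saturated_algebra_def)
  next
    case (7 i a)
    then show ?case
      using VP Vs Vupd index_model.model_cyl[OF M]
      by (auto simp: model_set_def neat_reduct_def saturated_algebra_def inl)
  next
    case (8 i j)
    then show ?case
      using VP Vs index_model.model_diag[OF M]
      by (auto simp: model_set_def neat_reduct_def saturated_algebra_def)
  qed
qed

lemma (in amalgamation_problem) super_amalgam_exists:
  "\<exists>(D :: (('a1, 'a2, 'i) amalgam, 'i) cyl_alg) m n.
     D \<in> Nr_CA \<alpha> natLeq \<and> monomorphism \<alpha> A1 D m \<and> monomorphism \<alpha> A2 D n \<and>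
     (\<forall>x\<in>carrier A0. (m \<circ> f) x = (n \<circ> g) x) \<and>
     (\<forall>a\<in>carrier A1. \<forall>b\<in>carrier A2.
        (m a \<sqsubseteq>\<^bsub>D\<^esub> n b \<longrightarrow> (\<exists>t\<in>carrier A0. a \<sqsubseteq>\<^bsub>A1\<^esub> f t \<and> g t \<sqsubseteq>\<^bsub>A2\<^esub> b)) \<and>
        (n b \<sqsubseteq>\<^bsub>D\<^esub> m a \<longrightarrow> (\<exists>t\<in>carrier A0. b \<sqsubseteq>\<^bsub>A2\<^esub> g t \<and> f t \<sqsubseteq>\<^bsub>A1\<^esub> a)))"
proof -
  \<comment> \<open>one factor of the product for every pair that must be told apart\<close>
  define P where "P = {(a, b). a \<in> carrier A1 \<and> b \<in> carrier A2 \<and>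
    \<not> (\<exists>t\<in>carrier A0. a \<sqsubseteq>\<^bsub>A1\<^esub> f t \<and> g t \<sqsubseteq>\<^bsub>A2\<^esub> b)}"
  have "\<exists>h :: (('a1 + 'a2, 'i) idx \<Rightarrow> ('a1 + 'a2, 'i) idx \<Rightarrow> bool) \<times> _ \<times> _. p \<in> P \<longrightarrow>
    index_model \<alpha> A1 (fst h) (fst (snd h)) \<and> index_model \<alpha> A2 (fst h) (snd (snd h)) \<and>
    (\<forall>t\<in>carrier A0. fst (snd h) (f t) = snd (snd h) (g t)) \<and>
    Base \<in> fst (snd h) (fst p) \<and> Base \<notin> snd (snd h) (snd p)" for p
  proof (cases "p \<in> P")
    case True
    then have "fst p \<in> carrier A1" "snd p \<in> carrier A2"
      "\<not> (\<exists>t\<in>carrier A0. fst p \<sqsubseteq>\<^bsub>A1\<^esub> f t \<and> g t \<sqsubseteq>\<^bsub>A2\<^esub> snd p)" by (auto simp: P_def)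
    from joint_index_models[OF this] obtain E M N where
      "index_model \<alpha> A1 E M \<and> index_model \<alpha> A2 E N \<and> (\<forall>t\<in>carrier A0. M (f t) = N (g t)) \<and>
       (Base :: 'i \<Rightarrow> ('a1 + 'a2, 'i) idx) \<in> M (fst p) \<and> Base \<notin> N (snd p)" by (elim exE)
    then show ?thesis by (intro exI[of _ "(E, M, N)"]) simp
  qed simp
  then obtain h :: "'a1 \<times> 'a2 \<Rightarrow> (('a1 + 'a2, 'i) idx \<Rightarrow> ('a1 + 'a2, 'i) idx \<Rightarrow> bool) \<times> _ \<times> _" where
    h: "\<And>p. p \<in> P \<Longrightarrow> index_model \<alpha> A1 (fst (h p)) (fst (snd (h p))) \<and>
      index_model \<alpha> A2 (fst (h p)) (snd (snd (h p))) \<and>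
      (\<forall>t\<in>carrier A0. fst (snd (h p)) (f t) = snd (snd (h p)) (g t)) \<and>
      Base \<in> fst (snd (h p)) (fst p) \<and> Base \<notin> snd (snd (h p)) (snd p)" by metis
  define E M N where "E p = fst (h p)" and "M p = fst (snd (h p))" and "N p = snd (snd (h p))" for p
  have M: "index_model \<alpha> A1 (E p) (M p)" and N: "index_model \<alpha> A2 (E p) (N p)"
    and agree: "t \<in> carrier A0 \<Longrightarrow> M p (f t) = N p (g t)"
    and apart: "Base \<in> M p (fst p)" "Base \<notin> N p (snd p)" if "p \<in> P" for p t
    using h[OF that] by (simp_all add: E_def M_def N_def)
  define V :: "(('a1 \<times> 'a2) \<times> ('i + nat \<Rightarrow> ('a1 + 'a2, 'i) idx)) set"
    where "V = {(p, s). p \<in> P \<and> s \<circ> Inl \<in> index_seqs \<alpha>}"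
  have Vupd: "(p, s(i := x)) \<in> V" if "(p, s) \<in> V" for p s i x
  proof (cases i)
    case (Inl i')
    have "s(i := x) \<circ> Inl = (s \<circ> Inl)(i' := x)" by (auto simp: fun_eq_iff Inl)
    then show ?thesis using that by (simp add: V_def index_seqs_upd)
  next
    case (Inr k)
    have "s(i := x) \<circ> Inl = s \<circ> Inl" by (auto simp: fun_eq_iff Inr)
    then show ?thesis using that by (simp add: V_def)
  qed
  define B where "B = saturated_algebra V E"
  define m0 where "m0 = model_set V M"
  define n0 where "n0 = model_set V N"
  have equiv: "equivp (E p)" if "(p, s) \<in> V" for p s
    using index_model.E[OF M] that unfolding V_def by blast
  have B: "cylindric_algebra (ord_sum \<alpha> natLeq) B"
    unfolding B_def using Vupd equiv by (rule cylindric_saturated_algebra)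
  have m0: "homomorphism \<alpha> A1 (neat_reduct \<alpha> natLeq B) m0"
    unfolding B_def m0_def by (rule homomorphism_model_set[OF M V_def])
  have n0: "homomorphism \<alpha> A2 (neat_reduct \<alpha> natLeq B) n0"
    unfolding B_def n0_def by (rule homomorphism_model_set[OF N V_def])
  define G where "G = m0 ` carrier A1 \<union> n0 ` carrier A2"
  define S where "S = generated (ord_sum \<alpha> natLeq) B G"
  have "G \<subseteq> carrier B"
    using m0 n0 unfolding G_def homomorphism_def neat_reduct_def by auto
  then have S: "closed_under (ord_sum \<alpha> natLeq) B S"
    unfolding S_def using B by (intro closed_under_generated) (simp add: cylindric_algebra_def)
  have m0S: "m0 ` carrier A1 \<subseteq> S" and n0S: "n0 ` carrier A2 \<subseteq> S"
    unfolding S_def G_def by (auto intro: generated.gen)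
  have "G \<subseteq> range m0 \<union> range n0" unfolding G_def by blast
  from generated_coding[OF this, of "ord_sum \<alpha> natLeq" B]
  obtain d :: "('a1, 'a2, 'i) amalgam \<Rightarrow> _" and e where d: "\<And>x. x \<in> S \<Longrightarrow> d (e x) = x"
    unfolding S_def by (elim exE) blast
  define D where "D = neat_reduct \<alpha> natLeq (recode e d S B)"
  define m n where "m = e \<circ> m0" and "n = e \<circ> n0"
  have D: "D \<in> Nr_CA \<alpha> natLeq"
    unfolding Nr_CA_def CA_def D_def using cylindric_recode[where e = e and d = d, OF B S d] by blast
  have hom_m: "homomorphism \<alpha> A1 D m" and hom_n: "homomorphism \<alpha> A2 D n"
    unfolding m_def n_def D_def
    using homomorphism_recode[where e = e and d = d, OF m0 S m0S d]
      homomorphism_recode[where e = e and d = d, OF n0 S n0S d] by blast+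
  have le_D: "X \<subseteq> Y" if "X \<in> S" "Y \<in> S" "e X \<sqsubseteq>\<^bsub>D\<^esub> e Y" for X Y
  proof -
    have "X \<oplus>\<^bsub>B\<^esub> Y \<in> S" using that unfolding S_def by (intro generated.gen_add)
    moreover have "X \<oplus>\<^bsub>B\<^esub> Y = X \<union> Y" by (simp add: B_def saturated_algebra_def)
    moreover have "e (X \<oplus>\<^bsub>B\<^esub> Y) = e Y"
      using that d by (simp add: le_def D_def neat_reduct_def recode_def)
    ultimately have "X \<union> Y = Y" using d that(2) by metis
    then show ?thesis by blast
  qed
  have inter1: "\<exists>t\<in>carrier A0. a \<sqsubseteq>\<^bsub>A1\<^esub> f t \<and> g t \<sqsubseteq>\<^bsub>A2\<^esub> b"
    if ab: "a \<in> carrier A1" "b \<in> carrier A2" "m0 a \<subseteq> n0 b" for a b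
  proof (rule ccontr)
    assume "\<not> ?thesis"
    then have p: "(a, b) \<in> P" using ab by (simp add: P_def)
    \<comment> \<open>the identity sequence satisfies \<open>a\<close> but not \<open>b\<close> in the factor belonging to \<open>(a, b)\<close>\<close>
    define s :: "'i + nat \<Rightarrow> ('a1 + 'a2, 'i) idx" where "s = case_sum Base (\<lambda>_. Base undefined)"
    have s: "s \<circ> Inl = Base" by (simp add: s_def fun_eq_iff)
    have "Base \<in> index_seqs \<alpha>" by (simp add: index_seqs_def)
    then have "((a, b), s) \<in> m0 a"
      using apart(1)[OF p] p s by (simp add: m0_def model_set_def V_def)
    then have "((a, b), s) \<in> n0 b" using ab(3) by blast
    then show False using apart(2)[OF p] s by (simp add: n0_def model_set_def)
  qed
  have m0_ops: "m0 (\<ominus>\<^bsub>A1\<^esub> x) = V - m0 x" "m0 (x \<otimes>\<^bsub>A1\<^esub> y) = m0 x \<inter> m0 y"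
    if "x \<in> carrier A1" "y \<in> carrier A1" for x y
    using m0 that by (simp_all add: homomorphism_def neat_reduct_def B_def saturated_algebra_def)
  have n0_ops: "n0 (\<ominus>\<^bsub>A2\<^esub> x) = V - n0 x" "n0 (x \<otimes>\<^bsub>A2\<^esub> y) = n0 x \<inter> n0 y"
    if "x \<in> carrier A2" "y \<in> carrier A2" for x y
    using n0 that by (simp_all add: homomorphism_def neat_reduct_def B_def saturated_algebra_def)
  have m0V: "m0 x \<subseteq> V" and n0V: "n0 y \<subseteq> V" for x y by (auto simp: m0_def n0_def model_set_def)
  have f_ops: "f (\<ominus>\<^bsub>A0\<^esub> t) = \<ominus>\<^bsub>A1\<^esub> (f t)" "g (\<ominus>\<^bsub>A0\<^esub> t) = \<ominus>\<^bsub>A2\<^esub> (g t)" if "t \<in> carrier A0" for t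
    using f g that by (simp_all add: monomorphism_def homomorphism_def)
  have fg_zero: "f \<zero>\<^bsub>A0\<^esub> = \<zero>\<^bsub>A1\<^esub>" "g \<zero>\<^bsub>A0\<^esub> = \<zero>\<^bsub>A2\<^esub>"
    using f g by (simp_all add: monomorphism_def homomorphism_def)
  have inter2: "\<exists>t\<in>carrier A0. b \<sqsubseteq>\<^bsub>A2\<^esub> g t \<and> f t \<sqsubseteq>\<^bsub>A1\<^esub> a"
    if ab: "a \<in> carrier A1" "b \<in> carrier A2" "n0 b \<subseteq> m0 a" for a b
  proof -
    have neg: "\<ominus>\<^bsub>A1\<^esub> a \<in> carrier A1" "\<ominus>\<^bsub>A2\<^esub> b \<in> carrier A2"
      using ab one.neg_closed two.neg_closed by auto
    have "m0 (\<ominus>\<^bsub>A1\<^esub> a) \<subseteq> n0 (\<ominus>\<^bsub>A2\<^esub> b)" using ab m0_ops(1) n0_ops(1) by blast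
    from inter1[OF neg this] obtain t where t: "t \<in> carrier A0"
      "\<ominus>\<^bsub>A1\<^esub> a \<sqsubseteq>\<^bsub>A1\<^esub> f t" "g t \<sqsubseteq>\<^bsub>A2\<^esub> \<ominus>\<^bsub>A2\<^esub> b" by blast
    have ft: "f t \<in> carrier A1" "g t \<in> carrier A2" using t f_closed g_closed by auto
    have nt: "\<ominus>\<^bsub>A0\<^esub> t \<in> carrier A0" using t zero.neg_closed by blast
    have "tuples (Field \<alpha>) U1 - \<rho>1 a \<subseteq> \<rho>1 (f t)" "\<rho>2 (g t) \<subseteq> tuples (Field \<alpha>) U2 - \<rho>2 b"
      using t ab ft neg le_iff_subset by (simp_all add: one.hom_neg two.hom_neg)
    then have "\<rho>2 b \<subseteq> \<rho>2 (g (\<ominus>\<^bsub>A0\<^esub> t))" "\<rho>1 (f (\<ominus>\<^bsub>A0\<^esub> t)) \<subseteq> \<rho>1 a"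
      using t ft two.hom_sub[OF ab(2)] by (auto simp: f_ops one.hom_neg two.hom_neg)
    then show ?thesis using nt ab le_iff_subset f_closed[OF nt] g_closed[OF nt] by blast
  qed
  \<comment> \<open>an interpolant between an element of the kernel and zero is mapped to zero by \<open>g\<close>, so it is zero\<close>
  have zero1: "\<rho>1 z = {}" if z: "z \<in> carrier A1" "m0 z = {}" for z
  proof -
    obtain t where t: "t \<in> carrier A0" "z \<sqsubseteq>\<^bsub>A1\<^esub> f t" "g t \<sqsubseteq>\<^bsub>A2\<^esub> \<zero>\<^bsub>A2\<^esub>"
      using inter1[OF z(1) two.zero_closed] z(2) by blast
    then have "\<rho>2 (g t) = \<rho>2 (g \<zero>\<^bsub>A0\<^esub>)"
      using le_iff_subset(2) g_closed two.zero_closed two.hom_zero by (simp add: fg_zero)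
    then have "t = \<zero>\<^bsub>A0\<^esub>"
      using t(1) faithful2 g g_closed zero.zero_closed unfolding monomorphism_def inj_on_def by metis
    then show ?thesis using t(2) z(1) le_iff_subset(1) one.zero_closed one.hom_zero by (simp add: fg_zero)
  qed
  have zero2: "\<rho>2 z = {}" if z: "z \<in> carrier A2" "n0 z = {}" for z
  proof -
    obtain t where t: "t \<in> carrier A0" "z \<sqsubseteq>\<^bsub>A2\<^esub> g t" "f t \<sqsubseteq>\<^bsub>A1\<^esub> \<zero>\<^bsub>A1\<^esub>"
      using inter2[OF one.zero_closed z(1)] z(2) by blast
    then have "\<rho>1 (f t) = \<rho>1 (f \<zero>\<^bsub>A0\<^esub>)"
      using le_iff_subset(1) f_closed one.zero_closed one.hom_zero by (simp add: fg_zero)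
    then have "t = \<zero>\<^bsub>A0\<^esub>"
      using t(1) faithful1 f f_closed zero.zero_closed unfolding monomorphism_def inj_on_def by metis
    then show ?thesis using t(2) z(1) le_iff_subset(2) two.zero_closed two.hom_zero by (simp add: fg_zero)
  qed
  have sub1: "\<rho>1 x \<subseteq> \<rho>1 y" if xy: "x \<in> carrier A1" "y \<in> carrier A1" "m0 x = m0 y" for x y
  proof -
    have "m0 (x \<otimes>\<^bsub>A1\<^esub> \<ominus>\<^bsub>A1\<^esub> y) = {}"
      using xy m0_ops one.neg_closed by (auto simp: m0_ops)
    from zero1[OF one.mult_closed[OF xy(1) one.neg_closed[OF xy(2)]] this]
    have "\<rho>1 x \<inter> (tuples (Field \<alpha>) U1 - \<rho>1 y) = {}"
      using xy by (simp add: one.hom_mult one.hom_neg one.neg_closed)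
    then show ?thesis using one.hom_sub[OF xy(1)] by blast
  qed
  have sub2: "\<rho>2 x \<subseteq> \<rho>2 y" if xy: "x \<in> carrier A2" "y \<in> carrier A2" "n0 x = n0 y" for x y
  proof -
    have "n0 (x \<otimes>\<^bsub>A2\<^esub> \<ominus>\<^bsub>A2\<^esub> y) = {}"
      using xy n0_ops two.neg_closed by (auto simp: n0_ops)
    from zero2[OF two.mult_closed[OF xy(1) two.neg_closed[OF xy(2)]] this]
    have "\<rho>2 x \<inter> (tuples (Field \<alpha>) U2 - \<rho>2 y) = {}"
      using xy by (simp add: two.hom_mult two.hom_neg two.neg_closed)
    then show ?thesis using two.hom_sub[OF xy(1)] by blast
  qed
  have mono_m: "monomorphism \<alpha> A1 D m"
    unfolding monomorphism_def
  proof (intro conjI hom_m inj_onI)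
    fix x y assume xy: "x \<in> carrier A1" "y \<in> carrier A1" "m x = m y"
    then have "d (e (m0 x)) = d (e (m0 y))" by (simp add: m_def)
    then have "m0 x = m0 y" using d m0S xy by (simp add: image_subset_iff)
    then have "\<rho>1 x = \<rho>1 y" using sub1[OF xy(1,2)] sub1[OF xy(2,1)] by simp
    then show "x = y" using faithful1 xy unfolding inj_on_def by blast
  qed
  have mono_n: "monomorphism \<alpha> A2 D n"
    unfolding monomorphism_def
  proof (intro conjI hom_n inj_onI)
    fix x y assume xy: "x \<in> carrier A2" "y \<in> carrier A2" "n x = n y"
    then have "d (e (n0 x)) = d (e (n0 y))" by (simp add: n_def)
    then have "n0 x = n0 y" using d n0S xy by (simp add: image_subset_iff)
    then have "\<rho>2 x = \<rho>2 y" using sub2[OF xy(1,2)] sub2[OF xy(2,1)] by simp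
    then show "x = y" using faithful2 xy unfolding inj_on_def by blast
  qed
  have comm: "(m \<circ> f) t = (n \<circ> g) t" if t: "t \<in> carrier A0" for t
  proof -
    have "m0 (f t) = n0 (g t)"
      using agree[OF _ t] by (auto simp: m0_def n0_def model_set_def V_def)
    then show ?thesis by (simp add: m_def n_def)
  qed
  show ?thesis
  proof (rule exI[of _ D], rule exI[of _ m], rule exI[of _ n], intro conjI ballI impI D mono_m mono_n comm)
    fix a b assume ab: "a \<in> carrier A1" "b \<in> carrier A2"
    have S_ab: "m0 a \<in> S" "n0 b \<in> S" using ab m0S n0S by auto
    show "\<exists>t\<in>carrier A0. a \<sqsubseteq>\<^bsub>A1\<^esub> f t \<and> g t \<sqsubseteq>\<^bsub>A2\<^esub> b" if "m a \<sqsubseteq>\<^bsub>D\<^esub> n b"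
      using inter1[OF ab] le_D[OF S_ab] that by (simp add: m_def n_def)
    show "\<exists>t\<in>carrier A0. b \<sqsubseteq>\<^bsub>A2\<^esub> g t \<and> f t \<sqsubseteq>\<^bsub>A1\<^esub> a" if "n b \<sqsubseteq>\<^bsub>D\<^esub> m a"
      using inter2[OF ab] le_D[OF S_ab(2,1)] that by (simp add: m_def n_def)
  qed
qed

theorem theorem1p13:
  fixes \<alpha> :: "'i rel"
    and A0 :: "('a0, 'i) cyl_alg"
    and A1 :: "('a1, 'i) cyl_alg"
    and A2 :: "('a2, 'i) cyl_alg"
    and f :: "'a0 \<Rightarrow> 'a1"
    and g :: "'a0 \<Rightarrow> 'a2"
  assumes "Well_order \<alpha>" and "(natLeq, \<alpha>) \<in> ordLeq"
    and "A0 \<in> Dc \<alpha>"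
    and "A1 \<in> RCA TYPE('k1) TYPE('u1) \<alpha>"
    and "A2 \<in> RCA TYPE('k2) TYPE('u2) \<alpha>"
    and "monomorphism \<alpha> A0 A1 f"
    and "monomorphism \<alpha> A0 A2 g"
  shows "\<exists>(D :: (('a1, 'a2, 'i) amalgam, 'i) cyl_alg) m n.
     D \<in> Nr_CA \<alpha> natLeq \<and>
     monomorphism \<alpha> A1 D m \<and>
     monomorphism \<alpha> A2 D n \<and>
     (\<forall>x\<in>carrier A0. (m \<circ> f) x = (n \<circ> g) x) \<and>
     (\<forall>a\<in>carrier A1. \<forall>b\<in>carrier A2.
        (m a \<sqsubseteq>\<^bsub>D\<^esub> n b \<longrightarrow> (\<exists>t\<in>carrier A0. a \<sqsubseteq>\<^bsub>A1\<^esub> f t \<and> g t \<sqsubseteq>\<^bsub>A2\<^esub> b)) \<and>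
        (n b \<sqsubseteq>\<^bsub>D\<^esub> m a \<longrightarrow> (\<exists>t\<in>carrier A0. b \<sqsubseteq>\<^bsub>A2\<^esub> g t \<and> f t \<sqsubseteq>\<^bsub>A1\<^esub> a)))"
proof -
  have inf: "infinite (Field \<alpha>)"
    by (rule card_of_ordLeq_infinite[OF card_of_mono2[OF assms(2)]]) (simp add: Field_natLeq)
  then have ne: "Field \<alpha> \<noteq> {}" by auto
  obtain U1 :: "'k1 + 'k2 \<Rightarrow> ('u1 + 'u2) set" and \<rho>1 where 1: "set_hom \<alpha> A1 U1 \<rho>1"
    "inj_on \<rho>1 (carrier A1)" "\<forall>k. U1 k \<noteq> {} \<longrightarrow> k \<in> range Inl"
    using RCA_faithful_set_hom[OF assms(4) inj_Inl inj_Inl ne] by blast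
  obtain U2 :: "'k1 + 'k2 \<Rightarrow> ('u1 + 'u2) set" and \<rho>2 where 2: "set_hom \<alpha> A2 U2 \<rho>2"
    "inj_on \<rho>2 (carrier A2)" "\<forall>k. U2 k \<noteq> {} \<longrightarrow> k \<in> range Inr"
    using RCA_faithful_set_hom[OF assms(5) inj_Inr inj_Inr ne] by blast
  have "U1 k = {} \<or> U2 k = {}" for k using 1(3) 2(3) by (cases k) auto
  with assms inf 1 2 interpret amalgamation_problem \<alpha> A0 A1 A2 f g U1 U2 \<rho>1 \<rho>2
    by (simp add: amalgamation_problem_def)
  show ?thesis by (rule super_amalgam_exists)
qed

end
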